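(* Let $L\ge 1$, let $n_0,n_1,\dots,n_L\ge 1$ be integers, let $\sigma:\mathbb{R}\to\mathbb{R}$ be Lipschitz, and let $f^{(L)}:\mathbb{R}^{n_0}\to\mathbb{R}^{n_L}$ be the fully connected neural network with activation $\sigma$ whose weights $(W^{(\ell)})_{\ell=1}^L$ and biases $(b^{(\ell)})_{\ell=1}^L$ have independent centered Gaussian entries with $\mathbb{E}[(W^{(\ell)}_{i,j})^2]=1/n_{\ell-1}$ and $\mathbb{E}[(b^{(\ell)}_i)^2]=1$ for all $\ell,i,j$. Let $\{(x_i,y_i)\}_{i\in\mathcal{D}}\subseteq\mathbb{R}^{n_0}\times\mathbb{R}^{n_L}$ be a finite training dataset and $\{x_j\}_{j\in\mathcal{T}}\subseteq\mathbb{R}^{n_0}$ a finite test set, and put $\mathcal{X}:=\{x_i\}_{i\in\mathcal{D}}\cup\{x_j\}_{j\in\mathcal{T}}$. Let $K^{(\ell)}[\mathcal{X}]$, $\ell=1,\dots,L$, be the infinite-width covariance matrices on $\mathcal{X}$ and $G^{(L)}_{n_L}$ the associated Gaussian process on $\mathcal{X}$, consisting of $n_L$ independent centered Gaussian components each with covariance $K^{(L)}[\mathcal{X}]$. Given the Gaussian likelihood $$\mathcal{L}((z_i)_{i\in\mathcal{D}}):=\exp\Big(-\sum_{i\in\mathcal{D}}\|z_i-y_i\|^2\Big),$$ let $f^{(L)}[\mathcal{X}]_{|\mathcal{D}}$ and $G^{(L)}_{n_L}[\mathcal{X}]_{|\mathcal{D}}$ denote the Bayesian posterior distributions of $f^{(L)}[\mathcal{X}]$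 and $G^{(L)}_{n_L}[\mathcal{X}]$, obtained from Bayes' rule with likelihood $\mathcal{L}$ evaluated at $z_i=f^{(L)}(x_i)$, respectively $z_i=G^{(L)}_{n_L}(x_i)$, $i\in\mathcal{D}$. (a) If all the matrices $K^{(1)}[\mathcal{X}],\dots,K^{(L)}[\mathcal{X}]$ are invertible, then $$\mathcal{W}_1\big(f^{(L)}[\mathcal{X}]_{|\mathcal{D}},G^{(L)}_{n_L}[\mathcal{X}]_{|\mathcal{D}}\big)\le\mathsf{c}\sum_{\ell=1}^{L-1}\frac1{n_\ell}.$$ (b) In general, $$\mathcal{W}_1\big(f^{(L)}[\mathcal{X}]_{|\mathcal{D}},G^{(L)}_{n_L}[\mathcal{X}]_{|\mathcal{D}}\big)\le\mathsf{c}\sum_{\ell=1}^{L-1}\frac1{\sqrt{n_\ell}}.$$ In both cases the constant $\mathsf{c}<\infty$ does not depend on the hidden layer widths $(n_i)_{i=1}^{L-1}$.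
   Context: Fully connected network: $W^{(\ell)}\in\mathbb{R}^{n_\ell\times n_{\ell-1}}$, $b^{(\ell)}\in\mathbb{R}^{n_\ell}$; $f^{(1)}(x)=W^{(1)}x+b^{(1)}$ and, for $\ell=2,\dots,L$, $f^{(\ell)}(x)=W^{(\ell)}\sigma(f^{(\ell-1)}(x))+b^{(\ell)}$, with $\sigma$ applied componentwise. $f^{(L)}[\mathcal{X}]=(f^{(L)}(x))_{x\in\mathcal{X}}$. Infinite-width covariances (matrices indexed by $x,x'\in\mathcal{X}$): $K^{(1)}[\mathcal{X}]_{x,x'}=1+\frac{1}{n_0}\langle x,x'\rangle$ and, for $\ell\ge2$, $K^{(\ell)}[\mathcal{X}]_{x,x'}=1+\mathbb{E}[\sigma(g_x)\sigma(g_{x'})]$ where $(g_x)_{x\in\mathcal{X}}$ is a centered Gaussian vector with covariance $K^{(\ell-1)}[\mathcal{X}]$. Posterior: if $F=(F(x))_{x\in\mathcal{X}}$ is a random element of $\mathbb{R}^{n_L\times\mathcal{X}}$ with law $\mu$, its posterior $F_{|\mathcal{D}}$ is the probability measure on $\mathbb{R}^{n_L\times\mathcal{X}}$ with density $z\mapsto \mathcal{L}((z(x_i))_{i\in\mathcal{D}})/\mathbb{E}[\mathcal{L}((F(x_i))_{i\in\mathcal{D}})]$ with respect to $\mu$. $\mathcal{W}_1$ is the Wasserstein distance of order $1$ with respect to the Euclidean norm. The constants $\mathsf{c}$ may depend on everything except the hidden widths (e.g. on $n_0$, $n_L$, $L$, $\sigma$, the datasets and the matrices $K^{(\ell)}[\mathcal{X}]$).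 Empty sums are $0$. *)

theory Defs
  imports "HOL-Probability.Probability"
begin

text \<open>
  Vectors of \<open>\<real>\<^sup>n\<close> are functions on \<open>{..<n}\<close>, extensional where equality of vectors matters
  (the points of a data set form a set).  An element of \<open>\<real>\<^bsup>n\<^sub>L \<times> X\<^esup>\<close> is a function
  \<open>z\<close> with entries \<open>z k p\<close> for \<open>k < n\<^sub>L\<close> and \<open>p \<in> X\<close>.
\<close>

type_synonym vec = "nat \<Rightarrow> real"
type_synonym outputs = "nat \<Rightarrow> vec \<Rightarrow> real"

definition output_space :: "nat \<Rightarrow> vec set \<Rightarrow> outputs measure" where
  "output_space m X = (\<Pi>\<^sub>M k\<in>{..<m}. \<Pi>\<^sub>M p\<in>X. borel)"

definition output_dist :: "nat \<Rightarrow> vec set \<Rightarrow> outputs \<Rightarrow> outputs \<Rightarrow> real" where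
  "output_dist m X z z' = L2_set (\<lambda>(k, p). z k p - z' k p) ({..<m} \<times> X)"


section \<open>Wasserstein distance\<close>

definition couplings :: "'a measure \<Rightarrow> 'b measure \<Rightarrow> ('a \<times> 'b) measure set" where
  "couplings \<mu> \<nu> = {\<gamma>. sets \<gamma> = sets (\<mu> \<Otimes>\<^sub>M \<nu>) \<and> distr \<gamma> \<mu> fst = \<mu> \<and> distr \<gamma> \<nu> snd = \<nu>}"

definition wasserstein1 :: "('a \<Rightarrow> 'a \<Rightarrow> real) \<Rightarrow> 'a measure \<Rightarrow> 'a measure \<Rightarrow> ennreal" where
  "wasserstein1 d \<mu> \<nu> = (INF \<gamma>\<in>couplings \<mu> \<nu>. \<integral>\<^sup>+ z. ennreal (d (fst z) (snd z)) \<partial>\<gamma>)"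


section \<open>Fully connected networks with random Gaussian parameters\<close>

text \<open>
  The function \<open>n\<close> lists the widths: \<open>n 0\<close> is the input and \<open>n L\<close> the output dimension.
  \<open>W l i j\<close> and \<open>b l i\<close> are the weights and biases of layer \<open>l \<ge> 1\<close>, with \<open>i < n l\<close> and
  \<open>j < n (l - 1)\<close>; the value of the network at layer \<open>0\<close> is irrelevant.
\<close>

fun network :: "(nat \<Rightarrow> nat) \<Rightarrow> (real \<Rightarrow> real) \<Rightarrow> (nat \<Rightarrow> nat \<Rightarrow> nat \<Rightarrow> real) \<Rightarrow> (nat \<Rightarrow> nat \<Rightarrow> real)
    \<Rightarrow> nat \<Rightarrow> vec \<Rightarrow> vec" where
  "network n \<sigma> W b 0 x = x"
| "network n \<sigma> W b (Suc 0) x = (\<lambda>i. (\<Sum>j<n 0. W 1 i j * x j) + b 1 i)"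
| "network n \<sigma> W b (Suc (Suc l)) x =
    (\<lambda>i. (\<Sum>j<n (Suc l). W (Suc (Suc l)) i j * \<sigma> (network n \<sigma> W b (Suc l) x j))
      + b (Suc (Suc l)) i)"

text \<open>Weights and biases are collected in one index type to express their joint independence.\<close>

datatype param = Weight nat nat nat | Bias nat nat

definition params :: "(nat \<Rightarrow> nat) \<Rightarrow> nat \<Rightarrow> param set" where
  "params n L = {Weight l i j | l i j. l \<in> {1..L} \<and> i < n l \<and> j < n (l - 1)}
    \<union> {Bias l i | l i. l \<in> {1..L} \<and> i < n l}"

definition gaussian_params :: "'w measure \<Rightarrow> (nat \<Rightarrow> nat) \<Rightarrow> nat
    \<Rightarrow> (nat \<Rightarrow> nat \<Rightarrow> nat \<Rightarrow> 'w \<Rightarrow> real) \<Rightarrow> (nat \<Rightarrow> nat \<Rightarrow> 'w \<Rightarrow> real) \<Rightarrow> bool" where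
  "gaussian_params M n L W b \<longleftrightarrow>
    prob_space M \<and>
    prob_space.indep_vars M (\<lambda>_. borel)
      (\<lambda>q. case q of Weight l i j \<Rightarrow> W l i j | Bias l i \<Rightarrow> b l i) (params n L) \<and>
    (\<forall>l\<in>{1..L}. \<forall>i<n l. \<forall>j<n (l - 1).
      distributed M lborel (W l i j) (normal_density 0 (sqrt (1 / real (n (l - 1)))))) \<and>
    (\<forall>l\<in>{1..L}. \<forall>i<n l. distributed M lborel (b l i) (normal_density 0 1))"

definition network_law :: "'w measure \<Rightarrow> (nat \<Rightarrow> nat) \<Rightarrow> (real \<Rightarrow> real)
    \<Rightarrow> (nat \<Rightarrow> nat \<Rightarrow> nat \<Rightarrow> 'w \<Rightarrow> real) \<Rightarrow> (nat \<Rightarrow> nat \<Rightarrow> 'w \<Rightarrow> real)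
    \<Rightarrow> nat \<Rightarrow> vec set \<Rightarrow> outputs measure" where
  "network_law M n \<sigma> W b L X = distr M (output_space (n L) X)
    (\<lambda>\<omega>. \<lambda>k\<in>{..<n L}. \<lambda>p\<in>X. network n \<sigma> (\<lambda>l i j. W l i j \<omega>) (\<lambda>l i. b l i \<omega>) L p k)"


section \<open>Gaussian vectors with possibly singular covariance\<close>

text \<open>
  \<^const>\<open>normal_density\<close> with standard deviation \<open>0\<close> is the zero function, so the degenerate
  normal distribution has to be treated separately.
\<close>

definition centered_normal :: "real \<Rightarrow> real measure" where
  "centered_normal v =
    (if v = 0 then return borel 0 else density lborel (normal_density 0 (sqrt v)))"

definition is_centered_gaussian :: "'a set \<Rightarrow> ('a \<Rightarrow> 'a \<Rightarrow> real) \<Rightarrow> ('a \<Rightarrow> real) measure \<Rightarrow> bool" where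
  "is_centered_gaussian I K \<mu> \<longleftrightarrow>
    sets \<mu> = sets (\<Pi>\<^sub>M i\<in>I. borel) \<and>
    (\<forall>t. distr \<mu> borel (\<lambda>g. \<Sum>i\<in>I. t i * g i) =
      centered_normal (\<Sum>i\<in>I. \<Sum>j\<in>I. t i * K i j * t j))"

text \<open>
  For finite \<open>I\<close> and symmetric positive semidefinite \<open>K\<close>, such a measure exists and is unique:
  a law on \<open>\<real>\<^sup>I\<close> is determined by the laws of the linear combinations of the coordinates.
\<close>

definition centered_gaussian :: "'a set \<Rightarrow> ('a \<Rightarrow> 'a \<Rightarrow> real) \<Rightarrow> ('a \<Rightarrow> real) measure" where
  "centered_gaussian I K = (THE \<mu>. is_centered_gaussian I K \<mu>)"

definition invertible_matrix_on :: "'a set \<Rightarrow> ('a \<Rightarrow> 'a \<Rightarrow> real) \<Rightarrow> bool" where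
  "invertible_matrix_on I A \<longleftrightarrow> (\<exists>B. \<forall>i\<in>I. \<forall>j\<in>I.
    (\<Sum>k\<in>I. A i k * B k j) = (if i = j then 1 else 0) \<and>
    (\<Sum>k\<in>I. B i k * A k j) = (if i = j then 1 else 0))"


section \<open>Infinite-width limit\<close>

text \<open>Layers are numbered from \<open>1\<close>; the value at layer \<open>0\<close> is irrelevant.\<close>

fun limit_cov :: "nat \<Rightarrow> (real \<Rightarrow> real) \<Rightarrow> vec set \<Rightarrow> nat \<Rightarrow> vec \<Rightarrow> vec \<Rightarrow> real" where
  "limit_cov n\<^sub>0 \<sigma> X 0 p q = 0"
| "limit_cov n\<^sub>0 \<sigma> X (Suc 0) p q = 1 + 1 / real n\<^sub>0 * (\<Sum>j<n\<^sub>0. p j * q j)"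
| "limit_cov n\<^sub>0 \<sigma> X (Suc (Suc l)) p q =
    1 + (\<integral>g. \<sigma> (g p) * \<sigma> (g q) \<partial>centered_gaussian X (limit_cov n\<^sub>0 \<sigma> X (Suc l)))"

text \<open>The product measure makes the \<open>m\<close> components independent copies.\<close>

definition limit_law :: "nat \<Rightarrow> (real \<Rightarrow> real) \<Rightarrow> nat \<Rightarrow> nat \<Rightarrow> vec set \<Rightarrow> outputs measure" where
  "limit_law n\<^sub>0 \<sigma> L m X = (\<Pi>\<^sub>M k\<in>{..<m}. centered_gaussian X (limit_cov n\<^sub>0 \<sigma> X L))"


section \<open>Bayesian posterior\<close>

definition gaussian_likelihood :: "nat \<Rightarrow> 'i set \<Rightarrow> ('i \<Rightarrow> vec) \<Rightarrow> ('i \<Rightarrow> vec) \<Rightarrow> real" where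
  "gaussian_likelihood m D y z = exp (- (\<Sum>i\<in>D. (L2_set (\<lambda>k. z i k - y i k) {..<m})\<^sup>2))"

definition posterior :: "(('i \<Rightarrow> vec) \<Rightarrow> real) \<Rightarrow> ('i \<Rightarrow> vec) \<Rightarrow> outputs measure \<Rightarrow> outputs measure" where
  "posterior lik x \<mu> = density \<mu> (\<lambda>z. ennreal
    (lik (\<lambda>i k. z k (x i)) / (\<integral>u. lik (\<lambda>i k. u k (x i)) \<partial>\<mu>)))"

end

theory Submission
  imports Defs
begin

text \<open>
  Conditionally on layer \<open>l\<close>, the outputs of layer \<open>l + 1\<close> are independent Gaussian rows whose covariance
  \<open>A\<close> is the empirical covariance of the activations, so every layer is a mixture of the laws
  \<open>N(0, A)\<close>.  By induction on the layers, \<open>A\<close> has bias and variance \<open>O(\<Sum> 1 / n l)\<close> around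
  the limit covariance \<open>K\<close>: for a test function \<open>f\<close> of quadratic growth, merely measurable,
  \<open>\<integral> f dN(0, A)\<close> agrees with a linear function of \<open>A - K\<close> up to \<open>O(|A - K|\<^sup>2)\<close>, so
  the bias of \<open>A\<close> enters at first order and its fluctuations only at second order.  The same
  expansion for the output layer bounds a weighted total variation distance, which passes to the
  posteriors and dominates \<open>W\<^sub>1\<close>.

  The covariance \<open>K\<close> may be singular.  Almost surely the null space of \<open>K\<close> is contained in that
  of \<open>A\<close>, and then \<open>A = \<Sum> (1 + u j) v j (v j)\<^sup>T\<close> for fixed vectors \<open>v j\<close> and
  coefficients \<open>u j\<close> that are linear in \<open>A - K\<close>; the expansion thus reduces to the densities of
  one-dimensional normal distributions of variance \<open>1 + u j\<close>.  Hence the rate \<open>\<Sum> 1 / n l\<close> holds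
  without any invertibility, and it implies the weaker rate \<open>\<Sum> 1 / sqrt (n l)\<close>.
\<close>

section \<open>Measures determined by linear functionals\<close>

text \<open>The coupling behind the Wasserstein bound tests the two laws with a weight cut off to
  the set where one density exceeds the other. Such tests are discontinuous, so the derivative in
  the covariance has to fall on the Gaussian density. Quadratic growth suits every test that occurs:
  the norm times the likelihood, the likelihood itself, the squared norm (whose mean must stay
  bounded uniformly in the widths) and, after scaling, products of two activations.

  The obstacle at a singular K is that centered Gaussian laws with different supports are mutually
  singular. The inclusion of null spaces survives a layer because a relation between activations
  that holds almost surely in the limit holds on the whole limit support, which the rows of the
  finite network do not leave. Far from K there is no density expansion, but there |A - K| is
  bounded below and moments suffice.

  The induction carries bias and mean square separately, both of order e: the mean square alone
  would bound the linear term of the expansion only by the square root of e.\<close>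

lemma finite_measure_eqI_char:
  assumes "finite_measure M1" "finite_measure M2"
    and sets: "sets M1 = sets borel" "sets M2 = sets borel"
    and char: "\<And>t. char M1 t = char M2 t"
  shows "M1 = M2"
proof -
  interpret M1: finite_measure M1 by fact
  interpret M2: finite_measure M2 by fact
  have sp: "space M1 = UNIV" "space M2 = UNIV"
    using sets by (auto dest: sets_eq_imp_space_eq)
  define c where "c = measure M1 UNIV"
  have "complex_of_real (measure M1 UNIV) = of_real (measure M2 UNIV)"
    using char[of 0] by (simp add: char_def sp)
  then have c: "measure M1 UNIV = c" "measure M2 UNIV = c"
    by (auto simp: c_def)
  show ?thesis
  proof (cases "c = 0")
    case True
    have "emeasure M1 A = 0" "emeasure M2 A = 0" for A
    proof -
      have "emeasure M1 A \<le> emeasure M1 (space M1)" by (rule emeasure_space)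
      then show "emeasure M1 A = 0" using c True by (simp add: M1.emeasure_eq_measure sp)
      have "emeasure M2 A \<le> emeasure M2 (space M2)" by (rule emeasure_space)
      then show "emeasure M2 A = 0" using c True by (simp add: M2.emeasure_eq_measure sp)
    qed
    then show ?thesis by (intro measure_eqI) (auto simp: sets)
  next
    case False
    then have pos: "c > 0" by (simp add: c_def zero_less_measure_iff)
    \<comment> \<open>Levy's theorem concerns probability measures. Both total masses are the value
      of \<open>char\<close> at \<open>0\<close>, so dividing by the common mass \<open>c\<close>
      makes it applicable.\<close>
    have rd: "real_distribution (density M (\<lambda>_. ennreal (1 / c)))"
      if "finite_measure M" "sets M = sets borel" "measure M UNIV = c" for M
    proof -
      interpret finite_measure M by fact
      have [simp]: "space M = UNIV" using that(2) by (auto dest: sets_eq_imp_space_eq)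
      have "emeasure (density M (\<lambda>_. ennreal (1 / c))) (space M) = ennreal (1 / c) * ennreal c"
        using that(2,3) by (simp add: emeasure_density emeasure_eq_measure)
      also have "\<dots> = 1"
        using pos by (simp flip: ennreal_mult'')
      finally have "emeasure (density M (\<lambda>_. ennreal (1 / c))) (space M) = 1" .
      then have "prob_space (density M (\<lambda>_. ennreal (1 / c)))"
        by (intro prob_spaceI) simp
      then show ?thesis
        by (simp add: real_distribution_def real_distribution_axioms_def that)
    qed
    have ch: "char (density M (\<lambda>_. ennreal (1 / c))) t = char M t / c"
      if "finite_measure M" "sets M = sets borel" for M t
    proof -
      have [measurable_cong]: "sets M = sets borel" by fact
      show ?thesis using pos
        unfolding char_def
        by (subst integral_density) (simp_all add: scaleR_conv_of_real)
    qed
    have "density M1 (\<lambda>_. ennreal (1 / c)) = density M2 (\<lambda>_. ennreal (1 / c))"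
      by (intro Levy_uniqueness rd) (auto simp: assms c fun_eq_iff ch)
    then have "emeasure (density M1 (\<lambda>_. ennreal (1 / c))) A = emeasure (density M2 (\<lambda>_. ennreal (1 / c))) A" for A
      by simp
    from this have "ennreal (1 / c) * emeasure M1 A = ennreal (1 / c) * emeasure M2 A" if "A \<in> sets borel" for A
      using that emeasure_density_const[of A M1] emeasure_density_const[of A M2] by (metis sets)
    then show ?thesis
      using pos by (intro measure_eqI) (auto simp: sets ennreal_mult_cancel_left)
  qed
qed

text \<open>
  Induction on the coordinates: weighting a measure by the nonnegative functions
  \<open>1 + cos (s * x i + c)\<close> keeps track of the coordinate \<open>i\<close> while the others are determined by the
  induction hypothesis, and Levy's theorem then recovers the coordinate \<open>i\<close>.
\<close>

lemma PiM_borel_eqI_char: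
  fixes \<mu> \<nu> :: "('a \<Rightarrow> real) measure"
  assumes "finite I" "finite_measure \<mu>" "finite_measure \<nu>"
    and "sets \<mu> = sets (\<Pi>\<^sub>M i\<in>I. borel)" "sets \<nu> = sets (\<Pi>\<^sub>M i\<in>I. borel)"
    and "\<And>t. (\<integral>x. iexp (\<Sum>i\<in>I. t i * x i) \<partial>\<mu>) = (\<integral>x. iexp (\<Sum>i\<in>I. t i * x i) \<partial>\<nu>)"
  shows "\<mu> = \<nu>"
  using assms
proof (induction I arbitrary: \<mu> \<nu>)
  case empty
  interpret m: finite_measure \<mu> by fact
  interpret n: finite_measure \<nu> by fact
  have eq: "measure \<mu> (space \<mu>) = measure \<nu> (space \<nu>)"
    using empty.prems(5) by simp
  have sp: "space \<mu> = {\<lambda>x. undefined}" "space \<nu> = {\<lambda>x. undefined}"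
    using empty.prems(3,4)[THEN sets_eq_imp_space_eq] by (auto simp: space_PiM)
  show ?case
  proof (rule measure_eqI)
    fix A assume "A \<in> sets \<mu>"
    then have "A \<subseteq> {\<lambda>x. undefined}" using sets.sets_into_space sp by blast
    then have "A = {} \<or> A = {\<lambda>x. undefined}" by blast
    then show "emeasure \<mu> A = emeasure \<nu> A"
      using eq by (auto simp: sp m.emeasure_eq_measure n.emeasure_eq_measure)
  qed (simp add: empty)
next
  case (insert i I)
  interpret m: finite_measure \<mu> by fact
  interpret n: finite_measure \<nu> by fact
  note fin = insert.hyps(1) and notin = insert.hyps(2)
  let ?P = "\<lambda>J. \<Pi>\<^sub>M i\<in>J. (borel :: real measure)"
  define w where "w s c x = 1 + cos (s * x i + c)" for s c :: real and x :: "'a \<Rightarrow> real"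
  have w0: "0 \<le> w s c x" for s c x
    unfolding w_def using cos_ge_minus_one[of "s * x i + c"] by linarith
  have w2: "w s c x \<le> 2" for s c x
    unfolding w_def using cos_le_one[of "s * x i + c"] by linarith
  define wm where "wm M s c = distr (density M (\<lambda>x. ennreal (w s c x))) (?P I) (\<lambda>x. restrict x I)" for M s c
  have sums: "(\<Sum>j\<in>I. t j * restrict x I j) = (\<Sum>j\<in>I. t j * x j)" for t x by (rule sum.cong) auto
  have wint: "(\<integral>x. f x \<partial>wm M s c) = (\<integral>x. w s c x *\<^sub>R f (restrict x I) \<partial>M)"
    if M: "sets M = sets (?P (insert i I))" and f: "f \<in> borel_measurable (?P I)" for M s c and f :: "_ \<Rightarrow> complex"
  proof -
    have [measurable_cong]: "sets M = sets (?P (insert i I))" by fact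
    have [measurable]: "f \<in> borel_measurable (?P I)" by fact
    have [measurable]: "(\<lambda>x. restrict x I) \<in> measurable M (?P I)" by measurable
    have [measurable]: "w s c \<in> borel_measurable M" unfolding w_def by measurable
    show ?thesis unfolding wm_def
      by (subst integral_distr, simp, simp, subst integral_density) (auto simp: w0)
  qed
  \<comment> \<open>Writing the cosine with exponentials expresses the transform of the weighted
    measure by three values of the original one, with coordinate \<open>i\<close> of
    \<open>t\<close> set to \<open>0\<close>, \<open>s\<close> and \<open>-s\<close>.\<close>
  have char_w: "(\<integral>x. iexp (\<Sum>j\<in>I. t j * x j) \<partial>wm M s c)
     = (\<integral>x. iexp (\<Sum>j\<in>insert i I. (t(i:=0)) j * x j) \<partial>M)
       + iexp c / 2 * (\<integral>x. iexp (\<Sum>j\<in>insert i I. (t(i:=s)) j * x j) \<partial>M)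
       + iexp (-c) / 2 * (\<integral>x. iexp (\<Sum>j\<in>insert i I. (t(i:=-s)) j * x j) \<partial>M)"
    if M: "sets M = sets (?P (insert i I))" and "finite_measure M" for M s c t
  proof -
    interpret finite_measure M by fact
    have [measurable_cong]: "sets M = sets (?P (insert i I))" by fact
    have up: "(\<Sum>j\<in>insert i I. (t(i:=r)) j * x j) = r * x i + (\<Sum>j\<in>I. t j * x j)" for r x
    proof -
      have "(\<Sum>j\<in>I. (t(i:=r)) j * x j) = (\<Sum>j\<in>I. t j * x j)"
        using notin by (intro sum.cong) auto
      then show ?thesis using fin notin by simp
    qed
    have cw: "w s c x *\<^sub>R iexp S = iexp (0 * x i + S) + iexp c / 2 * iexp (s * x i + S) + iexp (-c)/2 * iexp (-s * x i + S)" for x S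
    proof -
      have c1: "complex_of_real (cos y) = (iexp y + iexp (-y)) / 2" for y
        using cos_exp_eq[of "complex_of_real y"] by (simp add: cos_of_real)
      have e: "iexp (a + b) = iexp a * iexp b" for a b
        by (simp add: exp_add ring_distribs)
      have "w s c x *\<^sub>R iexp S = iexp S + (iexp (s * x i + c) * iexp S + iexp (- s * x i + - c) * iexp S) / 2"
        unfolding w_def scaleR_conv_of_real of_real_add c1 by (simp add: ring_distribs)
      also have "\<dots> = iexp (0 * x i + S) + iexp c / 2 * iexp (s * x i + S) + iexp (-c)/2 * iexp (-s * x i + S)"
        unfolding e by (simp add: add_divide_distrib mult_ac)
      finally show ?thesis .
    qed
    have int: "integrable M (\<lambda>x. iexp (r * x i + (\<Sum>j\<in>I. t j * x j)))" for r
      by (rule integrable_const_bound[where B=1]) auto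
    have "(\<integral>x. iexp (\<Sum>j\<in>I. t j * x j) \<partial>wm M s c) = (\<integral>x. w s c x *\<^sub>R iexp (\<Sum>j\<in>I. t j * x j) \<partial>M)"
      by (subst wint[OF M]) (auto simp: sums)
    then show ?thesis unfolding up cw
      using int[of 0] int[of s] int[of "-s"] by simp
  qed
  have fm: "finite_measure (wm M s c)" if M: "sets M = sets (?P (insert i I))" and "finite_measure M" for M s c
  proof -
    interpret finite_measure M by fact
    have [measurable_cong]: "sets M = sets (?P (insert i I))" by fact
    have [measurable]: "(\<lambda>x. restrict x I) \<in> measurable M (?P I)" by measurable
    have [measurable]: "w s c \<in> borel_measurable M" unfolding w_def by measurable
    have "(\<integral>\<^sup>+ x. ennreal (w s c x) \<partial>M) \<le> (\<integral>\<^sup>+ x. 2 \<partial>M)"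
      by (intro nn_integral_mono) (use w2 in \<open>auto simp flip: ennreal_numeral\<close>)
    also have "\<dots> < \<infinity>" by (simp add: ennreal_mult_less_top emeasure_eq_measure)
    finally have "finite_measure (density M (\<lambda>x. ennreal (w s c x)))"
      by (intro finite_measureI) (simp add: emeasure_density cong: nn_integral_cong)
    then show ?thesis unfolding wm_def
      by (rule finite_measure.finite_measure_distr) simp
  qed
  have wm_eq: "wm \<mu> s c = wm \<nu> s c" for s c
  proof (rule insert.IH)
    show "(\<integral>x. iexp (\<Sum>j\<in>I. t j * x j) \<partial>wm \<mu> s c) = (\<integral>x. iexp (\<Sum>j\<in>I. t j * x j) \<partial>wm \<nu> s c)" for t
      unfolding char_w[OF insert.prems(3,1)] char_w[OF insert.prems(4,2)]
      by (simp only: insert.prems(5))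
  qed (use fm insert.prems in \<open>simp_all only: wm_def sets_distr\<close>)
  have main: "emeasure \<mu> {x \<in> space \<mu>. restrict x I \<in> A \<and> x i \<in> B} = emeasure \<nu> {x \<in> space \<nu>. restrict x I \<in> A \<and> x i \<in> B}"
    if A[measurable]: "A \<in> sets (?P I)" and B[measurable]: "B \<in> sets borel" for A B
  proof -
    define D where "D M = distr (density M (\<lambda>x. indicator A (restrict x I))) borel (\<lambda>x. x i)" for M :: "('a \<Rightarrow> real) measure"
    \<comment> \<open>The weight \<open>w 0 (pi/2)\<close> is constantly \<open>1\<close>;
      subtracting its integral removes the summand \<open>1\<close>, which was there for
      nonnegativity, and leaves the bare cosine.\<close>
    have cosint: "(\<integral>x. indicator A (restrict x I) * cos (s * x i + c) \<partial>\<mu>) = (\<integral>x. indicator A (restrict x I) * cos (s * x i + c) \<partial>\<nu>)" for s c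
    proof -
      have *: "complex_of_real (\<integral>x. indicator A (restrict x I) * cos (s * x i + c) \<partial>M)
         = (\<integral>x. indicator A x \<partial>wm M s c) - (\<integral>x. indicator A x \<partial>wm M 0 (pi/2))"
        if M: "sets M = sets (?P (insert i I))" and "finite_measure M" for M s c
      proof -
        interpret finite_measure M by fact
        have [measurable_cong]: "sets M = sets (?P (insert i I))" by fact
        have [measurable]: "(\<lambda>x. restrict x I) \<in> measurable M (?P I)" by measurable
        have [measurable]: "w s c \<in> borel_measurable M" for s c unfolding w_def by measurable
        have i1: "integrable M (\<lambda>x. w s c x *\<^sub>R (indicator A (restrict x I) :: complex))" for s c
          by (rule integrable_const_bound[where B=2]) (use w0 w2 in \<open>auto simp: indicator_def\<close>)
        show ?thesis
          unfolding integral_complex_of_real[symmetric]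
          apply (subst wint[OF M], simp, subst wint[OF M], simp)
          apply (subst Bochner_Integration.integral_diff[OF i1 i1, symmetric])
          apply (rule Bochner_Integration.integral_cong)
          by (auto simp: w_def indicator_def scaleR_conv_of_real)
      qed
      show ?thesis
        using trans[OF *[OF insert.prems(3,1), of s c] *[OF insert.prems(4,2), of s c, folded wm_eq, symmetric]]
        by (rule of_real_eq_iff[THEN iffD1])
    qed
    \<comment> \<open>The phase \<open>- pi/2\<close> turns the cosine into a sine, so
      \<open>cosint\<close> controls both the real and the imaginary part of the transform.\<close>
    have Dfin: "finite_measure (D M)" and Dchar: "char (D M) s = 
        complex_of_real (\<integral>x. indicator A (restrict x I) * cos (s * x i + 0) \<partial>M) +
        \<i> * complex_of_real (\<integral>x. indicator A (restrict x I) * cos (s * x i + (- pi/2)) \<partial>M)"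
      and Dem: "emeasure (D M) B = emeasure M {x \<in> space M. restrict x I \<in> A \<and> x i \<in> B}"
      if M: "sets M = sets (?P (insert i I))" and "finite_measure M" for M s
    proof -
      interpret finite_measure M by fact
      have [measurable_cong]: "sets M = sets (?P (insert i I))" by fact
      have [measurable]: "(\<lambda>x. restrict x I) \<in> measurable M (?P I)" by measurable
      have "(\<integral>\<^sup>+ x. indicator A (restrict x I) \<partial>M) \<le> (\<integral>\<^sup>+ x. 1 \<partial>M)"
        by (intro nn_integral_mono) (auto simp: indicator_def)
      also have "\<dots> < \<infinity>" by (simp add: emeasure_eq_measure)
      finally have "finite_measure (density M (\<lambda>x. indicator A (restrict x I)))"
        by (intro finite_measureI) (simp add: emeasure_density cong: nn_integral_cong)
      then show "finite_measure (D M)"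
        unfolding D_def by (rule finite_measure.finite_measure_distr) simp
      have i1: "integrable M (\<lambda>x. indicator A (restrict x I) * cos (s * x i + c))" for c
        by (rule integrable_const_bound[where B=1]) (auto simp: indicator_def)
      show "char (D M) s = 
        complex_of_real (\<integral>x. indicator A (restrict x I) * cos (s * x i + 0) \<partial>M) +
        \<i> * complex_of_real (\<integral>x. indicator A (restrict x I) * cos (s * x i + (- pi/2)) \<partial>M)"
      proof -
        have j: "integrable M (\<lambda>x. complex_of_real (indicator A (restrict x I) * cos (s * x i + c)))" for c
          using i1 by (rule integrable_of_real)
        have "char (D M) s = (\<integral>x. iexp (s * x i) \<partial>density M (\<lambda>x. ennreal (indicator A (restrict x I))))"
          unfolding char_def D_def ennreal_indicator by (subst integral_distr) simp_all
        also have "\<dots> = (\<integral>x. (indicator A (restrict x I) :: real) *\<^sub>R iexp (s * x i) \<partial>M)"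
          by (subst integral_density) simp_all
        also have "\<dots> = (\<integral>x. complex_of_real (indicator A (restrict x I) * cos (s * x i + 0)) +
             \<i> * complex_of_real (indicator A (restrict x I) * cos (s * x i + (- pi/2))) \<partial>M)"
          by (rule Bochner_Integration.integral_cong)
            (auto simp: indicator_def scaleR_conv_of_real complex_eq_iff Re_exp Im_exp cos_diff)
        also have "\<dots> = (\<integral>x. complex_of_real (indicator A (restrict x I) * cos (s * x i + 0)) \<partial>M) +
             (\<integral>x. \<i> * complex_of_real (indicator A (restrict x I) * cos (s * x i + (- pi/2))) \<partial>M)"
          by (rule Bochner_Integration.integral_add[OF j integrable_mult_right[OF j]])
        finally show ?thesis by (simp only: integral_mult_right_zero integral_complex_of_real)
      qed
      have *: "{x \<in> space M. restrict x I \<in> A \<and> x i \<in> B} \<in> sets M" by measurable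
      show "emeasure (D M) B = emeasure M {x \<in> space M. restrict x I \<in> A \<and> x i \<in> B}"
        unfolding D_def
        apply (subst emeasure_distr, simp, simp)
        apply (subst emeasure_density, simp, simp)
        apply (subst nn_integral_indicator[OF *, symmetric])
        by (intro nn_integral_cong) (auto simp: indicator_def)
    qed
    have "D \<mu> = D \<nu>"
    proof (rule finite_measure_eqI_char)
      show "char (D \<mu>) s = char (D \<nu>) s" for s
        by (simp only: Dchar[OF insert.prems(3,1)] Dchar[OF insert.prems(4,2)] cosint)
      show "sets (D \<mu>) = sets borel" "sets (D \<nu>) = sets borel" by (simp_all add: D_def)
    qed (use insert.prems Dfin in blast)+
    then show ?thesis using Dem[OF insert.prems(3,1)] Dem[OF insert.prems(4,2)] by simp
  qed
  show ?case
  proof (rule measure_eqI_PiM_finite[of "insert i I"])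
    show "finite (insert i I)" using fin by simp
    show "sets \<mu> = sets (?P (insert i I))" "sets \<nu> = sets (?P (insert i I))" by fact+
    fix A assume A: "\<And>j. j \<in> insert i I \<Longrightarrow> A j \<in> sets (borel::real measure)"
    have sp: "space M = PiE (insert i I) (\<lambda>_. UNIV)" if "sets M = sets (?P (insert i I))" for M
      using sets_eq_imp_space_eq[OF that] by (simp add: space_PiM)
    have "{x \<in> space M. restrict x I \<in> PiE I A \<and> x i \<in> A i} = PiE (insert i I) A" if "sets M = sets (?P (insert i I))" for M
      unfolding sp[OF that] by (auto simp: PiE_iff extensional_def Pi_iff)
    moreover have "PiE I A \<in> sets (?P I)" using A fin by (intro sets_PiM_I_finite) auto
    ultimately show "emeasure \<mu> (PiE (insert i I) A) = emeasure \<nu> (PiE (insert i I) A)"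
      using main[of "PiE I A" "A i"] A insert.prems(3,4) by auto
  next
    fix k :: nat
    show "emeasure \<mu> (PiE (insert i I) (\<lambda>_. UNIV)) \<noteq> \<infinity>" by (simp add: m.emeasure_eq_measure)
  qed (auto simp: space_PiM fin intro!: prod_algebraI_finite)
qed

section \<open>Centered Gaussian laws\<close>

abbreviation normal_prod :: "'q set \<Rightarrow> ('q \<Rightarrow> real) \<Rightarrow> ('q \<Rightarrow> real) measure" where
  "normal_prod Q s \<equiv> (\<Pi>\<^sub>M q\<in>Q. density lborel (normal_density 0 (s q)))"

abbreviation gaussian_outputs :: "nat \<Rightarrow> vec set \<Rightarrow> (vec \<Rightarrow> vec \<Rightarrow> real) \<Rightarrow> outputs measure" where
  "gaussian_outputs m X A \<equiv> (\<Pi>\<^sub>M k\<in>{..<m}. centered_gaussian X A)"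

lemma sets_centered_normal [simp, measurable_cong]: "sets (centered_normal v) = sets borel"
  by (simp add: centered_normal_def)

lemma is_centered_gaussian_sets: "is_centered_gaussian I K \<mu> \<Longrightarrow> sets \<mu> = sets (\<Pi>\<^sub>M i\<in>I. borel)"
  by (simp add: is_centered_gaussian_def)

lemma is_centered_gaussian_distr:
  "is_centered_gaussian I K \<mu> \<Longrightarrow>
    distr \<mu> borel (\<lambda>g. \<Sum>i\<in>I. t i * g i) = centered_normal (\<Sum>i\<in>I. \<Sum>j\<in>I. t i * K i j * t j)"
  by (simp add: is_centered_gaussian_def)

lemma is_centered_gaussian_prob_space:
  assumes "is_centered_gaussian I K \<mu>"
  shows "prob_space \<mu>"
proof -
  have [measurable_cong]: "sets \<mu> = sets (\<Pi>\<^sub>M i\<in>I. borel)"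
    using assms by (rule is_centered_gaussian_sets)
  have "distr \<mu> borel (\<lambda>g. 0::real) = return borel 0"
    using is_centered_gaussian_distr[OF assms, of "\<lambda>_. 0"] by (simp add: centered_normal_def)
  then have "emeasure (distr \<mu> borel (\<lambda>g. 0::real)) UNIV = 1" by simp
  then show ?thesis by (intro prob_spaceI) (simp add: emeasure_distr)
qed

text \<open>Cramer-Wold: the characteristic function at \<open>t\<close> only depends on the law of
  the linear combination with coefficients \<open>t\<close>, which the predicate prescribes.\<close>

lemma is_centered_gaussian_unique:
  assumes fin: "finite I" and m: "is_centered_gaussian I K \<mu>" and n: "is_centered_gaussian I K \<nu>"
  shows "\<mu> = \<nu>"
proof (rule PiM_borel_eqI_char[OF fin])
  show "finite_measure \<mu>" "finite_measure \<nu>"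
    using m n is_centered_gaussian_prob_space prob_space.finite_measure by blast+
  show sets: "sets \<mu> = sets (\<Pi>\<^sub>M i\<in>I. borel)" "sets \<nu> = sets (\<Pi>\<^sub>M i\<in>I. borel)"
    using m n is_centered_gaussian_sets by blast+
  note [measurable_cong] = sets
  fix t
  have "(\<integral>x. iexp (\<Sum>i\<in>I. t i * x i) \<partial>\<mu>) = (\<integral>x. iexp x \<partial>distr \<mu> borel (\<lambda>g. \<Sum>i\<in>I. t i * g i))"
    by (subst integral_distr) (auto)
  also have "\<dots> = (\<integral>x. iexp x \<partial>distr \<nu> borel (\<lambda>g. \<Sum>i\<in>I. t i * g i))"
    unfolding is_centered_gaussian_distr[OF m] is_centered_gaussian_distr[OF n] ..
  also have "\<dots> = (\<integral>x. iexp (\<Sum>i\<in>I. t i * x i) \<partial>\<nu>)"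
    by (subst integral_distr) (auto)
  finally show "(\<integral>x. iexp (\<Sum>i\<in>I. t i * x i) \<partial>\<mu>) = (\<integral>x. iexp (\<Sum>i\<in>I. t i * x i) \<partial>\<nu>)" .
qed

lemma centered_gaussian_eqI:
  assumes "finite I" "is_centered_gaussian I K \<mu>"
  shows "centered_gaussian I K = \<mu>"
  unfolding centered_gaussian_def
  using assms(2) is_centered_gaussian_unique[OF assms(1) _ assms(2)] by (rule the_equality)

text \<open>Summands with coefficient \<open>0\<close> are degenerate and are dropped before the
  theorem on sums of independent normals applies. If nothing remains, the sum is the point mass at
  \<open>0\<close>, which is \<open>centered_normal 0\<close>.\<close>

lemma (in prob_space) distr_sum_normal:
  assumes fin: "finite Q" and ind: "indep_vars (\<lambda>_. borel) Y Q" and s: "\<And>q. q \<in> Q \<Longrightarrow> s q > 0"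
    and dist: "\<And>q. q \<in> Q \<Longrightarrow> distributed M lborel (Y q) (normal_density 0 (s q))"
  shows "distr M borel (\<lambda>\<omega>. \<Sum>q\<in>Q. a q * Y q \<omega>) = centered_normal (\<Sum>q\<in>Q. (s q)\<^sup>2 * (a q)\<^sup>2)"
proof -
  define Q' where "Q' = {q\<in>Q. a q \<noteq> 0}"
  have Q': "finite Q'" "Q' \<subseteq> Q" using fin by (auto simp: Q'_def)
  have eq1: "(\<Sum>q\<in>Q. a q * Y q \<omega>) = (\<Sum>q\<in>Q'. a q * Y q \<omega>)" for \<omega>
    by (rule sum.mono_neutral_right) (use fin in \<open>auto simp: Q'_def\<close>)
  have eq2: "(\<Sum>q\<in>Q. (s q)\<^sup>2 * (a q)\<^sup>2) = (\<Sum>q\<in>Q'. (\<bar>a q\<bar> * s q)\<^sup>2)"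
    unfolding power_mult_distrib power2_abs
    by (subst mult.commute, rule sum.mono_neutral_right) (use fin in \<open>auto simp: Q'_def\<close>)
  show ?thesis
  proof (cases "Q' = {}")
    case True
    have "distr M borel (\<lambda>\<omega>. 0::real) = return borel 0"
      by (intro measure_eqI) (auto simp: emeasure_distr emeasure_space_1 indicator_def)
    then show ?thesis unfolding eq1 eq2 True by (simp add: centered_normal_def)
  next
    case False
    have d: "distributed M lborel (\<lambda>\<omega>. a q * Y q \<omega>) (normal_density 0 (\<bar>a q\<bar> * s q))" if "q \<in> Q'" for q
      using normal_density_affine[OF dist[of q] s[of q], of "a q" 0] that by (simp add: Q'_def)
    have i: "indep_vars (\<lambda>_. borel) (\<lambda>q \<omega>. a q * Y q \<omega>) Q'"
      by (rule indep_vars_compose2[where M'="\<lambda>_. borel" and X=Y and Y="\<lambda>q x. a q * x"])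
        (use indep_vars_subset[OF ind Q'(2)] in auto)
    have "distributed M lborel (\<lambda>\<omega>. \<Sum>q\<in>Q'. a q * Y q \<omega>) (normal_density (\<Sum>q\<in>Q'. 0) (sqrt (\<Sum>q\<in>Q'. (\<bar>a q\<bar> * s q)\<^sup>2)))"
      using Q' False s by (intro sum_indep_normal i d) (auto simp: Q'_def)
    then have "distr M lborel (\<lambda>\<omega>. \<Sum>q\<in>Q'. a q * Y q \<omega>) = density lborel (normal_density 0 (sqrt (\<Sum>q\<in>Q'. (\<bar>a q\<bar> * s q)\<^sup>2)))"
      by (simp add: distributed_def)
    moreover have "(\<Sum>q\<in>Q'. (\<bar>a q\<bar> * s q)\<^sup>2) > 0"
      using Q' False s by (intro sum_pos) (force simp: Q'_def)+
    moreover have "distr M lborel f = distr M borel f" for f :: "'a \<Rightarrow> real"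
      by (rule distr_cong) auto
    ultimately show ?thesis unfolding eq1 eq2 by (simp add: centered_normal_def)
  qed
qed

text \<open>A linear combination of the coordinates of the image is again one of the independent
  normals \<open>Y q\<close>, so its law is known and its variance is the quadratic form of
  \<open>A\<close>.\<close>

lemma (in prob_space) is_centered_gaussian_linear:
  assumes fin: "finite Q" "finite X" and ind: "indep_vars (\<lambda>_. borel) Y Q" and s: "\<And>q. q \<in> Q \<Longrightarrow> s q > 0"
    and dist: "\<And>q. q \<in> Q \<Longrightarrow> distributed M lborel (Y q) (normal_density 0 (s q))"
    and cov: "\<And>p p'. p \<in> X \<Longrightarrow> p' \<in> X \<Longrightarrow> (\<Sum>q\<in>Q. (s q)\<^sup>2 * (a q p * a q p')) = A p p'"
  shows "is_centered_gaussian X A (distr M (\<Pi>\<^sub>M p\<in>X. borel) (\<lambda>\<omega>. \<lambda>p\<in>X. \<Sum>q\<in>Q. a q p * Y q \<omega>))"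
  unfolding is_centered_gaussian_def
proof (intro conjI allI)
  fix t :: "'c \<Rightarrow> real"
  have [measurable]: "random_variable borel (Y q)" if "q \<in> Q" for q
    using ind that by (auto simp: indep_vars_def)
  have "distr (distr M (\<Pi>\<^sub>M p\<in>X. borel) (\<lambda>\<omega>. \<lambda>p\<in>X. \<Sum>q\<in>Q. a q p * Y q \<omega>)) borel (\<lambda>g. \<Sum>i\<in>X. t i * g i)
    = distr M borel (\<lambda>\<omega>. \<Sum>p\<in>X. t p * (\<Sum>q\<in>Q. a q p * Y q \<omega>))"
    by (subst distr_distr) (auto simp: comp_def)
  also have "(\<lambda>\<omega>. \<Sum>p\<in>X. t p * (\<Sum>q\<in>Q. a q p * Y q \<omega>)) = (\<lambda>\<omega>. \<Sum>q\<in>Q. (\<Sum>p\<in>X. t p * a q p) * Y q \<omega>)"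
    unfolding sum_distrib_left sum_distrib_right mult.assoc by (subst sum.swap) simp
  also have "distr M borel \<dots> = centered_normal (\<Sum>q\<in>Q. (s q)\<^sup>2 * (\<Sum>p\<in>X. t p * a q p)\<^sup>2)"
    by (rule distr_sum_normal[OF fin(1) ind s dist])
  also have "(\<Sum>q\<in>Q. (s q)\<^sup>2 * (\<Sum>p\<in>X. t p * a q p)\<^sup>2) = (\<Sum>q\<in>Q. \<Sum>p\<in>X. \<Sum>p'\<in>X. t p * t p' * ((s q)\<^sup>2 * (a q p * a q p')))"
    by (simp only: power2_eq_square[of "sum _ _"] sum_product, simp only: sum_distrib_left mult_ac)
  also have "\<dots> = (\<Sum>p\<in>X. \<Sum>p'\<in>X. \<Sum>q\<in>Q. t p * t p' * ((s q)\<^sup>2 * (a q p * a q p')))"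
    by (subst sum.swap, intro sum.cong refl, subst sum.swap) simp
  also have "\<dots> = (\<Sum>p\<in>X. \<Sum>p'\<in>X. t p * A p p' * t p')"
    by (intro sum.cong refl) (simp only: sum_distrib_left[symmetric] cov, simp only: mult_ac)
  finally show "distr (distr M (\<Pi>\<^sub>M p\<in>X. borel) (\<lambda>\<omega>. \<lambda>p\<in>X. \<Sum>q\<in>Q. a q p * Y q \<omega>)) borel (\<lambda>g. \<Sum>i\<in>X. t i * g i)
    = centered_normal (\<Sum>i\<in>X. \<Sum>j\<in>X. t i * A i j * t j)" .
qed simp

text \<open>Row \<open>k\<close> only reads the variables in its own block \<open>R k\<close>;
  disjoint blocks make the rows independent, and a common covariance makes them copies. The lemma
  serves a network layer, whose variables are its parameters, as well as the representation of a
  Gaussian law by rank one directions.\<close>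

lemma (in prob_space) distr_rows_eq_gaussian_outputs:
  assumes m: "m \<ge> 1" and fin: "finite Q" "finite X"
    and ind: "indep_vars (\<lambda>_. borel) Y Q" and s: "\<And>q. q \<in> Q \<Longrightarrow> s q > 0"
    and dist: "\<And>q. q \<in> Q \<Longrightarrow> distributed M lborel (Y q) (normal_density 0 (s q))"
    and R: "\<And>k. k < m \<Longrightarrow> R k \<subseteq> Q" "disjoint_family_on R {..<m}"
    and cov: "\<And>k p p'. k < m \<Longrightarrow> p \<in> X \<Longrightarrow> p' \<in> X \<Longrightarrow> (\<Sum>q\<in>R k. (s q)\<^sup>2 * (a q p * a q p')) = A p p'"
  shows "distr M (output_space m X) (\<lambda>\<omega>. \<lambda>k\<in>{..<m}. \<lambda>p\<in>X. \<Sum>q\<in>R k. a q p * Y q \<omega>) = gaussian_outputs m X A"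
proof -
  let ?P = "\<Pi>\<^sub>M p\<in>X. (borel :: real measure)"
  let ?row = "\<lambda>k \<omega>. \<lambda>p\<in>X. \<Sum>q\<in>R k. a q p * Y q \<omega>"
  have rowdist: "is_centered_gaussian X A (distr M ?P (?row k))" if "k < m" for k
    using that R s dist fin(2) finite_subset[OF R(1)[OF that] fin(1)] indep_vars_subset[OF ind R(1)[OF that]]
    by (intro is_centered_gaussian_linear[where s=s] cov) auto
  have [measurable]: "random_variable borel (Y q)" if "q \<in> Q" for q
    using ind that by (auto simp: indep_vars_def)
  have rm: "random_variable ?P (?row k)" if "k < m" for k
    using R(1)[OF that] by (intro measurable_restrict borel_measurable_sum) auto
  have "indep_vars (\<lambda>k. PiM (R k) (\<lambda>_. borel)) (\<lambda>k \<omega>. restrict (\<lambda>q. Y q \<omega>) (R k)) {..<m}"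
    by (rule indep_vars_restrict[OF ind]) (use R in auto)
  then have "indep_vars (\<lambda>k. ?P) (\<lambda>k \<omega>. (\<lambda>y. \<lambda>p\<in>X. \<Sum>q\<in>R k. a q p * y q) (restrict (\<lambda>q. Y q \<omega>) (R k))) {..<m}"
    by (rule indep_vars_compose2)
      (intro measurable_restrict borel_measurable_sum borel_measurable_times measurable_const
        measurable_component_singleton, simp_all)
  then have "indep_vars (\<lambda>k. ?P) ?row {..<m}"
    by (rule indep_vars_cong[THEN iffD1, rotated -1]) (auto intro!: restrict_ext sum.cong)
  then have "distr M (\<Pi>\<^sub>M k\<in>{..<m}. ?P) (\<lambda>\<omega>. \<lambda>k\<in>{..<m}. ?row k \<omega>) = (\<Pi>\<^sub>M k\<in>{..<m}. distr M ?P (?row k))"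
    using m by (subst (asm) indep_vars_iff_distr_eq_PiM') (auto intro: rm simp: lessThan_empty_iff)
  also have "\<dots> = gaussian_outputs m X A"
    by (rule PiM_cong) (auto intro: centered_gaussian_eqI[symmetric] rowdist fin)
  finally show ?thesis by (simp add: output_space_def)
qed

lemma prob_space_normal_prod: "(\<And>q. q \<in> Q \<Longrightarrow> s q > 0) \<Longrightarrow> prob_space (normal_prod Q s)"
  by (intro prob_space_PiM prob_space_normal_density)

lemma sets_normal_prod [simp, measurable_cong]: "sets (normal_prod Q s) = sets (\<Pi>\<^sub>M q\<in>Q. borel)"
  by (rule sets_PiM_cong) auto

lemma normal_prod_coordinates:
  assumes "finite Q" "\<And>q. q \<in> Q \<Longrightarrow> s q > 0"
  shows "prob_space.indep_vars (normal_prod Q s) (\<lambda>_. borel) (\<lambda>q x. x q) Q"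
    and "\<And>q. q \<in> Q \<Longrightarrow> distributed (normal_prod Q s) lborel (\<lambda>x. x q) (normal_density 0 (s q))"
proof -
  interpret prob_space "normal_prod Q s" using assms(2) by (rule prob_space_normal_prod)
  let ?N = "\<lambda>q. density lborel (normal_density 0 (s q))"
  have c: "distr (normal_prod Q s) (?N q) (\<lambda>x. x q) = ?N q" if "q \<in> Q" for q
    using assms(2) that by (intro distr_PiM_component prob_space_normal_density)
  show "distributed (normal_prod Q s) lborel (\<lambda>x. x q) (normal_density 0 (s q))" if "q \<in> Q" for q
  proof -
    have "distr (normal_prod Q s) lborel (\<lambda>x. x q) = distr (normal_prod Q s) (?N q) (\<lambda>x. x q)"
      by (rule distr_cong) auto
    then show ?thesis using that c[OF that] by (simp add: distributed_def)
  qed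
  have "indep_vars ?N (\<lambda>q x. x q) Q"
  proof (cases "Q = {}")
    case True then show ?thesis unfolding indep_vars_def indep_sets_def by simp
  next
    case False
    have "distr (normal_prod Q s) (normal_prod Q s) (\<lambda>x. \<lambda>q\<in>Q. x q) = distr (normal_prod Q s) (normal_prod Q s) (\<lambda>x. x)"
      by (rule distr_cong) (auto simp: space_PiM)
    also have "\<dots> = (\<Pi>\<^sub>M q\<in>Q. distr (normal_prod Q s) (?N q) (\<lambda>x. x q))"
      by (simp add: distr_id c cong: PiM_cong)
    finally show ?thesis using False by (subst indep_vars_iff_distr_eq_PiM') auto
  qed
  then show "indep_vars (\<lambda>_. borel) (\<lambda>q x. x q) Q"
    by (rule indep_vars_compose2[where Y="\<lambda>_ x. x"]) auto
qed

section \<open>Moments of centered Gaussian laws\<close>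

lemma centered_normal_moments:
  assumes "v \<ge> 0"
  shows "integrable (centered_normal v) (\<lambda>x. x ^ k)"
    and "(\<integral>x. x\<^sup>2 \<partial>centered_normal v) = v"
    and "(\<integral>x. x ^ 4 \<partial>centered_normal v) = 3 * v\<^sup>2"
proof -
  have "integrable (centered_normal v) (\<lambda>x. x ^ k) \<and> (\<integral>x. x\<^sup>2 \<partial>centered_normal v) = v
    \<and> (\<integral>x. x ^ 4 \<partial>centered_normal v) = 3 * v\<^sup>2"
  proof (cases "v = 0")
    case True
    have "integrable (return borel 0) (\<lambda>x::real. x ^ k)"
      by (intro integrableI_bounded) (auto simp: nn_integral_return)
    then show ?thesis using True by (simp add: centered_normal_def integral_return)
  next
    case False
    then have v: "v > 0" using assms by simp
    have 1: "integrable (density lborel (normal_density 0 (sqrt v))) (\<lambda>x. x ^ k)"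
      using integrable_normal_moment[of "sqrt v" 0 k] v
      by (subst integrable_density) auto
    have 2: "(\<integral>x. x ^ (2 * j) \<partial>density lborel (normal_density 0 (sqrt v))) = fact (2 * j) / ((2 / v) ^ j * fact j)" for j
      using integral_normal_moment_even[of "sqrt v" 0 j] v
      by (subst integral_density) auto
    have "fact 4 = (24::real)" by (simp add: fact_numeral)
    then show ?thesis using False v 1 2[of 1] 2[of 2]
      by (simp add: centered_normal_def field_simps power2_eq_square fact_numeral)
  qed
  then show "integrable (centered_normal v) (\<lambda>x. x ^ k)"
    and "(\<integral>x. x\<^sup>2 \<partial>centered_normal v) = v"
    and "(\<integral>x. x ^ 4 \<partial>centered_normal v) = 3 * v\<^sup>2" by auto
qed

lemma is_centered_gaussian_component:
  assumes "is_centered_gaussian I K \<mu>" "finite I" "p \<in> I"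
  shows "distr \<mu> borel (\<lambda>g. g p) = centered_normal (K p p)"
proof -
  have "(\<Sum>i\<in>I. (if i = p then 1 else 0) * g i) = g p" for g :: "'a \<Rightarrow> real"
    using assms(2,3) by (simp add: if_distrib[of "\<lambda>x. x * _"] cong: if_cong)
  moreover have "(\<Sum>i\<in>I. \<Sum>j\<in>I. (if i = p then 1 else 0) * K i j * (if j = p then 1 else 0)) = K p p"
    using assms(2,3) by (simp add: if_distrib[of "\<lambda>x. x * _"] if_distrib[of "\<lambda>x. _ * x"] cong: if_cong)
  ultimately show ?thesis
    using is_centered_gaussian_distr[OF assms(1), of "\<lambda>i. if i = p then 1 else 0"] by simp
qed

text \<open>Second moments become traces of covariances; fourth moments are needed because a product
  of two activations grows quadratically and its square has to be integrated.\<close>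

lemma is_centered_gaussian_moments:
  assumes "is_centered_gaussian I K \<mu>" "finite I" "p \<in> I" "K p p \<ge> 0"
  shows "integrable \<mu> (\<lambda>g. g p ^ k)"
    and "(\<integral>g. (g p)\<^sup>2 \<partial>\<mu>) = K p p"
    and "(\<integral>g. g p ^ 4 \<partial>\<mu>) = 3 * (K p p)\<^sup>2"
proof -
  have [measurable_cong]: "sets \<mu> = sets (\<Pi>\<^sub>M i\<in>I. borel)"
    using assms(1) by (rule is_centered_gaussian_sets)
  have [measurable]: "(\<lambda>g. g p) \<in> borel_measurable \<mu>" using assms(3) by measurable
  note c = is_centered_gaussian_component[OF assms(1-3), symmetric]
  show "integrable \<mu> (\<lambda>g. g p ^ k)"
    using centered_normal_moments(1)[OF assms(4), of k] unfolding c by (subst (asm) integrable_distr_eq) auto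
  show "(\<integral>g. (g p)\<^sup>2 \<partial>\<mu>) = K p p"
    using centered_normal_moments(2)[OF assms(4)] unfolding c by (subst (asm) integral_distr) auto
  show "(\<integral>g. g p ^ 4 \<partial>\<mu>) = 3 * (K p p)\<^sup>2"
    using centered_normal_moments(3)[OF assms(4)] unfolding c by (subst (asm) integral_distr) auto
qed

section \<open>Positive semidefinite matrices\<close>

definition psd_on :: "'a set \<Rightarrow> ('a \<Rightarrow> 'a \<Rightarrow> real) \<Rightarrow> bool" where
  "psd_on X K \<longleftrightarrow> (\<forall>p\<in>X. \<forall>q\<in>X. K p q = K q p) \<and>
    (\<forall>t. 0 \<le> (\<Sum>p\<in>X. \<Sum>q\<in>X. t p * K p q * t q))"

lemma psd_onD_sym: "psd_on X K \<Longrightarrow> p \<in> X \<Longrightarrow> q \<in> X \<Longrightarrow> K p q = K q p"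
  by (simp add: psd_on_def)

lemma psd_onD: "psd_on X K \<Longrightarrow> 0 \<le> (\<Sum>p\<in>X. \<Sum>q\<in>X. t p * K p q * t q)"
  by (simp add: psd_on_def)

lemma psd_on_diag:
  assumes "psd_on X K" "finite X" "p \<in> X"
  shows "0 \<le> K p p"
proof -
  have "(\<Sum>i\<in>X. \<Sum>j\<in>X. (if i = p then 1 else 0) * K i j * (if j = p then 1 else 0)) = K p p"
    using assms(2,3) by (simp add: if_distrib[of "\<lambda>x. x * _"] if_distrib[of "\<lambda>x. _ * x"] cong: if_cong)
  then show ?thesis using psd_onD[OF assms(1), of "\<lambda>i. if i = p then 1 else 0"] by simp
qed

text \<open>
  Cholesky decomposition of a possibly singular matrix; the dual vectors \<open>u\<close> make the factor
  left invertible.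
\<close>

lemma psd_on_factorization:
  assumes "finite X" "psd_on X K"
  shows "\<exists>(r::nat) w u. (\<forall>p\<in>X. \<forall>q\<in>X. K p q = (\<Sum>i<r. w i p * w i q)) \<and>
    (\<forall>i<r. \<forall>j<r. (\<Sum>p\<in>X. u i p * w j p) = (if i = j then 1 else 0))"
  using assms
proof (induction X arbitrary: K)
  case empty
  show ?case by (rule exI[of _ 0]) simp
next
  case (insert a X)
  note fin = insert.hyps(1) and notin = insert.hyps(2)
  have Ksym: "K p q = K q p" if "p \<in> insert a X" "q \<in> insert a X" for p q
    using psd_onD_sym[OF insert.prems that] .
  have split: "(\<Sum>p\<in>insert a X. \<Sum>q\<in>insert a X. t p * K p q * t q)
     = K a a * (t a)\<^sup>2 + 2 * t a * (\<Sum>q\<in>X. K a q * t q) + (\<Sum>p\<in>X. \<Sum>q\<in>X. t p * K p q * t q)" for t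
  proof -
    have "(\<Sum>p\<in>X. t p * K p a * t a) = t a * (\<Sum>q\<in>X. K a q * t q)"
      unfolding sum_distrib_left by (intro sum.cong) (auto simp: Ksym[of _ a])
    then show ?thesis using fin notin
      by (simp add: sum.distrib sum_distrib_left power2_eq_square mult_ac)
  qed
  have nn: "0 \<le> K a a * c\<^sup>2 + 2 * c * (\<Sum>q\<in>X. K a q * t q) + (\<Sum>p\<in>X. \<Sum>q\<in>X. t p * K p q * t q)" for c t
  proof -
    have *: "(\<Sum>q\<in>X. K a q * (t(a:=c)) q) = (\<Sum>q\<in>X. K a q * t q)"
      "(\<Sum>p\<in>X. \<Sum>q\<in>X. (t(a:=c)) p * K p q * (t(a:=c)) q) = (\<Sum>p\<in>X. \<Sum>q\<in>X. t p * K p q * t q)"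
      using notin by (intro sum.cong refl; auto)+
    show ?thesis
      using psd_onD[OF insert.prems, of "t(a:=c)"] unfolding split * by simp
  qed
  define d where "d = K a a"
  have d0: "d \<ge> 0" using psd_on_diag[OF insert.prems] fin by (simp add: d_def)
  show ?case
  proof (cases "d = 0")
    case True
    have zero: "K a q = 0" if "q \<in> X" for q
    proof (rule ccontr)
      assume ne: "K a q \<noteq> 0"
      define t where "t = (\<lambda>p. if p = q then 1 else 0::real)"
      have t1: "(\<Sum>q\<in>X. K a q * t q) = K a q"
        "(\<Sum>i\<in>X. \<Sum>j\<in>X. t i * K i j * t j) = K q q"
        using fin that by (simp_all add: t_def if_distrib[of "\<lambda>x. x * _"] if_distrib[of "\<lambda>x. _ * x"] cong: if_cong)
      \<comment> \<open>With \<open>K a a = 0\<close> the quadratic form is affine in the value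
        \<open>c\<close> at \<open>a\<close>; this choice makes it \<open>-1\<close>.\<close>
      define c where "c = - (K q q + 1) / (2 * K a q)"
      have "2 * c * K a q = - (K q q + 1)" using ne by (simp add: c_def)
      then show False using nn[of c t] True unfolding t1 d_def by simp
    qed
    have psd: "psd_on X K" unfolding psd_on_def
      using Ksym nn[of 0] by simp
    obtain r :: nat and w u where K: "\<forall>p\<in>X. \<forall>q\<in>X. K p q = (\<Sum>i<r. w i p * w i q)"
      and u: "\<forall>i<r. \<forall>j<r. (\<Sum>p\<in>X. u i p * w j p) = (if i = j then 1 else 0)"
      using insert.IH[OF psd] by blast
    have zero': "K q a = 0" if "q \<in> X" for q
      using zero[OF that] Ksym[of q a] that by simp
    define w' where "w' i p = (if p = a then 0 else w i p)" for i p
    have ww: "w' i p = w i p" if "p \<in> X" for i p using that notin by (auto simp: w'_def)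
    have wa: "w' i a = 0" for i by (simp add: w'_def)
    have c1: "K p q = (\<Sum>i<r. w' i p * w' i q)" if pq: "p \<in> insert a X" "q \<in> insert a X" for p q
    proof -
      consider "p \<in> X" "q \<in> X" | "p = a" "q = a" | "p = a" "q \<in> X" | "p \<in> X" "q = a" using pq by blast
      then show ?thesis
      proof cases
        case 1 then show ?thesis unfolding ww[OF 1(1)] ww[OF 1(2)] using K by blast
      qed (use True zero zero' in \<open>simp_all add: wa d_def\<close>)
    qed
    have c2: "(\<Sum>p\<in>insert a X. u i p * w' j p) = (if i = j then 1 else 0)" if "i < r" "j < r" for i j
      using fin notin u that by (simp add: ww wa)
    show ?thesis by (intro exI[of _ r] exI[of _ w'] exI[of _ u] conjI ballI allI impI c1 c2)
  next
    case False
    then have d: "d > 0" using d0 by simp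
    \<comment> \<open>Schur complement of the entry \<open>K a a\<close>. Its form is that of
      \<open>K\<close> minimised over the value at \<open>a\<close>, the minimum being attained at
      \<open>- S / d\<close>, and is therefore nonnegative.\<close>
    define K' where "K' p q = K p q - K a p * K a q / d" for p q
    have psd: "psd_on X K'" unfolding psd_on_def
    proof safe
      show "K' p q = K' q p" if "p \<in> X" "q \<in> X" for p q
        using Ksym[of p q] that by (simp add: K'_def)
      fix t
      let ?S = "\<Sum>q\<in>X. K a q * t q"
      have "(\<Sum>p\<in>X. \<Sum>q\<in>X. t p * K' p q * t q)
        = (\<Sum>p\<in>X. \<Sum>q\<in>X. t p * K p q * t q) - (\<Sum>p\<in>X. \<Sum>q\<in>X. (K a p * t p) * (K a q * t q)) / d"
        unfolding K'_def by (simp add: algebra_simps sum_subtractf sum_divide_distrib)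
      also have "(\<Sum>p\<in>X. \<Sum>q\<in>X. (K a p * t p) * (K a q * t q)) = ?S\<^sup>2"
        by (simp only: sum_product power2_eq_square)
      finally have 1: "(\<Sum>p\<in>X. \<Sum>q\<in>X. t p * K' p q * t q)
        = (\<Sum>p\<in>X. \<Sum>q\<in>X. t p * K p q * t q) - ?S\<^sup>2 / d" .
      have "d * (- S / d)\<^sup>2 + 2 * (- S / d) * S = - S\<^sup>2 / d" for S
        using d by (simp add: power2_eq_square field_simps)
      then show "0 \<le> (\<Sum>p\<in>X. \<Sum>q\<in>X. t p * K' p q * t q)"
        using nn[of "- ?S / d" t] unfolding d_def[symmetric] 1 by simp
    qed
    obtain r :: nat and w u where K: "\<forall>p\<in>X. \<forall>q\<in>X. K' p q = (\<Sum>i<r. w i p * w i q)"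
      and u: "\<forall>i<r. \<forall>j<r. (\<Sum>p\<in>X. u i p * w j p) = (if i = j then 1 else 0)"
      using insert.IH[OF psd] by blast
    define w' where "w' i p = (if i = r then K a p / sqrt d else if p = a then 0 else w i p)" for i p
    \<comment> \<open>The old vectors vanish at \<open>a\<close>, so the dual of the new one may be
      supported at \<open>a\<close>. The old duals receive an entry at \<open>a\<close> that cancels
      \<open>e i\<close>, their pairing over \<open>X\<close> with the new vector.\<close>
    define e where "e i = (\<Sum>p\<in>X. u i p * (K a p / sqrt d))" for i
    define u' where "u' i p = (if i = r then (if p = a then 1 / sqrt d else 0)
      else (if p = a then - e i / sqrt d else u i p))" for i p
    have sq: "sqrt d * sqrt d = d" using d by simp
    have ww: "w' i p = w i p" if "p \<in> X" "i < r" for i p using that notin by (auto simp: w'_def)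
    have uu: "u' i p = u i p" if "p \<in> X" "i < r" for i p using that notin by (auto simp: u'_def)
    have wr: "w' r p = K a p / sqrt d" for p by (simp add: w'_def)
    have wa: "w' i a = 0" if "i < r" for i using that by (simp add: w'_def)
    have c1: "K p q = (\<Sum>i<Suc r. w' i p * w' i q)" if pq: "p \<in> insert a X" "q \<in> insert a X" for p q
    proof -
      consider "p \<in> X" "q \<in> X" | "p = a" | "q = a" using pq by blast
      then show ?thesis
      proof cases
        case 1
        then have "(\<Sum>i<Suc r. w' i p * w' i q) = K' p q + K a p * K a q / d"
          using K sq by (simp add: ww wr)
        then show ?thesis by (simp add: K'_def)
      next
        case 2
        then show ?thesis using sq d by (simp add: wa wr) (simp add: d_def[symmetric])
      next
        case 3
        moreover have "K p a = K a p" using Ksym[of p a] pq by simp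
        ultimately show ?thesis using sq d by (simp add: wa wr) (simp add: d_def[symmetric])
      qed
    qed
    have c2: "(\<Sum>p\<in>insert a X. u' i p * w' j p) = (if i = j then 1 else 0)"
      if ij: "i < Suc r" "j < Suc r" for i j
    proof -
      have s: "(\<Sum>p\<in>insert a X. u' i p * w' j p) = u' i a * w' j a + (\<Sum>p\<in>X. u' i p * w' j p)"
        using fin notin by simp
      have r0: "u' r p = 0" if "p \<in> X" for p using that notin by (auto simp: u'_def)
      have ra: "u' r a = 1 / sqrt d" by (simp add: u'_def)
      have ia: "u' i a = - e i / sqrt d" if "i < r" for i using that by (simp add: u'_def)
      have sd: "sqrt d \<noteq> 0" using d by simp
      have waa: "w' r a = sqrt d" using d by (simp add: wr real_div_sqrt flip: d_def)
      consider "i < r" "j < r" | "i = r" "j < r" | "i < r" "j = r" | "i = r" "j = r" using ij by linarith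
      then show ?thesis
      proof cases
        case 1 then show ?thesis unfolding s using u by (simp add: wa ww uu)
      next
        case 2 then show ?thesis unfolding s by (simp add: wa r0)
      next
        case 3
        then have "(\<Sum>p\<in>insert a X. u' i p * w' j p) = - e i / sqrt d * sqrt d + e i"
          unfolding s by (simp only: waa ia) (simp add: uu wr e_def)
        then show ?thesis using 3 sd by simp
      next
        case 4 then show ?thesis unfolding s using d by (simp add: waa ra r0)
      qed
    qed
    show ?thesis by (intro exI[of _ "Suc r"] exI[of _ w'] exI[of _ u'] conjI ballI allI impI c1 c2)
  qed
qed

text \<open>Existence: the image of a standard normal vector under the factor \<open>w\<close> of
  \<open>K\<close> has the right law, so the definite description in
  \<open>centered_gaussian\<close> denotes it.\<close>

lemma is_centered_gaussian_centered_gaussian: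
  assumes fin: "finite X" and psd: "psd_on X K"
  shows "is_centered_gaussian X K (centered_gaussian X K)"
proof -
  obtain r :: nat and w where K: "\<forall>p\<in>X. \<forall>q\<in>X. K p q = (\<Sum>i<r. w i p * w i q)"
    using psd_on_factorization[OF assms] by blast
  interpret prob_space "normal_prod {..<r} (\<lambda>_. 1)" by (rule prob_space_normal_prod) simp
  have "is_centered_gaussian X K (distr (normal_prod {..<r} (\<lambda>_. 1)) (\<Pi>\<^sub>M p\<in>X. borel)
      (\<lambda>\<omega>. \<lambda>p\<in>X. \<Sum>q\<in>{..<r}. w q p * \<omega> q))"
  proof (rule is_centered_gaussian_linear[where s="\<lambda>_. 1", OF _ fin])
    show "(\<Sum>q<r. 1\<^sup>2 * (w q p * w q p')) = K p p'" if "p \<in> X" "p' \<in> X" for p p'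
      using K that by simp
  qed (rule normal_prod_coordinates; simp | simp)+
  from centered_gaussian_eqI[OF fin this] this show ?thesis by (simp only:)
qed

text \<open>
  The matrices whose kernel contains that of \<open>K\<close>: the Gaussian laws with such covariances live on
  the support of the Gaussian law with covariance \<open>K\<close>.
\<close>

definition cov_below :: "'a set \<Rightarrow> ('a \<Rightarrow> 'a \<Rightarrow> real) \<Rightarrow> ('a \<Rightarrow> 'a \<Rightarrow> real) \<Rightarrow> bool" where
  "cov_below X K A \<longleftrightarrow> psd_on X A \<and>
    (\<forall>t. (\<forall>p\<in>X. (\<Sum>q\<in>X. K p q * t q) = 0) \<longrightarrow> (\<forall>p\<in>X. (\<Sum>q\<in>X. A p q * t q) = 0))"

lemma cov_below_refl: "psd_on X K \<Longrightarrow> cov_below X K K"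
  by (simp add: cov_below_def)

text \<open>The duals give a projection onto the span of the \<open>w i\<close>, and identity minus
  projection maps into the null space of \<open>K\<close>, hence of \<open>A\<close>. So
  \<open>A\<close> is unchanged by the projection on the right and, by symmetry, on the left. The
  resulting coefficients are linear in \<open>A\<close>.\<close>

lemma cov_below_expand:
  fixes r :: nat
  assumes fin: "finite X" and A: "cov_below X K A"
    and K: "\<forall>p\<in>X. \<forall>q\<in>X. K p q = (\<Sum>i<r. w i p * w i q)"
    and u: "\<forall>i<r. \<forall>j<r. (\<Sum>p\<in>X. u i p * w j p) = (if i = j then 1 else 0)"
    and pq: "p \<in> X" "q \<in> X"
  shows "A p q = (\<Sum>i<r. \<Sum>j<r. (\<Sum>p'\<in>X. \<Sum>q'\<in>X. u i p' * A p' q' * u j q') * w i p * w j q)"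
proof -
  have step: "A p q = (\<Sum>j<r. (\<Sum>q'\<in>X. A p q' * u j q') * w j q)" if "p \<in> X" "q \<in> X" for p q
  proof -
    \<comment> \<open>A column of identity minus projection; duality of \<open>u\<close> and
      \<open>w\<close> makes it orthogonal to every \<open>w i\<close>.\<close>
    define t where "t q' = (if q' = q then 1 else 0) - (\<Sum>j<r. w j q * u j q')" for q'
    have tw: "(\<Sum>q'\<in>X. w i q' * t q') = 0" if i: "i < r" for i
    proof -
      have "(\<Sum>q'\<in>X. w i q' * t q') = (\<Sum>q'\<in>X. w i q' * (if q' = q then 1 else 0))
         - (\<Sum>q'\<in>X. \<Sum>j<r. w j q * (u j q' * w i q'))"
        unfolding t_def by (simp add: right_diff_distrib sum_subtractf sum_distrib_left mult_ac)
      also have "(\<Sum>q'\<in>X. \<Sum>j<r. w j q * (u j q' * w i q')) = (\<Sum>j<r. w j q * (\<Sum>q'\<in>X. u j q' * w i q'))"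
        by (subst sum.swap) (simp add: sum_distrib_left)
      also have "\<dots> = (\<Sum>j<r. w j q * (if j = i then 1 else 0))"
        using u i by (intro sum.cong) auto
      also have "\<dots> = (\<Sum>j<r. if j = i then w j q else 0)" by (intro sum.cong) auto
      also have "\<dots> = w i q" using i by (subst sum.delta) auto
      also have "(\<Sum>q'\<in>X. w i q' * (if q' = q then 1 else 0)) = w i q"
        using fin \<open>q \<in> X\<close> by (simp add: if_distrib[of "\<lambda>x. _ * x"] cong: if_cong)
      finally show ?thesis by simp
    qed
    have "(\<Sum>q'\<in>X. K p' q' * t q') = 0" if "p' \<in> X" for p'
    proof -
      have "(\<Sum>q'\<in>X. K p' q' * t q') = (\<Sum>q'\<in>X. \<Sum>i<r. w i p' * (w i q' * t q'))"
        using K that by (intro sum.cong refl) (simp add: sum_distrib_left mult_ac)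
      also have "\<dots> = (\<Sum>i<r. w i p' * (\<Sum>q'\<in>X. w i q' * t q'))"
        by (subst sum.swap) (simp add: sum_distrib_left)
      finally show ?thesis using tw by simp
    qed
    then have "(\<Sum>q'\<in>X. A p q' * t q') = 0" using A \<open>p \<in> X\<close> by (auto simp: cov_below_def)
    moreover have "(\<Sum>q'\<in>X. A p q' * t q') = (\<Sum>q'\<in>X. A p q' * (if q' = q then 1 else 0))
         - (\<Sum>q'\<in>X. \<Sum>j<r. A p q' * u j q' * w j q)"
      unfolding t_def by (simp add: right_diff_distrib sum_subtractf sum_distrib_left mult_ac)
    moreover have "(\<Sum>q'\<in>X. \<Sum>j<r. A p q' * u j q' * w j q) = (\<Sum>j<r. (\<Sum>q'\<in>X. A p q' * u j q') * w j q)"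
      by (subst sum.swap) (simp add: sum_distrib_right)
    moreover have "(\<Sum>q'\<in>X. A p q' * (if q' = q then 1 else 0)) = A p q"
      using fin \<open>q \<in> X\<close> by (simp add: if_distrib[of "\<lambda>x. _ * x"] cong: if_cong)
    ultimately show ?thesis by simp
  qed
  have sym: "A p q = A q p" if "p \<in> X" "q \<in> X" for p q
    using A psd_onD_sym[OF _ that] by (simp add: cov_below_def)
  have "(\<Sum>q'\<in>X. A p q' * u j q') = (\<Sum>i<r. (\<Sum>p'\<in>X. \<Sum>q'\<in>X. u i p' * A p' q' * u j q') * w i p)" if "j < r" for j
  proof -
    have "(\<Sum>q'\<in>X. A p q' * u j q') = (\<Sum>q'\<in>X. (\<Sum>i<r. (\<Sum>p'\<in>X. A q' p' * u i p') * w i p) * u j q')"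
      using step[OF _ pq(1)] sym pq by (intro sum.cong refl) metis
    also have "\<dots> = (\<Sum>q'\<in>X. \<Sum>i<r. (\<Sum>p'\<in>X. u i p' * A p' q' * u j q') * w i p)"
      unfolding sum_distrib_right using sym by (intro sum.cong refl) (simp add: mult_ac)
    also have "\<dots> = (\<Sum>i<r. (\<Sum>q'\<in>X. \<Sum>p'\<in>X. u i p' * A p' q' * u j q') * w i p)"
      by (subst sum.swap) (simp add: sum_distrib_right)
    also have "\<dots> = (\<Sum>i<r. (\<Sum>p'\<in>X. \<Sum>q'\<in>X. u i p' * A p' q' * u j q') * w i p)"
      by (intro sum.cong refl, subst sum.swap) simp
    finally show ?thesis .
  qed
  then have "A p q = (\<Sum>j<r. (\<Sum>i<r. (\<Sum>p'\<in>X. \<Sum>q'\<in>X. u i p' * A p' q' * u j q') * w i p) * w j q)"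
    using step[OF pq] by simp
  then show ?thesis unfolding sum_distrib_right by (subst sum.swap) simp
qed

text \<open>
  Polarisation turns the expansion of \<open>A\<close> in the products \<open>w i p * w j q\<close> into one in rank one
  matrices whose coefficients at \<open>A = K\<close> are all \<open>1\<close>, so that they stay positive near \<open>K\<close>.
\<close>

lemma rank_one_frame:
  fixes K :: "'a \<Rightarrow> 'a \<Rightarrow> real"
  assumes fin: "finite X" and psd: "psd_on X K"
  shows "\<exists>(J :: (nat \<times> nat \<times> bool) set) v a. finite J \<and> (\<forall>A. cov_below X K A \<longrightarrow> (\<forall>p\<in>X. \<forall>q\<in>X.
    A p q = (\<Sum>j\<in>J. (1 + (\<Sum>p'\<in>X. \<Sum>q'\<in>X. a j p' q' * (A p' q' - K p' q'))) * (v j p * v j q))))"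
proof -
  obtain r :: nat and w u where K: "\<forall>p\<in>X. \<forall>q\<in>X. K p q = (\<Sum>i<r. w i p * w i q)"
    and u: "\<forall>i<r. \<forall>j<r. (\<Sum>p\<in>X. u i p * w j p) = (if i = j then 1 else 0)"
    using psd_on_factorization[OF assms] by blast
  define J where "J = {..<r} \<times> {..<r} \<times> (UNIV :: bool set)"
  \<comment> \<open>For each pair \<open>i\<close>, \<open>j\<close> the squares of sum and
    difference add up to multiples of the squares of \<open>w i\<close> and \<open>w j\<close>, and
    \<open>2 * sqrt r\<close> is the scaling for which the total over all pairs is \<open>K\<close>.
    Their difference is the symmetrised mixed product; the factor \<open>r\<close> in
    \<open>a\<close> undoes the scaling there.\<close>
  define v where "v = (\<lambda>(i, j, b) p. (if b then w i p + w j p else w i p - w j p) / (2 * sqrt r))"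
  define a where "a = (\<lambda>(i, j, b) p q. (if b then real r else - real r) * (u i p * u j q))"
  have main: "A p q = (\<Sum>j\<in>J. (1 + (\<Sum>p'\<in>X. \<Sum>q'\<in>X. a j p' q' * (A p' q' - K p' q'))) * (v j p * v j q))"
    if A: "cov_below X K A" and pq: "p \<in> X" "q \<in> X" for A p q
  proof (cases "r = 0")
    case True
    then show ?thesis using cov_below_expand[OF fin A K u pq] by (simp add: J_def)
  next
    case False
    define D where "D i j = (\<Sum>p'\<in>X. \<Sum>q'\<in>X. u i p' * u j q' * (A p' q' - K p' q'))" for i j
    have sym: "A p q - K p q = A q p - K q p" if "p \<in> X" "q \<in> X" for p q
      using A psd_onD_sym[OF psd that] psd_onD_sym[OF _ that, of A] by (simp add: cov_below_def)
    have Dsym: "D i j = D j i" for i j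
      unfolding D_def by (subst sum.swap, intro sum.cong refl) (use sym in \<open>simp add: mult_ac\<close>)
    have AD: "A p q - K p q = (\<Sum>i<r. \<Sum>j<r. D i j * (w i p * w j q))"
      using cov_below_expand[OF fin A K u pq] cov_below_expand[OF fin cov_below_refl[OF psd] K u pq]
      by (simp add: D_def sum_subtractf algebra_simps)
    have AD': "A p q - K p q = (\<Sum>i<r. \<Sum>j<r. D i j * (w j p * w i q))"
      unfolding AD by (subst sum.swap) (simp add: Dsym)
    have aD: "(\<Sum>p'\<in>X. \<Sum>q'\<in>X. a (i, j, b) p' q' * (A p' q' - K p' q')) = (if b then 1 else -1) * real r * D i j" for i j b
      by (cases b) (simp_all add: a_def D_def sum_distrib_left mult_ac flip: sum_negf)
    have sq: "sqrt (real r) * sqrt (real r) = real r" by simp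
    have s1: "(\<Sum>i<r. \<Sum>j<r. w i p * w i q / (2 * real r)) = (\<Sum>i<r. w i p * w i q) / 2"
      using False by (simp add: sum_divide_distrib)
    have s2: "(\<Sum>i<r. \<Sum>j<r. w j p * w j q / (2 * real r)) = (\<Sum>j<r. w j p * w j q) / 2"
      using s1 by (subst sum.swap) simp
    have "(2 * sqrt (real r)) * (2 * sqrt (real r)) = 4 * real r" by simp
    then have dv: "x / (2 * sqrt (real r)) * (y / (2 * sqrt (real r))) = x * y / (4 * real r)" for x y :: real
      by (simp only: times_divide_times_eq)
    have vv: "v (i, j, b) p * v (i, j, b) q = (if b then (w i p + w j p) * (w i q + w j q)
        else (w i p - w j p) * (w i q - w j q)) / (4 * real r)" for i j b
      by (cases b) (simp_all only: v_def split if_True if_False dv)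
    have "(\<Sum>j\<in>J. (1 + (\<Sum>p'\<in>X. \<Sum>q'\<in>X. a j p' q' * (A p' q' - K p' q'))) * (v j p * v j q))
      = (\<Sum>i<r. \<Sum>j<r. \<Sum>b\<in>UNIV. (1 + (if b then 1 else -1) * real r * D i j) *
          (v (i,j,b) p * v (i,j,b) q))"
      unfolding J_def sum.cartesian_product' aD ..
    also have "\<dots> = (\<Sum>i<r. \<Sum>j<r. (w i p * w i q) / (2 * real r) + (w j p * w j q) / (2 * real r)
        + (D i j * (w i p * w j q) / 2 + D i j * (w j p * w i q) / 2))"
      using False by (intro sum.cong refl) (simp add: UNIV_bool vv field_simps)
    also have "\<dots> = (\<Sum>i<r. w i p * w i q) / 2 + (\<Sum>j<r. w j p * w j q) / 2
       + ((A p q - K p q) / 2 + (A p q - K p q) / 2)"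
      unfolding sum.distrib s1 s2 by (simp only: AD[symmetric] AD'[symmetric] flip: sum_divide_distrib)
    also have "\<dots> = A p q" using K pq by simp
    finally show ?thesis by simp
  qed
  have "finite J" by (simp add: J_def)
  then show ?thesis by (intro exI[of _ J] exI[of _ v] exI[of _ a] conjI ballI allI impI main)
qed

section \<open>Perturbing the variances of independent normal variables\<close>

lemma abs_exp_minus_one_minus_le:
  fixes x :: real
  shows "\<bar>exp x - 1 - x\<bar> \<le> x\<^sup>2 * exp \<bar>x\<bar>"
proof -
  have 1: "0 \<le> exp x - 1 - x" using exp_ge_add_one_self[of x] by linarith
  have "exp x * (1 - x) \<le> exp x * exp (- x)"
    using exp_ge_add_one_self[of "-x"] by (intro mult_left_mono) auto
  then have 2: "exp x - 1 \<le> x * exp x" by (simp add: algebra_simps flip: exp_add)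
  have 3: "\<bar>exp x - 1\<bar> \<le> \<bar>x\<bar> * exp \<bar>x\<bar>"
  proof (cases "x \<ge> 0")
    case True then show ?thesis using 2 by simp
  next
    case False
    then have "\<bar>exp x - 1\<bar> = 1 - exp x" by simp
    also have "\<dots> \<le> \<bar>x\<bar> * 1" using exp_ge_add_one_self[of x] by linarith
    also have "\<dots> \<le> \<bar>x\<bar> * exp \<bar>x\<bar>" by (intro mult_left_mono) auto
    finally show ?thesis .
  qed
  have "exp x - 1 - x \<le> x * (exp x - 1)" using 2 by (simp add: algebra_simps)
  also have "\<dots> \<le> \<bar>x\<bar> * \<bar>exp x - 1\<bar>" by (metis abs_ge_self abs_mult)
  also have "\<dots> \<le> \<bar>x\<bar> * (\<bar>x\<bar> * exp \<bar>x\<bar>)" using 3 by (intro mult_left_mono) auto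
  finally show ?thesis using 1 by (simp add: power2_eq_square abs_mult_self_eq flip: mult.assoc)
qed

text \<open>The logarithm of the density of \<open>N(0, 1 + u)\<close> relative to \<open>N(0, 1)\<close>.\<close>

definition log_ratio :: "real \<Rightarrow> real \<Rightarrow> real" where
  "log_ratio u x = - ln (1 + u) / 2 + x\<^sup>2 / 2 * (u / (1 + u))"

lemma normal_density_eq_log_ratio:
  assumes "\<bar>u\<bar> \<le> 1/8"
  shows "normal_density 0 (sqrt (1 + u)) x = normal_density 0 1 x * exp (log_ratio u x)"
proof -
  have u: "1 + u > 0" using assms by linarith
  have "ln (sqrt (1 + u)) = ln (1 + u) / 2" using u by (simp add: ln_sqrt)
  then have "exp (- ln (1 + u) / 2) = exp (- ln (sqrt (1 + u)))" by simp
  also have "\<dots> = 1 / sqrt (1 + u)" using u by (simp add: exp_minus inverse_eq_divide)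
  finally have e: "exp (- ln (1 + u) / 2) = 1 / sqrt (1 + u)" .
  have eq: "- x\<^sup>2 / (2 * (1 + u)) = - x\<^sup>2 / 2 + x\<^sup>2 / 2 * (u / (1 + u))"
    using u by (simp add: field_simps)
  have "normal_density 0 (sqrt (1 + u)) x = 1 / sqrt (2 * pi * (1 + u)) * exp (- x\<^sup>2 / (2 * (1 + u)))"
    using u by (simp add: normal_density_def)
  also have "exp (- x\<^sup>2 / (2 * (1 + u))) = exp (- x\<^sup>2 / 2) * exp (x\<^sup>2 / 2 * (u / (1 + u)))"
    by (simp only: eq exp_add)
  also have "1 / sqrt (2 * pi * (1 + u)) = 1 / sqrt (2 * pi) * exp (- ln (1 + u) / 2)"
    by (simp only: real_sqrt_mult e) simp
  finally show ?thesis
    by (simp only: log_ratio_def exp_add normal_density_def) simp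
qed

text \<open>The factor \<open>(x\<^sup>2 - 1) / 2\<close> is the derivative of
  \<open>log_ratio\<close> in \<open>u\<close> at \<open>0\<close>. The last bound keeps the density
  ratio far below the threshold \<open>exp (x\<^sup>2 / 2)\<close> of integrability against the
  standard normal, which leaves room for polynomial factors.\<close>

lemma log_ratio_bounds:
  assumes u: "\<bar>u\<bar> \<le> 1/8"
  shows "\<bar>log_ratio u x - u * ((x\<^sup>2 - 1) / 2)\<bar> \<le> u\<^sup>2 * (1 + x\<^sup>2)"
    and "\<bar>log_ratio u x\<bar> \<le> \<bar>u\<bar> * (1 + x\<^sup>2)"
    and "\<bar>log_ratio u x\<bar> \<le> (1 + x\<^sup>2) / 12"
proof -
  have pos: "1 + u > 0" "1 + u \<ge> 1/2" using u by linarith+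
  have 1: "\<bar>ln (1 + u) - u\<bar> \<le> 2 * u\<^sup>2"
    using u by (intro abs_ln_one_plus_x_minus_x_bound) auto
  have eq: "log_ratio u x - u * ((x\<^sup>2 - 1) / 2) = - (ln (1 + u) - u) / 2 - x\<^sup>2 / 2 * (u\<^sup>2 / (1 + u))"
    using pos by (simp add: log_ratio_def field_simps power2_eq_square)
  have "u\<^sup>2 / (1 + u) \<le> u\<^sup>2 / (1/2)" using pos by (intro divide_left_mono) auto
  then have "x\<^sup>2 / 2 * (u\<^sup>2 / (1 + u)) \<le> x\<^sup>2 / 2 * (u\<^sup>2 / (1/2))" by (intro mult_left_mono) auto
  then have t: "0 \<le> x\<^sup>2 / 2 * (u\<^sup>2 / (1 + u))" "x\<^sup>2 / 2 * (u\<^sup>2 / (1 + u)) \<le> u\<^sup>2 * x\<^sup>2"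
    using pos by (simp_all add: mult.commute)
  show b: "\<bar>log_ratio u x - u * ((x\<^sup>2 - 1) / 2)\<bar> \<le> u\<^sup>2 * (1 + x\<^sup>2)"
  proof -
    have "\<bar>- y / 2 - t\<bar> \<le> a + b" if "\<bar>y\<bar> \<le> 2 * a" "0 \<le> t" "t \<le> b" for y t a b :: real
      using that by linarith
    from this[OF 1 t] show ?thesis
      unfolding eq by (simp only: ring_distribs mult_1_right)
  qed
  have "u\<^sup>2 \<le> \<bar>u\<bar> * (1/8)"
    using mult_left_mono[OF u, of "\<bar>u\<bar>"] by (simp add: power2_eq_square)
  then have "u\<^sup>2 * (1 + x\<^sup>2) \<le> \<bar>u\<bar> * (1/8) * (1 + x\<^sup>2)" by (intro mult_right_mono) auto
  moreover have "\<bar>u * ((x\<^sup>2 - 1) / 2)\<bar> \<le> \<bar>u\<bar> * ((1 + x\<^sup>2) / 2)"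
  proof -
    have "\<bar>(x\<^sup>2 - 1) / 2\<bar> \<le> (1 + x\<^sup>2) / 2" using zero_le_power2[of x] by (simp add: abs_le_iff field_simps)
    then show ?thesis unfolding abs_mult by (intro mult_left_mono) auto
  qed
  moreover have "\<bar>z\<bar> \<le> \<bar>l\<bar> + \<bar>z - l\<bar>" for z l :: real by linarith
  from this[of "log_ratio u x" "u * ((x\<^sup>2 - 1) / 2)"]
  have "\<bar>log_ratio u x\<bar> \<le> \<bar>u * ((x\<^sup>2 - 1) / 2)\<bar> + u\<^sup>2 * (1 + x\<^sup>2)" using b by linarith
  ultimately have c: "\<bar>log_ratio u x\<bar> \<le> \<bar>u\<bar> * (1 + x\<^sup>2) * (5/8)"
    by (simp add: field_simps)
  have nn: "0 \<le> \<bar>u\<bar> * (1 + x\<^sup>2)" by simp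
  show "\<bar>log_ratio u x\<bar> \<le> \<bar>u\<bar> * (1 + x\<^sup>2)" using c nn by linarith
  have "\<bar>u\<bar> * (1 + x\<^sup>2) \<le> 1/8 * (1 + x\<^sup>2)" using u by (intro mult_right_mono) auto
  then show "\<bar>log_ratio u x\<bar> \<le> (1 + x\<^sup>2) / 12" using c nn zero_le_power2[of x] by linarith
qed

lemma borel_measurable_log_ratio [measurable]: "log_ratio u \<in> borel_measurable borel"
  unfolding log_ratio_def by measurable

lemma normal_prod_eq_density:
  assumes fin: "finite Q" and u: "\<And>q. q \<in> Q \<Longrightarrow> \<bar>u q\<bar> \<le> 1/8"
  shows "normal_prod Q (\<lambda>q. sqrt (1 + u q)) =
    density (normal_prod Q (\<lambda>_. 1)) (\<lambda>x. ennreal (exp (\<Sum>q\<in>Q. log_ratio (u q) (x q))))"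
proof -
  \<comment> \<open>Extension by \<open>0\<close> makes every factor of the family over
    \<open>UNIV\<close> a probability measure, as the product locale demands.\<close>
  let ?u = "\<lambda>q. if q \<in> Q then u q else 0"
  let ?N = "\<lambda>q. density lborel (normal_density 0 (sqrt (1 + ?u q)))"
  let ?S = "\<lambda>_::'a. density lborel (normal_density 0 1)"
  have u': "\<bar>?u q\<bar> \<le> 1/8" for q using u by auto
  have pos: "1 + ?u q > 0" for q using u'[of q] by linarith
  interpret N: product_prob_space ?N UNIV
    by (intro product_prob_spaceI prob_space_normal_density) (use pos in auto)
  interpret S: product_prob_space ?S UNIV
    by (intro product_prob_spaceI prob_space_normal_density) auto
  have cong: "normal_prod Q (\<lambda>q. sqrt (1 + u q)) = PiM Q ?N"
    by (rule PiM_cong) auto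
  show ?thesis unfolding cong
  proof (rule N.PiM_eqI[OF fin, symmetric])
    show "sets (density (normal_prod Q (\<lambda>_. 1)) (\<lambda>x. ennreal (exp (\<Sum>q\<in>Q. log_ratio (u q) (x q))))) = sets (PiM Q ?N)"
      by (simp add: cong: sets_PiM_cong)
    fix A assume A: "\<And>q. q \<in> Q \<Longrightarrow> A q \<in> sets (?N q)"
    then have [measurable]: "A q \<in> sets borel" if "q \<in> Q" for q using that by simp
    have PA: "PiE Q A \<in> sets (normal_prod Q (\<lambda>_. 1))" using fin by (simp add: sets_PiM_I_finite)
    have ind: "indicator (PiE Q A) x = (\<Prod>q\<in>Q. indicator (A q) (x q) :: ennreal)" if "x \<in> space (normal_prod Q (\<lambda>_. 1))" for x
      using that fin by (auto simp: indicator_def space_PiM PiE_iff prod_eq_1_iff prod_zero_iff)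
    have "emeasure (density (normal_prod Q (\<lambda>_. 1)) (\<lambda>x. ennreal (exp (\<Sum>q\<in>Q. log_ratio (u q) (x q))))) (PiE Q A)
       = (\<integral>\<^sup>+x. ennreal (exp (\<Sum>q\<in>Q. log_ratio (u q) (x q))) * indicator (PiE Q A) x \<partial>normal_prod Q (\<lambda>_. 1))"
      by (rule emeasure_density[OF _ PA]) measurable
    also have "\<dots> = (\<integral>\<^sup>+x. (\<Prod>q\<in>Q. ennreal (exp (log_ratio (u q) (x q))) * indicator (A q) (x q)) \<partial>normal_prod Q (\<lambda>_. 1))"
      by (intro nn_integral_cong) (simp add: ind exp_sum fin prod.distrib prod_ennreal)
    also have "\<dots> = (\<Prod>q\<in>Q. \<integral>\<^sup>+x. ennreal (exp (log_ratio (u q) x)) * indicator (A q) x \<partial>density lborel (normal_density 0 1))"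
      by (rule S.product_nn_integral_prod[OF fin]) measurable
    also have "\<dots> = (\<Prod>q\<in>Q. emeasure (?N q) (A q))"
    proof (rule prod.cong[OF refl])
      fix q assume q: "q \<in> Q"
      have [measurable]: "A q \<in> sets borel" using A[OF q] by simp
      have "(\<integral>\<^sup>+x. ennreal (exp (log_ratio (u q) x)) * indicator (A q) x \<partial>density lborel (normal_density 0 1))
        = (\<integral>\<^sup>+x. ennreal (normal_density 0 1 x) * (ennreal (exp (log_ratio (u q) x)) * indicator (A q) x) \<partial>lborel)"
        by (subst nn_integral_density) auto
      also have "\<dots> = (\<integral>\<^sup>+x. ennreal (normal_density 0 (sqrt (1 + u q)) x) * indicator (A q) x \<partial>lborel)"
        by (intro nn_integral_cong)
          (simp add: normal_density_eq_log_ratio[OF u[OF q]] ennreal_mult mult.assoc del: normal_density_def)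
      also have "\<dots> = emeasure (?N q) (A q)" using q by (subst emeasure_density) auto
      finally show "(\<integral>\<^sup>+x. ennreal (exp (log_ratio (u q) x)) * indicator (A q) x \<partial>density lborel (normal_density 0 1)) = emeasure (?N q) (A q)" .
    qed
    finally show "emeasure (density (normal_prod Q (\<lambda>_. 1)) (\<lambda>x. ennreal (exp (\<Sum>q\<in>Q. log_ratio (u q) (x q))))) (PiE Q A) = (\<Prod>q\<in>Q. emeasure (?N q) (A q))" .
  qed
qed

text \<open>The exponent \<open>3/8\<close> is below \<open>1/2\<close>: in each coordinate, the
  weighted standard density is twice the normal density with standard deviation
  \<open>2\<close>.\<close>

lemma integrable_exp_sum_squares:
  assumes fin: "finite Q"
  shows "integrable (normal_prod Q (\<lambda>_. 1)) (\<lambda>x. exp (3/8 * (\<Sum>q\<in>Q. (x q)\<^sup>2)))"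
proof -
  let ?S = "\<lambda>_::'a. density lborel (normal_density 0 1)"
  interpret S: product_prob_space ?S UNIV
    by (intro product_prob_spaceI prob_space_normal_density) auto
  have eq: "normal_density 0 1 x * exp (3/8 * x\<^sup>2) = 2 * normal_density 0 2 x" for x :: real
  proof -
    have "- x\<^sup>2 / 2 + 3/8 * x\<^sup>2 = - x\<^sup>2 / 8" by (simp add: field_simps)
    then have "exp (- x\<^sup>2 / 2) * exp (3/8 * x\<^sup>2) = exp (- x\<^sup>2 / 8)" by (simp flip: exp_add)
    moreover have "sqrt (8 * pi) = 2 * sqrt (2 * pi)"
      using real_sqrt_mult[of 4 "2 * pi"] by simp
    ultimately show ?thesis by (simp add: normal_density_def)
  qed
  have "integrable (density lborel (normal_density 0 1)) (\<lambda>x. exp (3/8 * x\<^sup>2))"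
    by (subst integrable_density) (auto simp: eq simp del: times_divide_eq_left)
  then have "integrable (PiM Q ?S) (\<lambda>x. \<Prod>q\<in>Q. exp (3/8 * (x q)\<^sup>2))"
    by (intro S.product_integrable_prod fin)
  then show ?thesis using fin by (simp add: exp_sum sum_distrib_left)
qed

text \<open>Here \<open>1728 = 12 ^ 3\<close>, from \<open>1 + t \<le> exp t\<close> at
  \<open>t = R / 12\<close>. The cube arises from one factor of the test function and two of the
  remainder; \<open>1/4\<close> together with the \<open>1/12\<close> of the log density stays below
  the integrable \<open>3/8\<close>.\<close>

lemma cube_le_exp:
  fixes R :: real assumes "0 \<le> R" shows "(1 + R) ^ 3 \<le> 1728 * exp (R / 4)"
proof -
  have "1 + R \<le> 12 * (1 + R / 12)" using assms by simp
  also have "\<dots> \<le> 12 * exp (R / 12)" using exp_ge_add_one_self[of "R/12"] by (intro mult_left_mono) auto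
  finally have "(1 + R) ^ 3 \<le> (12 * exp (R / 12)) ^ 3" using assms by (intro power_mono) auto
  also have "\<dots> = 1728 * exp (R / 4)" by (simp add: power_mult_distrib flip: exp_of_nat_mult)
  finally show ?thesis .
qed

text \<open>The variances only enter through the density ratio \<open>exp (P x)\<close>, which is
  split into \<open>1\<close>, a part \<open>l\<close> linear in \<open>u\<close>, and a remainder
  quadratic in the sum of the \<open>\<bar>u q\<bar>\<close>. Hence \<open>g\<close> need only be
  measurable of quadratic growth, and \<open>C\<close> depends on \<open>Q\<close> alone.\<close>

lemma normal_prod_perturbation:
  fixes Q :: "'q set"
  assumes fin: "finite Q"
  obtains C where "C \<ge> 0"
    and "\<And>B g q. g \<in> borel_measurable (\<Pi>\<^sub>M q\<in>Q. borel) \<Longrightarrow>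
      (\<And>x. \<bar>g x\<bar> \<le> B * (1 + (\<Sum>q\<in>Q. (x q)\<^sup>2))) \<Longrightarrow> q \<in> Q \<Longrightarrow>
      \<bar>\<integral>x. g x * (((x q)\<^sup>2 - 1) / 2) \<partial>normal_prod Q (\<lambda>_. 1)\<bar> \<le> C * B"
    and "\<And>B g u. g \<in> borel_measurable (\<Pi>\<^sub>M q\<in>Q. borel) \<Longrightarrow>
      (\<And>x. \<bar>g x\<bar> \<le> B * (1 + (\<Sum>q\<in>Q. (x q)\<^sup>2))) \<Longrightarrow> (\<And>q. q \<in> Q \<Longrightarrow> \<bar>u q\<bar> \<le> 1/8) \<Longrightarrow>
      \<bar>(\<integral>x. g x \<partial>normal_prod Q (\<lambda>q. sqrt (1 + u q))) - (\<integral>x. g x \<partial>normal_prod Q (\<lambda>_. 1))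
        - (\<Sum>q\<in>Q. u q * (\<integral>x. g x * (((x q)\<^sup>2 - 1) / 2) \<partial>normal_prod Q (\<lambda>_. 1)))\<bar>
      \<le> C * B * (\<Sum>q\<in>Q. \<bar>u q\<bar>)\<^sup>2"
proof -
  let ?S = "normal_prod Q (\<lambda>_. 1)"
  define R where "R x = (\<Sum>q\<in>Q. (x q)\<^sup>2)" for x :: "'q \<Rightarrow> real"
  have R0: "R x \<ge> 0" for x by (simp add: R_def sum_nonneg)
  have Rq: "(x q)\<^sup>2 \<le> R x" if "q \<in> Q" for x q
    unfolding R_def by (rule member_le_sum) (use that fin in auto)
  define E where "E x = exp (3/8 * R x)" for x
  have Eint: "integrable ?S E"
    unfolding E_def[abs_def] R_def by (rule integrable_exp_sum_squares[OF fin])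
  define n where "n = real (card Q)"
  \<comment> \<open>The number is \<open>2 * 1728\<close>: the remainder consists of the error of
    the exponential and the error of the logarithm, each within the same bound. The factor
    \<open>exp (n / 12)\<close> is the constant part of the bound on
    \<open>exp \<bar>P x\<bar>\<close>.\<close>
  define C where "C = 3456 * exp (n / 12) * (\<integral>x. E x \<partial>?S)"
  have IE: "0 \<le> (\<integral>x. E x \<partial>?S)" by (intro integral_nonneg_AE) (simp add: E_def)
  have C1: "1728 * (\<integral>x. E x \<partial>?S) \<le> C"
  proof -
    have "1728 * 1 * (\<integral>x. E x \<partial>?S) \<le> 3456 * exp (n / 12) * (\<integral>x. E x \<partial>?S)"
      using IE by (intro mult_right_mono mult_mono) (auto simp: n_def)
    then show ?thesis by (simp add: C_def)
  qed
  have C0: "C \<ge> 0" using C1 IE by linarith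
  have poly: "(1 + R x) ^ 3 \<le> 1728 * exp (R x / 4)" for x using cube_le_exp[OF R0] .
  have Bpos: "B \<ge> 0" if g: "\<And>x. \<bar>g x\<bar> \<le> B * (1 + (\<Sum>q\<in>Q. (x q)\<^sup>2))" for B :: real and g
  proof -
    have "0 \<le> B * (1 + R undefined)" using order_trans[OF abs_ge_zero g[of undefined]] by (simp add: R_def)
    then show ?thesis using R0[of undefined] by (simp add: zero_le_mult_iff)
  qed
  have dom1: "\<bar>g x * (((x q)\<^sup>2 - 1) / 2)\<bar> \<le> B * (1728 * E x)"
    if g: "\<And>x. \<bar>g x\<bar> \<le> B * (1 + (\<Sum>q\<in>Q. (x q)\<^sup>2))" and q: "q \<in> Q" for B g q x
  proof -
    have B: "B \<ge> 0" using Bpos[OF g] .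
    have "\<bar>(y - 1) / 2\<bar> \<le> 1 + r" if "0 \<le> y" "y \<le> r" for y r :: real
      using that by (simp add: abs_le_iff field_simps)
    from this[OF zero_le_power2 Rq[OF q]] have "\<bar>((x q)\<^sup>2 - 1) / 2\<bar> \<le> 1 + R x" .
    then have "\<bar>g x * (((x q)\<^sup>2 - 1) / 2)\<bar> \<le> (B * (1 + R x)) * (1 + R x)"
      unfolding abs_mult using g[of x] R0[of x] B by (intro mult_mono) (auto simp: R_def)
    also have "\<dots> = B * (1 + R x) ^ 2" by (simp add: power2_eq_square)
    also have "\<dots> \<le> B * (1 + R x) ^ 3" using B R0[of x] by (intro mult_left_mono power_increasing) auto
    also have "\<dots> \<le> B * (1728 * exp (R x / 4))" using poly B by (intro mult_left_mono) auto
    also have "\<dots> \<le> B * (1728 * E x)" using B R0[of x] by (intro mult_left_mono) (auto simp: E_def)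
    finally show ?thesis .
  qed
  have int1: "integrable ?S (\<lambda>x. g x * (((x q)\<^sup>2 - 1) / 2))"
    if gm: "g \<in> borel_measurable (\<Pi>\<^sub>M q\<in>Q. borel)"
      and g: "\<And>x. \<bar>g x\<bar> \<le> B * (1 + (\<Sum>q\<in>Q. (x q)\<^sup>2))" and q: "q \<in> Q" for B g q
  proof (rule Bochner_Integration.integrable_bound)
    show "integrable ?S (\<lambda>x. B * (1728 * E x))" using Eint by simp
    have [measurable]: "g \<in> borel_measurable (\<Pi>\<^sub>M q\<in>Q. borel)" by fact
    show "(\<lambda>x. g x * (((x q)\<^sup>2 - 1) / 2)) \<in> borel_measurable ?S" using q by measurable
    show "AE x in ?S. norm (g x * (((x q)\<^sup>2 - 1) / 2)) \<le> norm (B * (1728 * E x))"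
      using dom1[OF g q] by (intro AE_I2) (smt (verit) real_norm_def)
  qed
  have bound1: "\<bar>\<integral>x. g x * (((x q)\<^sup>2 - 1) / 2) \<partial>?S\<bar> \<le> C * B"
    if gm: "g \<in> borel_measurable (\<Pi>\<^sub>M q\<in>Q. borel)"
      and g: "\<And>x. \<bar>g x\<bar> \<le> B * (1 + (\<Sum>q\<in>Q. (x q)\<^sup>2))" and q: "q \<in> Q" for B g q
  proof -
    have "\<bar>\<integral>x. g x * (((x q)\<^sup>2 - 1) / 2) \<partial>?S\<bar> \<le> (\<integral>x. B * (1728 * E x) \<partial>?S)"
      by (intro order_trans[OF integral_abs_bound] integral_mono integrable_abs int1[OF gm g q] dom1[OF g q]
          integrable_mult_right Eint)
    also have "\<dots> = B * (1728 * (\<integral>x. E x \<partial>?S))" by simp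
    also have "\<dots> \<le> B * C" using C1 Bpos[OF g] by (intro mult_left_mono) auto
    finally show ?thesis by (simp add: mult.commute)
  qed
  have bound2: "\<bar>(\<integral>x. g x \<partial>normal_prod Q (\<lambda>q. sqrt (1 + u q))) - (\<integral>x. g x \<partial>?S)
        - (\<Sum>q\<in>Q. u q * (\<integral>x. g x * (((x q)\<^sup>2 - 1) / 2) \<partial>?S))\<bar> \<le> C * B * (\<Sum>q\<in>Q. \<bar>u q\<bar>)\<^sup>2"
    if gm: "g \<in> borel_measurable (\<Pi>\<^sub>M q\<in>Q. borel)"
      and g: "\<And>x. \<bar>g x\<bar> \<le> B * (1 + (\<Sum>q\<in>Q. (x q)\<^sup>2))" and u: "\<And>q. q \<in> Q \<Longrightarrow> \<bar>u q\<bar> \<le> 1/8" for B g u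
  proof -
    have [measurable]: "g \<in> borel_measurable (\<Pi>\<^sub>M q\<in>Q. borel)" by fact
    have B: "B \<ge> 0" using Bpos[OF g] .
    define a where "a = (\<Sum>q\<in>Q. \<bar>u q\<bar>)"
    have a0: "a \<ge> 0" by (simp add: a_def sum_nonneg)
    define P where "P x = (\<Sum>q\<in>Q. log_ratio (u q) (x q))" for x
    define l where "l x = (\<Sum>q\<in>Q. u q * (((x q)\<^sup>2 - 1) / 2))" for x
    have [measurable]: "P \<in> borel_measurable (\<Pi>\<^sub>M q\<in>Q. borel)" "l \<in> borel_measurable (\<Pi>\<^sub>M q\<in>Q. borel)"
      unfolding P_def l_def by measurable
    have Pa: "\<bar>P x\<bar> \<le> a * (1 + R x)" for x
    proof -
      have "\<bar>P x\<bar> \<le> (\<Sum>q\<in>Q. \<bar>u q\<bar> * (1 + (x q)\<^sup>2))"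
        unfolding P_def by (intro order_trans[OF sum_abs] sum_mono log_ratio_bounds u)
      also have "\<dots> \<le> (\<Sum>q\<in>Q. \<bar>u q\<bar> * (1 + R x))" by (intro sum_mono mult_left_mono) (auto simp: Rq)
      finally show ?thesis by (simp add: a_def sum_distrib_right)
    qed
    have Pe: "\<bar>P x\<bar> \<le> (n + R x) / 12" for x
    proof -
      have "\<bar>P x\<bar> \<le> (\<Sum>q\<in>Q. (1 + (x q)\<^sup>2) / 12)"
        unfolding P_def by (intro order_trans[OF sum_abs] sum_mono log_ratio_bounds u)
      then show ?thesis by (simp add: R_def n_def sum.distrib flip: sum_divide_distrib)
    qed
    have Pl: "\<bar>P x - l x\<bar> \<le> a\<^sup>2 * (1 + R x)" for x
    proof -
      have "\<bar>P x - l x\<bar> \<le> (\<Sum>q\<in>Q. (u q)\<^sup>2 * (1 + (x q)\<^sup>2))"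
        unfolding P_def l_def sum_subtractf[symmetric]
        by (intro order_trans[OF sum_abs] sum_mono log_ratio_bounds u)
      also have "\<dots> \<le> (\<Sum>q\<in>Q. (\<bar>u q\<bar> * a) * (1 + R x))"
      proof (intro sum_mono mult_mono)
        fix q assume q: "q \<in> Q"
        have "\<bar>u q\<bar> \<le> a" unfolding a_def by (rule member_le_sum) (use q fin in auto)
        then show "(u q)\<^sup>2 \<le> \<bar>u q\<bar> * a"
          using mult_left_mono[of "\<bar>u q\<bar>" a "\<bar>u q\<bar>"] by (simp add: power2_eq_square abs_mult_self_eq)
      qed (use a0 R0 Rq in auto)
      also have "\<dots> = a\<^sup>2 * (1 + R x)" by (simp add: a_def power2_eq_square flip: sum_distrib_right)
      finally show ?thesis .
    qed
    define r where "r x = exp (P x) - 1 - l x" for x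
    have [measurable]: "r \<in> borel_measurable (\<Pi>\<^sub>M q\<in>Q. borel)" unfolding r_def by measurable
    have rb: "\<bar>r x\<bar> \<le> 2 * a\<^sup>2 * (1 + R x)\<^sup>2 * (exp (n / 12) * exp (R x / 12))" for x
    proof -
      let ?e = "exp (n / 12) * exp (R x / 12)"
      have e1: "1 \<le> ?e" using R0[of x] by (simp add: n_def flip: exp_add)
      have "exp \<bar>P x\<bar> \<le> ?e" using Pe[of x] by (simp add: add_divide_distrib flip: exp_add)
      moreover have "(P x)\<^sup>2 \<le> (a * (1 + R x))\<^sup>2" using Pa[of x] by (metis abs_le_square_iff abs_of_nonneg abs_ge_zero order_trans)
      ultimately have "(P x)\<^sup>2 * exp \<bar>P x\<bar> \<le> (a * (1 + R x))\<^sup>2 * ?e" by (intro mult_mono) auto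
      then have 1: "\<bar>exp (P x) - 1 - P x\<bar> \<le> a\<^sup>2 * (1 + R x)\<^sup>2 * ?e"
        using abs_exp_minus_one_minus_le[of "P x"] by (simp add: power_mult_distrib)
      have "a\<^sup>2 * (1 + R x) \<le> a\<^sup>2 * (1 + R x)\<^sup>2 * ?e"
      proof -
        have "(1 + R x) * 1 \<le> (1 + R x)\<^sup>2 * ?e"
          using e1 R0[of x] by (intro mult_mono) (auto simp: power2_eq_square algebra_simps)
        then show ?thesis using mult_left_mono[of "(1 + R x) * 1" "(1 + R x)\<^sup>2 * ?e" "a\<^sup>2"] by (simp add: mult.assoc)
      qed
      moreover have "\<bar>r x\<bar> \<le> \<bar>exp (P x) - 1 - P x\<bar> + \<bar>P x - l x\<bar>" unfolding r_def by linarith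
      ultimately show ?thesis using 1 Pl[of x] by linarith
    qed
    have dom: "\<bar>g x * r x\<bar> \<le> (3456 * exp (n / 12) * B * a\<^sup>2) * E x" for x
    proof -
      have "\<bar>g x * r x\<bar> \<le> (B * (1 + R x)) * (2 * a\<^sup>2 * (1 + R x)\<^sup>2 * (exp (n / 12) * exp (R x / 12)))"
        unfolding abs_mult using g[of x] rb[of x] R0[of x] B by (intro mult_mono) (auto simp: R_def)
      also have "\<dots> = (2 * a\<^sup>2 * B * exp (n / 12)) * ((1 + R x)^3 * exp (R x / 12))"
        by (simp add: power3_eq_cube power2_eq_square)
      also have "\<dots> \<le> (2 * a\<^sup>2 * B * exp (n / 12)) * ((1728 * exp (R x / 4)) * exp (R x / 12))"
        using poly B by (intro mult_left_mono mult_right_mono) auto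
      also have "\<dots> = (3456 * exp (n / 12) * B * a\<^sup>2) * (exp (R x / 4) * exp (R x / 12))" by simp
      also have "\<dots> \<le> (3456 * exp (n / 12) * B * a\<^sup>2) * E x"
        using B R0[of x] by (intro mult_left_mono) (auto simp: E_def simp flip: exp_add)
      finally show ?thesis .
    qed
    have dom0: "\<bar>g x\<bar> \<le> B * (1728 * E x)" for x
    proof -
      have "\<bar>g x\<bar> \<le> B * (1 + R x)" using g[of x] by (simp add: R_def)
      also have "\<dots> \<le> B * (1 + R x) ^ 3" using B R0[of x] power_increasing[of 1 3 "1 + R x"] by (intro mult_left_mono) auto
      also have "\<dots> \<le> B * (1728 * exp (R x / 4))" using poly B by (intro mult_left_mono) auto
      also have "\<dots> \<le> B * (1728 * E x)" using B R0[of x] by (intro mult_left_mono) (auto simp: E_def)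
      finally show ?thesis .
    qed
    have ig: "integrable ?S g"
      by (rule Bochner_Integration.integrable_bound[where f="\<lambda>x. B * (1728 * E x)"])
        (use Eint dom0 in \<open>auto intro!: AE_I2 intro: order_trans[OF _ abs_ge_self]\<close>)
    have ir: "integrable ?S (\<lambda>x. g x * r x)"
      by (rule Bochner_Integration.integrable_bound[where f="\<lambda>x. (3456 * exp (n / 12) * B * a\<^sup>2) * E x"])
        (use Eint dom in \<open>auto intro!: AE_I2 intro: order_trans[OF _ abs_ge_self]\<close>)
    have il: "integrable ?S (\<lambda>x. \<Sum>q\<in>Q. u q * (g x * (((x q)\<^sup>2 - 1) / 2)))"
      using int1[OF gm g] by (intro Bochner_Integration.integrable_sum integrable_mult_right) auto
    have Nd: "normal_prod Q (\<lambda>q. sqrt (1 + u q)) = density ?S (\<lambda>x. ennreal (exp (P x)))"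
      unfolding P_def by (rule normal_prod_eq_density[OF fin u])
    have "(\<integral>x. g x \<partial>normal_prod Q (\<lambda>q. sqrt (1 + u q))) = (\<integral>x. exp (P x) * g x \<partial>?S)"
      unfolding Nd by (subst integral_density) auto
    also have "\<dots> = (\<integral>x. g x + (\<Sum>q\<in>Q. u q * (g x * (((x q)\<^sup>2 - 1) / 2))) + g x * r x \<partial>?S)"
      by (intro Bochner_Integration.integral_cong) (auto simp: r_def l_def algebra_simps sum_distrib_left)
    also have "\<dots> = (\<integral>x. g x \<partial>?S) + (\<Sum>q\<in>Q. u q * (\<integral>x. g x * (((x q)\<^sup>2 - 1) / 2) \<partial>?S)) + (\<integral>x. g x * r x \<partial>?S)"
    proof -
      have "(\<integral>x. (\<Sum>q\<in>Q. u q * (g x * (((x q)\<^sup>2 - 1) / 2))) \<partial>?S) = (\<Sum>q\<in>Q. u q * (\<integral>x. g x * (((x q)\<^sup>2 - 1) / 2) \<partial>?S))"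
        by (subst Bochner_Integration.integral_sum)
          (intro integrable_mult_right int1[OF gm g], assumption, simp only: integral_mult_right_zero)
      then show ?thesis
        using Bochner_Integration.integral_add[OF Bochner_Integration.integrable_add[OF ig il] ir]
          Bochner_Integration.integral_add[OF ig il] by simp
    qed
    finally have "\<bar>(\<integral>x. g x \<partial>normal_prod Q (\<lambda>q. sqrt (1 + u q))) - (\<integral>x. g x \<partial>?S)
        - (\<Sum>q\<in>Q. u q * (\<integral>x. g x * (((x q)\<^sup>2 - 1) / 2) \<partial>?S))\<bar> = \<bar>\<integral>x. g x * r x \<partial>?S\<bar>" by simp
    also have "\<dots> \<le> (\<integral>x. (3456 * exp (n / 12) * B * a\<^sup>2) * E x \<partial>?S)"
      using ir Eint dom by (intro order_trans[OF integral_abs_bound] integral_mono) auto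
    also have "\<dots> = C * B * a\<^sup>2" by (simp add: C_def)
    finally show ?thesis by (simp add: a_def)
  qed
  show ?thesis using that[OF C0] bound1 bound2 by blast
qed

section \<open>Perturbing the covariance of a Gaussian law\<close>

definition normsq :: "nat \<Rightarrow> vec set \<Rightarrow> outputs \<Rightarrow> real" where
  "normsq m X z = (\<Sum>k<m. \<Sum>p\<in>X. (z k p)\<^sup>2)"

definition cov_dist :: "'a set \<Rightarrow> ('a \<Rightarrow> 'a \<Rightarrow> real) \<Rightarrow> ('a \<Rightarrow> 'a \<Rightarrow> real) \<Rightarrow> real" where
  "cov_dist X A K = (\<Sum>p\<in>X. \<Sum>q\<in>X. \<bar>A p q - K p q\<bar>)"

lemma normsq_nonneg: "0 \<le> normsq m X z"
  by (simp add: normsq_def sum_nonneg)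

lemma cov_dist_nonneg: "0 \<le> cov_dist X A K"
  by (simp add: cov_dist_def sum_nonneg)

lemma entry_le_cov_dist:
  assumes "finite X" "p \<in> X" "q \<in> X"
  shows "\<bar>A p q - K p q\<bar> \<le> cov_dist X A K"
proof -
  have "\<bar>A p q - K p q\<bar> \<le> (\<Sum>q\<in>X. \<bar>A p q - K p q\<bar>)"
    using assms by (intro member_le_sum) auto
  also have "\<dots> \<le> cov_dist X A K" unfolding cov_dist_def
    using assms by (intro member_le_sum[where f="\<lambda>p. \<Sum>q\<in>X. \<bar>A p q - K p q\<bar>"]) (auto intro: sum_nonneg)
  finally show ?thesis .
qed

lemma trace_le_cov_dist:
  assumes "finite X"
  shows "(\<Sum>p\<in>X. A p p) \<le> (\<Sum>p\<in>X. K p p) + cov_dist X A K"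
proof -
  have "(\<Sum>p\<in>X. A p p) - (\<Sum>p\<in>X. K p p) \<le> (\<Sum>p\<in>X. \<Sum>q\<in>X. \<bar>A p q - K p q\<bar>)"
    unfolding sum_subtractf[symmetric]
  proof (rule sum_mono)
    fix p assume p: "p \<in> X"
    have "A p p - K p p \<le> \<bar>A p p - K p p\<bar>" by simp
    also have "\<dots> \<le> (\<Sum>q\<in>X. \<bar>A p q - K p q\<bar>)"
      using assms p by (intro member_le_sum[where f="\<lambda>q. \<bar>A p q - K p q\<bar>"]) auto
    finally show "A p p - K p p \<le> (\<Sum>q\<in>X. \<bar>A p q - K p q\<bar>)" .
  qed
  then show ?thesis by (simp add: cov_dist_def)
qed

lemma sum_weighted_le_cov_dist:
  assumes "\<And>p q. p \<in> X \<Longrightarrow> q \<in> X \<Longrightarrow> \<bar>l p q\<bar> \<le> c"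
  shows "\<bar>\<Sum>p\<in>X. \<Sum>q\<in>X. l p q * (A p q - K p q)\<bar> \<le> c * cov_dist X A K"
proof -
  have "\<bar>\<Sum>p\<in>X. \<Sum>q\<in>X. l p q * (A p q - K p q)\<bar> \<le> (\<Sum>p\<in>X. \<Sum>q\<in>X. \<bar>l p q * (A p q - K p q)\<bar>)"
    by (rule order_trans[OF sum_abs]) (intro sum_mono sum_abs)
  also have "\<dots> \<le> (\<Sum>p\<in>X. \<Sum>q\<in>X. c * \<bar>A p q - K p q\<bar>)"
    unfolding abs_mult by (intro sum_mono mult_right_mono assms) auto
  finally show ?thesis by (simp add: cov_dist_def sum_distrib_left)
qed

lemma cov_dist_sq_le:
  fixes B K :: "'a \<Rightarrow> 'a \<Rightarrow> real"
  shows "(cov_dist X B K)\<^sup>2 \<le> (real (card X))\<^sup>2 * (\<Sum>p\<in>X. \<Sum>q\<in>X. (B p q - K p q)\<^sup>2)"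
proof -
  have "(cov_dist X B K)\<^sup>2 = (\<Sum>r\<in>X \<times> X. 1 * \<bar>B (fst r) (snd r) - K (fst r) (snd r)\<bar>)\<^sup>2"
    by (simp add: cov_dist_def sum.cartesian_product')
  also have "\<dots> \<le> (\<Sum>r\<in>X \<times> X. 1\<^sup>2) * (\<Sum>r\<in>X \<times> X. \<bar>B (fst r) (snd r) - K (fst r) (snd r)\<bar>\<^sup>2)"
    by (rule Cauchy_Schwarz_ineq_sum)
  also have "\<dots> = (real (card X))\<^sup>2 * (\<Sum>p\<in>X. \<Sum>q\<in>X. (B p q - K p q)\<^sup>2)"
    by (simp add: sum.cartesian_product' power2_eq_square card_cartesian_product)
  finally show ?thesis .
qed

section \<open>Integrals against independent Gaussian rows\<close>

lemma output_space_component: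
  assumes "k < m" "p \<in> X"
  shows "(\<lambda>z. z k p) \<in> borel_measurable (output_space m X)"
proof -
  have "(\<lambda>z. z k) \<in> output_space m X \<rightarrow>\<^sub>M (\<Pi>\<^sub>M p\<in>X. (borel :: real measure))"
    unfolding output_space_def using assms(1) by (intro measurable_component_singleton) simp
  from measurable_compose[OF this measurable_component_singleton[OF assms(2)]] show ?thesis .
qed

lemma normsq_measurable [measurable]: "normsq m X \<in> borel_measurable (output_space m X)"
  unfolding normsq_def by (intro borel_measurable_sum borel_measurable_power output_space_component) auto

context
  fixes X :: "vec set" and A :: "vec \<Rightarrow> vec \<Rightarrow> real"
  assumes fin: "finite X" and psd: "psd_on X A"
begin

lemma prob_space_centered_gaussian: "prob_space (centered_gaussian X A)"
  using is_centered_gaussian_prob_space[OF is_centered_gaussian_centered_gaussian[OF fin psd]] .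

lemma sets_centered_gaussian: "sets (centered_gaussian X A) = sets (\<Pi>\<^sub>M p\<in>X. borel)"
  using is_centered_gaussian_sets[OF is_centered_gaussian_centered_gaussian[OF fin psd]] .

lemma prob_space_gaussian_outputs: "prob_space (gaussian_outputs m X A)"
  by (intro prob_space_PiM prob_space_centered_gaussian)

lemma sets_gaussian_outputs: "sets (gaussian_outputs m X A) = sets (output_space m X)"
  unfolding output_space_def by (intro sets_PiM_cong refl sets_centered_gaussian)

lemma distr_gaussian_outputs_component:
  assumes "k < m"
  shows "distr (gaussian_outputs m X A) (centered_gaussian X A) (\<lambda>z. z k) = centered_gaussian X A"
  using assms by (intro distr_PiM_component prob_space_centered_gaussian) auto

lemma integral_gaussian_outputs_component:
  fixes f :: "(vec \<Rightarrow> real) \<Rightarrow> real"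
  assumes "k < m" and f: "f \<in> borel_measurable (\<Pi>\<^sub>M p\<in>X. borel)"
  shows "(\<integral>z. f (z k) \<partial>gaussian_outputs m X A) = (\<integral>g. f g \<partial>centered_gaussian X A)"
    and "integrable (gaussian_outputs m X A) (\<lambda>z. f (z k)) \<longleftrightarrow> integrable (centered_gaussian X A) f"
proof -
  have f': "f \<in> borel_measurable (centered_gaussian X A)"
    using f by (simp add: sets_centered_gaussian cong: measurable_cong_sets)
  have m: "(\<lambda>z. z k) \<in> gaussian_outputs m X A \<rightarrow>\<^sub>M centered_gaussian X A" using assms(1) by (intro measurable_component_singleton) simp
  show "(\<integral>z. f (z k) \<partial>gaussian_outputs m X A) = (\<integral>g. f g \<partial>centered_gaussian X A)"
    using integral_distr[OF m f'] unfolding distr_gaussian_outputs_component[OF assms(1)] by simp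
  show "integrable (gaussian_outputs m X A) (\<lambda>z. f (z k)) \<longleftrightarrow> integrable (centered_gaussian X A) f"
    using integrable_distr_eq[OF m f'] unfolding distr_gaussian_outputs_component[OF assms(1)] by simp
qed

lemma integral_normsq:
  shows "integrable (gaussian_outputs m X A) (normsq m X)"
    and "(\<integral>z. normsq m X z \<partial>gaussian_outputs m X A) = real m * (\<Sum>p\<in>X. A p p)"
proof -
  note mom = is_centered_gaussian_moments[OF is_centered_gaussian_centered_gaussian[OF fin psd] fin]
  have i: "integrable (gaussian_outputs m X A) (\<lambda>z. (z k p)\<^sup>2)"
    and e: "(\<integral>z. (z k p)\<^sup>2 \<partial>gaussian_outputs m X A) = A p p" if "k < m" "p \<in> X" for k p
    using integral_gaussian_outputs_component[OF that(1), of "\<lambda>g. (g p)\<^sup>2"] mom[OF that(2) psd_on_diag[OF psd fin that(2)]] that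
    by simp_all
  show "integrable (gaussian_outputs m X A) (normsq m X)"
    unfolding normsq_def by (intro Bochner_Integration.integrable_sum i) auto
  have "(\<integral>z. normsq m X z \<partial>gaussian_outputs m X A) = (\<Sum>k<m. \<Sum>p\<in>X. A p p)"
    unfolding normsq_def
    apply (subst Bochner_Integration.integral_sum)
     apply (intro Bochner_Integration.integrable_sum i; simp)
    apply (intro sum.cong refl)
    apply (subst Bochner_Integration.integral_sum)
     apply (intro i; simp)
    by (intro sum.cong refl e) auto
  then show "(\<integral>z. normsq m X z \<partial>gaussian_outputs m X A) = real m * (\<Sum>p\<in>X. A p p)" by simp
qed

text \<open>A bound in terms of the trace that holds for every covariance, whatever its distance
  from the limit.\<close>

lemma integral_quadratic_bound:
  assumes f: "f \<in> borel_measurable (output_space m X)"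
    and b: "\<And>z. z \<in> space (output_space m X) \<Longrightarrow> \<bar>f z\<bar> \<le> 1 + normsq m X z"
  shows "integrable (gaussian_outputs m X A) f"
    and "\<bar>\<integral>z. f z \<partial>gaussian_outputs m X A\<bar> \<le> 1 + real m * (\<Sum>p\<in>X. A p p)"
proof -
  interpret prob_space "gaussian_outputs m X A" by (rule prob_space_gaussian_outputs)
  have sp: "space (gaussian_outputs m X A) = space (output_space m X)"
    by (rule sets_eq_imp_space_eq[OF sets_gaussian_outputs])
  have i: "integrable (gaussian_outputs m X A) (\<lambda>z. 1 + normsq m X z)"
    using integral_normsq(1) by simp
  show fi: "integrable (gaussian_outputs m X A) f"
  proof (rule Bochner_Integration.integrable_bound[OF i])
    show "f \<in> borel_measurable (gaussian_outputs m X A)"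
      using f by (simp add: sets_gaussian_outputs cong: measurable_cong_sets)
    show "AE z in gaussian_outputs m X A. norm (f z) \<le> norm (1 + normsq m X z)"
      using b normsq_nonneg[of m X] by (intro AE_I2) (simp add: sp)
  qed
  have "\<bar>\<integral>z. f z \<partial>gaussian_outputs m X A\<bar> \<le> (\<integral>z. 1 + normsq m X z \<partial>gaussian_outputs m X A)"
    using fi i b by (intro order_trans[OF integral_abs_bound] integral_mono) (auto simp: sp)
  also have "\<dots> = 1 + real m * (\<Sum>p\<in>X. A p p)"
    using integral_normsq by (simp add: prob_space)
  finally show "\<bar>\<integral>z. f z \<partial>gaussian_outputs m X A\<bar> \<le> 1 + real m * (\<Sum>p\<in>X. A p p)" .
qed

end

text \<open>A derivative \<open>l\<close> of \<open>F\<close> at \<open>K\<close> with explicit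
  constants, along the covariances whose null space contains that of \<open>K\<close>. Both
  estimates hold at every distance from \<open>K\<close>; the Lipschitz one is listed separately
  because a quadratic error is too weak at large distances.\<close>

definition first_order_at :: "vec set \<Rightarrow> (vec \<Rightarrow> vec \<Rightarrow> real) \<Rightarrow> real \<Rightarrow>
    ((vec \<Rightarrow> vec \<Rightarrow> real) \<Rightarrow> real) \<Rightarrow> (vec \<Rightarrow> vec \<Rightarrow> real) \<Rightarrow> bool" where
  "first_order_at X K C F l \<longleftrightarrow> (\<forall>p\<in>X. \<forall>q\<in>X. \<bar>l p q\<bar> \<le> C) \<and> (\<forall>A. cov_below X K A \<longrightarrow>
    \<bar>F A - F K - (\<Sum>p\<in>X. \<Sum>q\<in>X. l p q * (A p q - K p q))\<bar> \<le> C * (cov_dist X A K)\<^sup>2 \<and>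
    \<bar>F A - F K\<bar> \<le> C * cov_dist X A K)"

lemma first_order_at_cong:
  assumes "psd_on X K" "\<And>A. cov_below X K A \<Longrightarrow> F A = F' A" "first_order_at X K C F l"
  shows "first_order_at X K C F' l"
  using assms(2,3) assms(2)[OF cov_below_refl[OF assms(1)]] by (simp add: first_order_at_def)

text \<open>The constant is the same for all admissible \<open>f\<close>. Near \<open>K\<close> the
  Gaussian law is the image under a fixed linear map of independent normals with variances
  \<open>1 + uA A j\<close>, to which the one-dimensional perturbation applies. If some
  \<open>uA A j\<close> exceeds \<open>1/8\<close>, then \<open>cov_dist X A K\<close> is bounded
  below, so even the moment bound on the integrals is of the required order.\<close>

lemma gaussian_outputs_expansion:
  assumes fin: "finite X" and psd: "psd_on X K" and m: "m \<ge> 1"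
  obtains C where "C \<ge> 0"
    and "\<And>f. f \<in> borel_measurable (output_space m X) \<Longrightarrow>
      (\<And>z. z \<in> space (output_space m X) \<Longrightarrow> \<bar>f z\<bar> \<le> 1 + normsq m X z) \<Longrightarrow>
      \<exists>l. first_order_at X K C (\<lambda>A. \<integral>z. f z \<partial>gaussian_outputs m X A) l"
proof -
  obtain J :: "(nat \<times> nat \<times> bool) set" and v a where J: "finite J"
    and frame': "\<forall>A. cov_below X K A \<longrightarrow> (\<forall>p\<in>X. \<forall>q\<in>X.
    A p q = (\<Sum>j\<in>J. (1 + (\<Sum>p'\<in>X. \<Sum>q'\<in>X. a j p' q' * (A p' q' - K p' q'))) * (v j p * v j q)))"
    using rank_one_frame[OF fin psd] by (elim exE conjE)
  note frame = frame'[rule_format]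
  \<comment> \<open>One independent normal variable for every output row and every rank one
    direction.\<close>
  define Q where "Q = {..<m} \<times> J"
  have finQ: "finite Q" using J by (simp add: Q_def)
  obtain C where C: "C \<ge> 0"
    and lin: "\<And>B g q. g \<in> borel_measurable (\<Pi>\<^sub>M q\<in>Q. borel) \<Longrightarrow>
      (\<And>x. \<bar>g x\<bar> \<le> B * (1 + (\<Sum>q\<in>Q. (x q)\<^sup>2))) \<Longrightarrow> q \<in> Q \<Longrightarrow>
      \<bar>\<integral>x. g x * (((x q)\<^sup>2 - 1) / 2) \<partial>normal_prod Q (\<lambda>_. 1)\<bar> \<le> C * B"
    and expan: "\<And>B g u. g \<in> borel_measurable (\<Pi>\<^sub>M q\<in>Q. borel) \<Longrightarrow>
      (\<And>x. \<bar>g x\<bar> \<le> B * (1 + (\<Sum>q\<in>Q. (x q)\<^sup>2))) \<Longrightarrow> (\<And>q. q \<in> Q \<Longrightarrow> \<bar>u q\<bar> \<le> 1/8) \<Longrightarrow>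
      \<bar>(\<integral>x. g x \<partial>normal_prod Q (\<lambda>q. sqrt (1 + u q))) - (\<integral>x. g x \<partial>normal_prod Q (\<lambda>_. 1))
        - (\<Sum>q\<in>Q. u q * (\<integral>x. g x * (((x q)\<^sup>2 - 1) / 2) \<partial>normal_prod Q (\<lambda>_. 1)))\<bar>
      \<le> C * B * (\<Sum>q\<in>Q. \<bar>u q\<bar>)\<^sup>2"
    using normal_prod_perturbation[OF finQ] by blast
  define F where "F \<xi> = (\<lambda>k\<in>{..<m}. \<lambda>p\<in>X. \<Sum>q\<in>{k} \<times> J. v (snd q) p * \<xi> q)" for \<xi> :: "nat \<times> nat \<times> nat \<times> bool \<Rightarrow> real"
  define uA where "uA A j = (\<Sum>p\<in>X. \<Sum>q\<in>X. a j p q * (A p q - K p q))" for A j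
  have Fm: "F \<in> (\<Pi>\<^sub>M q\<in>Q. borel) \<rightarrow>\<^sub>M output_space m X"
    unfolding F_def output_space_def
    by (intro measurable_restrict borel_measurable_sum borel_measurable_times measurable_const
        measurable_component_singleton) (auto simp: Q_def)
  have law: "distr (normal_prod Q (\<lambda>q. sqrt (1 + uA A (snd q)))) (output_space m X) F = gaussian_outputs m X A"
    if A: "cov_below X K A" and u: "\<And>j. j \<in> J \<Longrightarrow> \<bar>uA A j\<bar> \<le> 1/8" for A
  proof -
    have pos: "1 + uA A (snd q) > 0" if "q \<in> Q" for q
      using u[of "snd q"] that by (auto simp: Q_def abs_le_iff)
    then have sp: "sqrt (1 + uA A (snd q)) > 0" if "q \<in> Q" for q using that by simp
    interpret prob_space "normal_prod Q (\<lambda>q. sqrt (1 + uA A (snd q)))"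
      using sp by (rule prob_space_normal_prod)
    show ?thesis unfolding F_def
    proof (rule distr_rows_eq_gaussian_outputs[OF m finQ fin normal_prod_coordinates(1)[OF finQ sp] sp normal_prod_coordinates(2)[OF finQ sp]])
      show "{k} \<times> J \<subseteq> Q" if "k < m" for k using that by (auto simp: Q_def)
      show "disjoint_family_on (\<lambda>k. {k} \<times> J) {..<m}" by (auto simp: disjoint_family_on_def)
      fix k p p' assume k: "k < m" and p: "p \<in> X" "p' \<in> X"
      have "(\<Sum>q\<in>{k} \<times> J. (sqrt (1 + uA A (snd q)))\<^sup>2 * (v (snd q) p * v (snd q) p')) = (\<Sum>j\<in>J. (1 + uA A j) * (v j p * v j p'))"
      proof -
        have "0 \<le> 1 + uA A j" if "j \<in> J" for j using pos[of "(k, j)"] k that by (simp add: Q_def)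
        then show ?thesis unfolding sum.cartesian_product' by (simp cong: sum.cong)
      qed
      also have "\<dots> = A p p'" unfolding uA_def using frame[OF A p] by simp
      finally show "(\<Sum>q\<in>{k} \<times> J. (sqrt (1 + uA A (snd q)))\<^sup>2 * (v (snd q) p * v (snd q) p')) = A p p'" .
    qed
  qed
  have uK: "uA K j = 0" for j by (simp add: uA_def)
  have lawK: "distr (normal_prod Q (\<lambda>_. 1)) (output_space m X) F = gaussian_outputs m X K"
    using law[OF cov_below_refl[OF psd]] by (simp add: uK)
  \<comment> \<open>Cauchy-Schwarz in each row turns quadratic growth in the outputs into quadratic
    growth in the underlying normals.\<close>
  define B where "B = 1 + (\<Sum>p\<in>X. \<Sum>j\<in>J. (v j p)\<^sup>2)"
  have B0: "B \<ge> 1" by (simp add: B_def sum_nonneg)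
  have Fb: "1 + normsq m X (F \<xi>) \<le> B * (1 + (\<Sum>q\<in>Q. (\<xi> q)\<^sup>2))" for \<xi>
  proof -
    have "normsq m X (F \<xi>) = (\<Sum>k<m. \<Sum>p\<in>X. (\<Sum>j\<in>J. v j p * \<xi> (k, j))\<^sup>2)"
      unfolding normsq_def by (intro sum.cong refl) (simp add: F_def sum.cartesian_product')
    also have "\<dots> \<le> (\<Sum>k<m. \<Sum>p\<in>X. (\<Sum>j\<in>J. (v j p)\<^sup>2) * (\<Sum>j\<in>J. (\<xi> (k, j))\<^sup>2))"
      by (intro sum_mono Cauchy_Schwarz_ineq_sum)
    also have "\<dots> = (\<Sum>p\<in>X. \<Sum>j\<in>J. (v j p)\<^sup>2) * (\<Sum>q\<in>Q. (\<xi> q)\<^sup>2)"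
      by (simp only: Q_def sum.cartesian_product' sum_distrib_right[symmetric] sum_distrib_left[symmetric])
    finally have "normsq m X (F \<xi>) \<le> (B - 1) * (\<Sum>q\<in>Q. (\<xi> q)\<^sup>2)" by (simp add: B_def)
    moreover have "0 \<le> (\<Sum>q\<in>Q. (\<xi> q)\<^sup>2)" by (simp add: sum_nonneg)
    ultimately show ?thesis using B0 by (simp add: algebra_simps)
  qed
  define \<alpha> where "\<alpha> = 1 + (\<Sum>j\<in>J. \<Sum>p\<in>X. \<Sum>q\<in>X. \<bar>a j p q\<bar>)"
  have \<alpha>1: "\<alpha> \<ge> 1" by (simp add: \<alpha>_def sum_nonneg)
  have aJ: "\<bar>a j p q\<bar> \<le> (\<Sum>p\<in>X. \<Sum>q\<in>X. \<bar>a j p q\<bar>)" if "p \<in> X" "q \<in> X" for j p q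
    using entry_le_cov_dist[OF fin that, of "a j" "\<lambda>_ _. 0"] by (simp add: cov_dist_def)
  have uA_sum: "(\<Sum>j\<in>J. \<bar>uA A j\<bar>) \<le> \<alpha> * cov_dist X A K" for A
  proof -
    have "(\<Sum>j\<in>J. \<bar>uA A j\<bar>) \<le> (\<Sum>j\<in>J. (\<Sum>p\<in>X. \<Sum>q\<in>X. \<bar>a j p q\<bar>) * cov_dist X A K)"
      unfolding uA_def by (intro sum_mono sum_weighted_le_cov_dist aJ)
    also have "\<dots> = (\<alpha> - 1) * cov_dist X A K" by (simp add: \<alpha>_def sum_distrib_right)
    also have "\<dots> \<le> \<alpha> * cov_dist X A K" by (intro mult_right_mono cov_dist_nonneg) simp
    finally show ?thesis .
  qed
  define tr where "tr = (\<Sum>p\<in>X. K p p)"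
  have tr0: "tr \<ge> 0" unfolding tr_def by (intro sum_nonneg psd_on_diag[OF psd fin])
  \<comment> \<open>\<open>c1\<close> bounds the derivative. Near \<open>K\<close>,
    \<open>c2\<close> and \<open>c3\<close> bound the second-order error as a multiple of
    \<open>d\<^sup>2\<close> and of \<open>d\<close>; away from \<open>K\<close>, \<open>c4\<close>
    bounds all terms together.\<close>
  define c1 where "c1 = real m * \<alpha> * (C * B)"
  define c2 where "c2 = C * B * (real m * \<alpha>)\<^sup>2"
  define c3 where "c3 = C * B * (real (card Q) * (real m * \<alpha>))"
  define c4 where "c4 = (2 + 2 * real m * tr) * (8 * \<alpha>) + real m + c1"
  define CC where "CC = c1 + c2 + c3 + c4 + c4 * (8 * \<alpha>)"
  have nn: "0 \<le> c1" "0 \<le> c2" "0 \<le> c3" "0 \<le> c4" "0 \<le> c4 * (8 * \<alpha>)"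
    using C B0 \<alpha>1 tr0 by (auto simp: c1_def c2_def c3_def c4_def intro!: add_nonneg_nonneg mult_nonneg_nonneg)
  have main: "\<exists>l. first_order_at X K CC (\<lambda>A. \<integral>z. f z \<partial>gaussian_outputs m X A) l"
    if f: "f \<in> borel_measurable (output_space m X)"
      and fb: "\<And>z. z \<in> space (output_space m X) \<Longrightarrow> \<bar>f z\<bar> \<le> 1 + normsq m X z" for f
  proof -
    define g where "g \<xi> = f (F \<xi>)" for \<xi>
    have gm: "g \<in> borel_measurable (\<Pi>\<^sub>M q\<in>Q. borel)"
      unfolding g_def by (rule measurable_compose[OF Fm f])
    have Fsp: "F \<xi> \<in> space (output_space m X)" for \<xi>
      by (auto simp: F_def output_space_def space_PiM)
    have gb: "\<bar>g \<xi>\<bar> \<le> B * (1 + (\<Sum>q\<in>Q. (\<xi> q)\<^sup>2))" for \<xi>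
      unfolding g_def using fb[OF Fsp, of \<xi>] Fb[of \<xi>] by linarith
    define c where "c q = (\<integral>x. g x * (((x q)\<^sup>2 - 1) / 2) \<partial>normal_prod Q (\<lambda>_. 1))" for q
    have cb: "\<bar>c q\<bar> \<le> C * B" if "q \<in> Q" for q unfolding c_def by (rule lin[OF gm gb that])
    define l where "l p q = (\<Sum>r\<in>Q. a (snd r) p q * c r)" for p q
    have lb: "\<bar>l p q\<bar> \<le> c1" if "p \<in> X" "q \<in> X" for p q
    proof -
      have "\<bar>l p q\<bar> \<le> (\<Sum>r\<in>Q. (\<Sum>p\<in>X. \<Sum>q\<in>X. \<bar>a (snd r) p q\<bar>) * (C * B))"
        unfolding l_def using aJ[OF that] cb
        by (intro order_trans[OF sum_abs] sum_mono) (auto simp: abs_mult intro!: mult_mono sum_nonneg)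
      also have "\<dots> = real m * (\<alpha> - 1) * (C * B)"
        by (simp add: Q_def sum.cartesian_product' \<alpha>_def flip: sum_distrib_right)
      also have "\<dots> \<le> c1" unfolding c1_def using C B0 by (intro mult_right_mono mult_left_mono) auto
      finally show ?thesis .
    qed
    have lsum: "(\<Sum>p\<in>X. \<Sum>q\<in>X. l p q * (A p q - K p q)) = (\<Sum>r\<in>Q. uA A (snd r) * c r)" for A
    proof -
      have "(\<Sum>p\<in>X. \<Sum>q\<in>X. l p q * (A p q - K p q)) = (\<Sum>p\<in>X. \<Sum>q\<in>X. \<Sum>r\<in>Q. a (snd r) p q * (A p q - K p q) * c r)"
        unfolding l_def sum_distrib_right by (simp add: mult_ac)
      also have "\<dots> = (\<Sum>r\<in>Q. \<Sum>p\<in>X. \<Sum>q\<in>X. a (snd r) p q * (A p q - K p q) * c r)"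
      proof -
        have "(\<Sum>q\<in>X. \<Sum>r\<in>Q. h q r) = (\<Sum>r\<in>Q. \<Sum>q\<in>X. h q r)" for h :: "vec \<Rightarrow> _ \<Rightarrow> real"
          by (rule sum.swap)
        then show ?thesis by (simp only:)
      qed
      finally show ?thesis by (simp add: uA_def sum_distrib_right)
    qed
    have lbound: "\<bar>\<Sum>p\<in>X. \<Sum>q\<in>X. l p q * (A p q - K p q)\<bar> \<le> c1 * cov_dist X A K" for A
      by (rule sum_weighted_le_cov_dist[OF lb])
    have key: "\<bar>(\<integral>z. f z \<partial>gaussian_outputs m X A) - (\<integral>z. f z \<partial>gaussian_outputs m X K)
          - (\<Sum>p\<in>X. \<Sum>q\<in>X. l p q * (A p q - K p q))\<bar> \<le> (c2 + c4 * (8 * \<alpha>)) * (cov_dist X A K)\<^sup>2 \<and>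
        \<bar>(\<integral>z. f z \<partial>gaussian_outputs m X A) - (\<integral>z. f z \<partial>gaussian_outputs m X K)\<bar>
          \<le> (c1 + c3 + c4) * cov_dist X A K" if A: "cov_below X K A" for A
    proof -
      define d where "d = cov_dist X A K"
      have d0: "d \<ge> 0" by (simp add: d_def cov_dist_nonneg)
      define I where "I A = (\<integral>z. f z \<partial>gaussian_outputs m X A)" for A
      define S where "S = (\<Sum>p\<in>X. \<Sum>q\<in>X. l p q * (A p q - K p q))"
      have Sb: "\<bar>S\<bar> \<le> c1 * d" unfolding S_def d_def by (rule lbound)
      have "\<bar>I A - I K - S\<bar> \<le> (c2 + c4 * (8 * \<alpha>)) * d\<^sup>2 \<and> \<bar>I A - I K\<bar> \<le> (c1 + c3 + c4) * d"
      proof (cases "\<forall>j\<in>J. \<bar>uA A j\<bar> \<le> 1/8")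
        case True
        define s where "s = (\<Sum>q\<in>Q. \<bar>uA A (snd q)\<bar>)"
        have s0: "s \<ge> 0" by (simp add: s_def sum_nonneg)
        have uQ: "\<bar>uA A (snd q)\<bar> \<le> 1/8" if "q \<in> Q" for q using True that by (auto simp: Q_def)
        have s1: "s \<le> real m * \<alpha> * d"
          unfolding s_def Q_def sum.cartesian_product' d_def using uA_sum[of A] by (simp add: mult.assoc mult_left_mono)
        \<comment> \<open>Bounding only one factor of \<open>s\<^sup>2\<close> by a constant gives
          the Lipschitz estimate from the quadratic one.\<close>
        have s2: "s \<le> real (card Q)"
        proof -
          have "s \<le> (\<Sum>q\<in>Q. 1)" unfolding s_def by (intro sum_mono) (use uQ in force)
          then show ?thesis by simp
        qed
        have IA: "I A = (\<integral>x. g x \<partial>normal_prod Q (\<lambda>q. sqrt (1 + uA A (snd q))))"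
        proof -
          have "F \<in> normal_prod Q (\<lambda>q. sqrt (1 + uA A (snd q))) \<rightarrow>\<^sub>M output_space m X"
            using Fm by (simp cong: measurable_cong_sets)
          from integral_distr[OF this f] show ?thesis
            unfolding I_def g_def using law[OF A] True by simp
        qed
        have IK: "I K = (\<integral>x. g x \<partial>normal_prod Q (\<lambda>q. 1))"
          unfolding I_def g_def lawK[symmetric] by (rule integral_distr) (use Fm f in auto)
        have e: "\<bar>I A - I K - S\<bar> \<le> C * B * s\<^sup>2"
          unfolding IA IK S_def lsum s_def c_def by (rule expan[OF gm gb uQ])
        have "s\<^sup>2 \<le> (real m * \<alpha> * d)\<^sup>2" using s0 s1 by (intro power_mono) auto
        then have "C * B * s\<^sup>2 \<le> C * B * (real m * \<alpha> * d)\<^sup>2" using C B0 by (intro mult_left_mono) auto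
        also have "\<dots> = c2 * d\<^sup>2" by (simp add: c2_def power_mult_distrib)
        also have "\<dots> \<le> (c2 + c4 * (8 * \<alpha>)) * d\<^sup>2" using nn by (intro mult_right_mono) auto
        finally have 1: "\<bar>I A - I K - S\<bar> \<le> (c2 + c4 * (8 * \<alpha>)) * d\<^sup>2" using e by linarith
        have "s\<^sup>2 \<le> real (card Q) * (real m * \<alpha> * d)"
          unfolding power2_eq_square using s0 s1 s2 by (intro mult_mono) auto
        then have "C * B * s\<^sup>2 \<le> C * B * (real (card Q) * (real m * \<alpha> * d))" using C B0 by (intro mult_left_mono) auto
        also have "\<dots> = c3 * d" by (simp add: c3_def)
        finally have "\<bar>I A - I K\<bar> \<le> c1 * d + c3 * d" using e Sb by linarith
        also have "\<dots> \<le> (c1 + c3 + c4) * d" using nn d0 by (simp add: algebra_simps)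
        finally show ?thesis using 1 by blast
      next
        case False
        then obtain j where j: "j \<in> J" "1/8 < \<bar>uA A j\<bar>" by force
        have "\<bar>uA A j\<bar> \<le> (\<Sum>j\<in>J. \<bar>uA A j\<bar>)" using j J by (intro member_le_sum) auto
        \<comment> \<open>The lower bound on \<open>d\<close> may be inserted as a factor at will:
          once to absorb constants into a multiple of \<open>d\<close>, and once more to pass from
          \<open>d\<close> to \<open>d\<^sup>2\<close>.\<close>
        then have big: "1 \<le> 8 * \<alpha> * d" using j uA_sum[of A] by (simp add: d_def)
        have psdA: "psd_on X A" using A by (simp add: cov_below_def)
        have "\<bar>I A\<bar> \<le> 1 + real m * (\<Sum>p\<in>X. A p p)"
          unfolding I_def by (rule integral_quadratic_bound(2)[OF fin psdA f fb])
        also have "\<dots> \<le> 1 + real m * (tr + d)"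
          using trace_le_cov_dist[OF fin, of A K] unfolding tr_def d_def
          by (intro add_left_mono mult_left_mono) auto
        finally have a1: "\<bar>I A\<bar> \<le> 1 + real m * tr + real m * d" by (simp add: algebra_simps)
        have a2: "\<bar>I K\<bar> \<le> 1 + real m * tr"
          unfolding I_def tr_def by (rule integral_quadratic_bound(2)[OF fin psd f fb])
        have "(2 + 2 * real m * tr) * 1 \<le> (2 + 2 * real m * tr) * (8 * \<alpha> * d)"
          using big tr0 by (intro mult_left_mono) auto
        then have a3: "2 + 2 * real m * tr \<le> (2 + 2 * real m * tr) * (8 * \<alpha>) * d" by (simp only: mult_1_right mult.assoc)
        have c4d: "c4 * d = (2 + 2 * real m * tr) * (8 * \<alpha>) * d + real m * d + c1 * d"
          by (simp add: c4_def distrib_right)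
        have a12: "\<bar>I A\<bar> + \<bar>I K\<bar> \<le> (2 + 2 * real m * tr) * (8 * \<alpha>) * d + real m * d"
          using a1 a2 a3 by linarith
        have 1: "\<bar>I A - I K - S\<bar> \<le> c4 * d" using a12 Sb c4d by linarith
        have "c1 * d \<ge> 0" using nn d0 by simp
        then have 2: "\<bar>I A - I K\<bar> \<le> c4 * d" using a12 c4d by linarith
        have "c4 * d \<le> (c4 * d) * (8 * \<alpha> * d)"
          using mult_left_mono[OF big, of "c4 * d"] nn d0 by simp
        also have "\<dots> = c4 * (8 * \<alpha>) * d\<^sup>2" by (simp add: power2_eq_square)
        also have "\<dots> \<le> (c2 + c4 * (8 * \<alpha>)) * d\<^sup>2" using nn by (intro mult_right_mono) auto
        finally have 3: "\<bar>I A - I K - S\<bar> \<le> (c2 + c4 * (8 * \<alpha>)) * d\<^sup>2" using 1 by linarith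
        have "c4 * d \<le> (c1 + c3 + c4) * d" using nn d0 by (intro mult_right_mono) auto
        then show ?thesis using 2 3 by linarith
      qed
      then show ?thesis by (simp only: I_def S_def d_def)
    qed
    have mono: "(c2 + c4 * (8 * \<alpha>)) * (cov_dist X A K)\<^sup>2 \<le> CC * (cov_dist X A K)\<^sup>2"
      "(c1 + c3 + c4) * cov_dist X A K \<le> CC * cov_dist X A K" "c1 \<le> CC" for A
      using nn cov_dist_nonneg[of X A K] unfolding CC_def by (auto intro!: mult_right_mono)
    show ?thesis unfolding first_order_at_def
    proof (intro exI[of _ l] conjI ballI allI impI)
      show "\<bar>l p q\<bar> \<le> CC" if "p \<in> X" "q \<in> X" for p q
        using order_trans[OF lb[OF that] mono(3)] .
      fix A assume A: "cov_below X K A"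
      show "\<bar>(\<integral>z. f z \<partial>gaussian_outputs m X A) - (\<integral>z. f z \<partial>gaussian_outputs m X K)
          - (\<Sum>p\<in>X. \<Sum>q\<in>X. l p q * (A p q - K p q))\<bar> \<le> CC * (cov_dist X A K)\<^sup>2"
        using order_trans[OF conjunct1[OF key[OF A]] mono(1)] .
      show "\<bar>(\<integral>z. f z \<partial>gaussian_outputs m X A) - (\<integral>z. f z \<partial>gaussian_outputs m X K)\<bar>
          \<le> CC * cov_dist X A K"
        using order_trans[OF conjunct2[OF key[OF A]] mono(2)] .
    qed
  qed
  have "CC \<ge> 0" using nn by (simp add: CC_def)
  from that[OF this main] show ?thesis .
qed

section \<open>Wasserstein distance of posteriors\<close>

text \<open>The even mixture of the two laws dominates both; being a probability measure, it admits
  Radon-Nikodym densities for them.\<close>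

lemma prob_space_dominating:
  assumes "prob_space \<mu>" "prob_space \<nu>" "sets \<mu> = sets S" "sets \<nu> = sets S"
  obtains \<rho> where "prob_space \<rho>" "sets \<rho> = sets S" "absolutely_continuous \<rho> \<mu>" "absolutely_continuous \<rho> \<nu>"
proof -
  interpret m: prob_space \<mu> by fact
  interpret n: prob_space \<nu> by fact
  have sp: "space \<mu> = space S" "space \<nu> = space S"
    using assms(3,4) by (auto dest: sets_eq_imp_space_eq)
  let ?B = "measure_pmf (bernoulli_pmf (1/2))"
  define \<rho> where "\<rho> = ?B \<bind> (\<lambda>b. if b then \<mu> else \<nu>)"
  have k: "(\<lambda>b. if b then \<mu> else \<nu>) \<in> ?B \<rightarrow>\<^sub>M subprob_algebra S"
    using assms by (auto simp: space_subprob_algebra prob_space_imp_subprob_space)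
  have em: "emeasure \<rho> A = ennreal (1/2) * emeasure \<mu> A + ennreal (1/2) * emeasure \<nu> A" if "A \<in> sets S" for A
    unfolding \<rho>_def using that by (subst emeasure_bind[OF _ k]) (auto simp: mult.commute)
  have sets: "sets \<rho> = sets S"
    unfolding \<rho>_def by (rule sets_bind) (auto simp: assms)
  have "emeasure \<rho> (space S) = ennreal (1/2) + ennreal (1/2)"
    using m.emeasure_space_1 n.emeasure_space_1 by (subst em) (auto simp: sp)
  also have "\<dots> = 1" by (subst ennreal_plus[symmetric]) auto
  finally have "prob_space \<rho>"
    by (intro prob_spaceI) (simp add: sets_eq_imp_space_eq[OF sets])
  moreover have "absolutely_continuous \<rho> \<mu>" "absolutely_continuous \<rho> \<nu>"
    unfolding absolutely_continuous_def using sets assms by (auto simp: null_sets_def em)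
  ultimately show ?thesis using that sets by blast
qed

text \<open>
  The coupling keeps the common part \<open>min f g\<close> of the two densities on the diagonal and makes the
  two remainders independent, so that only the remainders are charged, with weight \<open>w\<close>.
\<close>

lemma wasserstein1_le_weighted_total_variation:
  fixes d :: "'a \<Rightarrow> 'a \<Rightarrow> real" and w :: "'a \<Rightarrow> real"
  assumes \<mu>: "prob_space \<mu>" "sets \<mu> = sets S" and \<nu>: "prob_space \<nu>" "sets \<nu> = sets S"
    and w: "w \<in> borel_measurable S" "\<And>x. 0 \<le> w x"
 and dm: "(\<lambda>z. d (fst z) (snd z)) \<in> borel_measurable (S \<Otimes>\<^sub>M S)"
    and d: "\<And>x. d x x = 0" "\<And>x y. d x y \<le> w x + w y"
    and fin: "(\<integral>\<^sup>+x. ennreal (w x) \<partial>\<mu>) < \<infinity>" "(\<integral>\<^sup>+x. ennreal (w x) \<partial>\<nu>) < \<infinity>"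
    and test: "\<And>\<phi>. \<phi> \<in> borel_measurable S \<Longrightarrow> (\<And>x. 0 \<le> \<phi> x \<and> \<phi> x \<le> w x) \<Longrightarrow>
      (\<integral>\<^sup>+x. ennreal (\<phi> x) \<partial>\<mu>) \<le> (\<integral>\<^sup>+x. ennreal (\<phi> x) \<partial>\<nu>) + ennreal e \<and>
      (\<integral>\<^sup>+x. ennreal (\<phi> x) \<partial>\<nu>) \<le> (\<integral>\<^sup>+x. ennreal (\<phi> x) \<partial>\<mu>) + ennreal e"
  shows "wasserstein1 d \<mu> \<nu> \<le> ennreal e + ennreal e"
proof -
  interpret m: prob_space \<mu> by fact
  interpret n: prob_space \<nu> by fact
  obtain \<rho> where \<rho>: "prob_space \<rho>" and s\<rho>: "sets \<rho> = sets S"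
    and ac: "absolutely_continuous \<rho> \<mu>" "absolutely_continuous \<rho> \<nu>"
    using prob_space_dominating[OF \<mu>(1) \<nu>(1) \<mu>(2) \<nu>(2)] .
  interpret prob_space \<rho> by fact
  define f where "f = RN_deriv \<rho> \<mu>"
  define g where "g = RN_deriv \<rho> \<nu>"
  have fd: "\<mu> = density \<rho> f" and gd: "\<nu> = density \<rho> g"
    unfolding f_def g_def using ac \<mu>(2) \<nu>(2) s\<rho> by (simp_all add: density_RN_deriv)
  have [measurable]: "f \<in> borel_measurable \<rho>" "g \<in> borel_measurable \<rho>"
    by (simp_all add: f_def g_def)
  have [measurable]: "w \<in> borel_measurable \<rho>" using w(1) s\<rho> by (simp cong: measurable_cong_sets)
  have [measurable]: "(\<lambda>z. d (fst z) (snd z)) \<in> borel_measurable (\<rho> \<Otimes>\<^sub>M \<rho>)"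
    using dm by (simp cong: measurable_cong_sets sets_pair_measure_cong add: measurable_cong_sets[OF sets_pair_measure_cong[OF s\<rho> s\<rho>] refl])
  have int_f: "(\<integral>\<^sup>+x. f x \<partial>\<rho>) = 1"
    using m.emeasure_space_1 unfolding fd by (simp add: emeasure_density cong: nn_integral_cong)
  have int_g: "(\<integral>\<^sup>+x. g x \<partial>\<rho>) = 1"
    using n.emeasure_space_1 unfolding gd by (simp add: emeasure_density cong: nn_integral_cong)
  define h where "h x = min (f x) (g x)" for x
  \<comment> \<open>The case distinction matters where both densities are infinite:
    \<open>\<top> - x\<close> is \<open>\<top>\<close> for all \<open>x\<close>, whereas the
    remainder has to be \<open>0\<close> there.\<close>
  define f' where "f' x = (if g x < f x then f x - g x else 0)" for x
  define g' where "g' x = (if f x < g x then g x - f x else 0)" for x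
  have [measurable]: "h \<in> borel_measurable \<rho>" "f' \<in> borel_measurable \<rho>" "g' \<in> borel_measurable \<rho>"
    unfolding h_def f'_def g'_def by measurable
  have hf: "h x + f' x = f x" and hg: "h x + g' x = g x" for x
    unfolding f'_def g'_def h_def by (auto simp: add_diff_inverse_ennreal min_def)
  define c where "c = (\<integral>\<^sup>+x. f' x \<partial>\<rho>)"
  define i where "i = (\<integral>\<^sup>+x. h x \<partial>\<rho>)"
  have i1: "i + c = 1"
    unfolding i_def c_def by (subst nn_integral_add[symmetric]) (auto simp: hf int_f)
  have i2: "i + (\<integral>\<^sup>+x. g' x \<partial>\<rho>) = 1"
    unfolding i_def by (subst nn_integral_add[symmetric]) (auto simp: hg int_g)
  have itop: "i \<noteq> \<top>" and ctop: "c \<noteq> \<top>" using i1 by (auto simp: ennreal_add_eq_top)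
  have c': "(\<integral>\<^sup>+x. g' x \<partial>\<rho>) = c"
    using i1 i2 itop ennreal_add_left_cancel[of i "\<integral>\<^sup>+x. g' x \<partial>\<rho>" c] by simp
  \<comment> \<open>Covers \<open>c = 0\<close> as well: then both remainders vanish almost
    everywhere and the two sides are \<open>0\<close>.\<close>
  have frac: "(\<integral>\<^sup>+x. u x * f' x \<partial>\<rho>) * c / c = (\<integral>\<^sup>+x. u x * f' x \<partial>\<rho>)"
    and frac': "(\<integral>\<^sup>+x. u x * g' x \<partial>\<rho>) * c / c = (\<integral>\<^sup>+x. u x * g' x \<partial>\<rho>)"
    if [measurable]: "u \<in> borel_measurable \<rho>" for u
  proof -
    have z: "(\<integral>\<^sup>+x. u x * v x \<partial>\<rho>) = 0" if "(\<integral>\<^sup>+x. v x \<partial>\<rho>) = 0" "v \<in> borel_measurable \<rho>" for v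
    proof -
      have [measurable]: "v \<in> borel_measurable \<rho>" by fact
      have "AE x in \<rho>. v x = 0" using that by (simp add: nn_integral_0_iff_AE)
      then show ?thesis by (subst nn_integral_0_iff_AE) auto
    qed
    show "(\<integral>\<^sup>+x. u x * f' x \<partial>\<rho>) * c / c = (\<integral>\<^sup>+x. u x * f' x \<partial>\<rho>)"
      using z[of f'] ctop by (cases "c = 0") (auto simp: c_def ennreal_mult_divide_eq)
    show "(\<integral>\<^sup>+x. u x * g' x \<partial>\<rho>) * c / c = (\<integral>\<^sup>+x. u x * g' x \<partial>\<rho>)"
      using z[of g'] ctop c' by (cases "c = 0") (auto simp: ennreal_mult_divide_eq)
  qed
  let ?B = "count_space (UNIV :: bool set) \<Otimes>\<^sub>M (\<rho> \<Otimes>\<^sub>M \<rho>)"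
  \<comment> \<open>The flag chooses the part of the coupling: \<open>True\<close> puts weight
    \<open>h\<close> on the diagonal point \<open>(x, x)\<close>, \<open>False\<close> takes the
    product of the remainders, each of mass \<open>c\<close>, divided once by
    \<open>c\<close>.\<close>
  define W where "W = (\<lambda>(b, x, y). if b then h x else f' x * g' y / c)"
  define H where "H = (\<lambda>(b, x, y). (x, if b then x else y) :: 'a \<times> 'a)"
  interpret P: pair_sigma_finite "count_space (UNIV :: bool set)" "\<rho> \<Otimes>\<^sub>M \<rho>"
    by (intro pair_sigma_finite.intro sigma_finite_measure_count_space_finite sigma_finite_pair_measure)
      (auto intro: sigma_finite_measure_axioms)
  interpret R: pair_sigma_finite \<rho> \<rho> ..
  have [measurable]: "W \<in> borel_measurable ?B"
    unfolding W_def by measurable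
  have [measurable]: "H \<in> ?B \<rightarrow>\<^sub>M \<rho> \<Otimes>\<^sub>M \<rho>"
    unfolding H_def by measurable
  define \<gamma> where "\<gamma> = distr (density ?B W) (\<rho> \<Otimes>\<^sub>M \<rho>) H"
  have int_\<gamma>: "(\<integral>\<^sup>+z. F z \<partial>\<gamma>) = (\<integral>\<^sup>+x. h x * F (x, x) \<partial>\<rho>) + (\<integral>\<^sup>+x. \<integral>\<^sup>+y. f' x * g' y / c * F (x, y) \<partial>\<rho> \<partial>\<rho>)"
    if [measurable]: "F \<in> borel_measurable (\<rho> \<Otimes>\<^sub>M \<rho>)" for F
  proof -
    have "(\<integral>\<^sup>+z. F z \<partial>\<gamma>) = (\<integral>\<^sup>+z. W z * F (H z) \<partial>?B)"
      unfolding \<gamma>_def by (simp add: nn_integral_distr nn_integral_density)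
    also have "\<dots> = (\<integral>\<^sup>+b. \<integral>\<^sup>+z. W (b, z) * F (H (b, z)) \<partial>(\<rho> \<Otimes>\<^sub>M \<rho>) \<partial>count_space UNIV)"
      by (rule P.M2.nn_integral_fst[symmetric]) simp
    also have "\<dots> = (\<integral>\<^sup>+z. W (True, z) * F (H (True, z)) \<partial>(\<rho> \<Otimes>\<^sub>M \<rho>)) + (\<integral>\<^sup>+z. W (False, z) * F (H (False, z)) \<partial>(\<rho> \<Otimes>\<^sub>M \<rho>))"
      by (simp add: nn_integral_count_space_finite UNIV_bool add.commute)
    also have "(\<integral>\<^sup>+z. W (True, z) * F (H (True, z)) \<partial>(\<rho> \<Otimes>\<^sub>M \<rho>)) = (\<integral>\<^sup>+x. h x * F (x, x) \<partial>\<rho>)"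
      by (subst nn_integral_fst[symmetric]) (auto simp: W_def H_def emeasure_space_1)
    also have "(\<integral>\<^sup>+z. W (False, z) * F (H (False, z)) \<partial>(\<rho> \<Otimes>\<^sub>M \<rho>)) = (\<integral>\<^sup>+x. \<integral>\<^sup>+y. f' x * g' y / c * F (x, y) \<partial>\<rho> \<partial>\<rho>)"
      by (subst nn_integral_fst[symmetric]) (auto simp: W_def H_def)
    finally show ?thesis .
  qed
  have int1: "(\<integral>\<^sup>+x. \<integral>\<^sup>+y. f' x * g' y / c * u x \<partial>\<rho> \<partial>\<rho>) = (\<integral>\<^sup>+x. u x * f' x \<partial>\<rho>)"
    if [measurable]: "u \<in> borel_measurable \<rho>" for u
  proof -
    have "(\<integral>\<^sup>+x. \<integral>\<^sup>+y. f' x * g' y / c * u x \<partial>\<rho> \<partial>\<rho>) = (\<integral>\<^sup>+x. \<integral>\<^sup>+y. (u x * f' x / c) * g' y \<partial>\<rho> \<partial>\<rho>)"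
      by (simp add: divide_ennreal_def mult_ac)
    also have "\<dots> = (\<integral>\<^sup>+x. (u x * f' x / c) * c \<partial>\<rho>)" by (simp add: nn_integral_cmult c')
    also have "\<dots> = (\<integral>\<^sup>+x. (u x * f' x) * (inverse c * c) \<partial>\<rho>)"
      by (simp add: divide_ennreal_def mult_ac)
    also have "\<dots> = (\<integral>\<^sup>+x. u x * f' x \<partial>\<rho>) * (inverse c * c)" by (rule nn_integral_multc) measurable
    also have "\<dots> = (\<integral>\<^sup>+x. u x * f' x \<partial>\<rho>) * c / c" by (simp add: divide_ennreal_def mult_ac)
    finally show ?thesis by (simp add: frac)
  qed
  have int2: "(\<integral>\<^sup>+x. \<integral>\<^sup>+y. f' x * g' y / c * u y \<partial>\<rho> \<partial>\<rho>) = (\<integral>\<^sup>+x. u x * g' x \<partial>\<rho>)"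
    if [measurable]: "u \<in> borel_measurable \<rho>" for u
  proof -
    have "(\<integral>\<^sup>+x. \<integral>\<^sup>+y. f' x * g' y / c * u y \<partial>\<rho> \<partial>\<rho>) = (\<integral>\<^sup>+x. \<integral>\<^sup>+y. (f' x / c) * (u y * g' y) \<partial>\<rho> \<partial>\<rho>)"
      by (simp add: divide_ennreal_def mult_ac)
    also have "\<dots> = (\<integral>\<^sup>+x. (f' x / c) * (\<integral>\<^sup>+y. u y * g' y \<partial>\<rho>) \<partial>\<rho>)" by (simp add: nn_integral_cmult)
    also have "\<dots> = (\<integral>\<^sup>+x. u x * g' x \<partial>\<rho>) * c / c"
      unfolding divide_ennreal_def c_def by (simp add: nn_integral_multc mult_ac)
    finally show ?thesis by (simp add: frac')
  qed
  have [measurable_cong]: "sets \<mu> = sets \<rho>" "sets \<nu> = sets \<rho>" using \<mu>(2) \<nu>(2) s\<rho> by auto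
  have s\<gamma>: "sets \<gamma> = sets (\<mu> \<Otimes>\<^sub>M \<nu>)"
    unfolding \<gamma>_def by (simp, rule sets_pair_measure_cong) (auto simp: \<mu>(2) \<nu>(2) s\<rho>)
  have "distr \<gamma> \<mu> fst = \<mu>"
  proof (rule measure_eqI)
    fix A assume "A \<in> sets (distr \<gamma> \<mu> fst)"
    then have A[measurable]: "A \<in> sets \<rho>" and A': "A \<in> sets \<mu>" using \<mu>(2) s\<rho> by auto
    have fm: "fst \<in> \<gamma> \<rightarrow>\<^sub>M \<mu>" using s\<gamma> by (simp cong: measurable_cong_sets)
    have "emeasure (distr \<gamma> \<mu> fst) A = (\<integral>\<^sup>+z. indicator A (fst z) \<partial>\<gamma>)"
      using nn_integral_distr[OF fm, of "indicator A"] A' by simp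
    also have "\<dots> = (\<integral>\<^sup>+x. h x * indicator A x \<partial>\<rho>) + (\<integral>\<^sup>+x. indicator A x * f' x \<partial>\<rho>)"
      by (subst int_\<gamma>) (auto simp: int1)
    also have "\<dots> = (\<integral>\<^sup>+x. f x * indicator A x \<partial>\<rho>)"
      by (subst nn_integral_add[symmetric]) (auto simp: hf[symmetric] indicator_def intro!: nn_integral_cong)
    also have "\<dots> = emeasure \<mu> A" unfolding fd by (simp add: emeasure_density)
    finally show "emeasure (distr \<gamma> \<mu> fst) A = emeasure \<mu> A" .
  qed simp
  moreover have "distr \<gamma> \<nu> snd = \<nu>"
  proof (rule measure_eqI)
    fix A assume "A \<in> sets (distr \<gamma> \<nu> snd)"
    then have A[measurable]: "A \<in> sets \<rho>" and A': "A \<in> sets \<nu>" using \<nu>(2) s\<rho> by auto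
    have fm: "snd \<in> \<gamma> \<rightarrow>\<^sub>M \<nu>" using s\<gamma> by (simp cong: measurable_cong_sets)
    have "emeasure (distr \<gamma> \<nu> snd) A = (\<integral>\<^sup>+z. indicator A (snd z) \<partial>\<gamma>)"
      using nn_integral_distr[OF fm, of "indicator A"] A' by simp
    also have "\<dots> = (\<integral>\<^sup>+x. h x * indicator A x \<partial>\<rho>) + (\<integral>\<^sup>+x. indicator A x * g' x \<partial>\<rho>)"
      by (subst int_\<gamma>) (auto simp: int2)
    also have "\<dots> = (\<integral>\<^sup>+x. g x * indicator A x \<partial>\<rho>)"
      by (subst nn_integral_add[symmetric]) (auto simp: hg[symmetric] indicator_def intro!: nn_integral_cong)
    also have "\<dots> = emeasure \<nu> A" unfolding gd by (simp add: emeasure_density)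
    finally show "emeasure (distr \<gamma> \<nu> snd) A = emeasure \<nu> A" .
  qed simp
  ultimately have "\<gamma> \<in> couplings \<mu> \<nu>" using s\<gamma> by (simp add: couplings_def)
  then have "wasserstein1 d \<mu> \<nu> \<le> (\<integral>\<^sup>+z. ennreal (d (fst z) (snd z)) \<partial>\<gamma>)"
    unfolding wasserstein1_def by (rule INF_lower)
  also have "\<dots> = (\<integral>\<^sup>+x. \<integral>\<^sup>+y. f' x * g' y / c * ennreal (d x y) \<partial>\<rho> \<partial>\<rho>)"
    by (subst int_\<gamma>) (auto simp: d(1))
  also have "\<dots> \<le> (\<integral>\<^sup>+x. \<integral>\<^sup>+y. f' x * g' y / c * ennreal (w x) + f' x * g' y / c * ennreal (w y) \<partial>\<rho> \<partial>\<rho>)"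
    unfolding distrib_left[symmetric]
    using d(2) w(2) by (intro nn_integral_mono mult_left_mono) (auto simp: ennreal_leI simp flip: ennreal_plus)
  also have "\<dots> = (\<integral>\<^sup>+x. ennreal (w x) * f' x \<partial>\<rho>) + (\<integral>\<^sup>+x. ennreal (w x) * g' x \<partial>\<rho>)"
    by (simp add: nn_integral_add flip: int1 int2)
  also have "\<dots> \<le> ennreal e + ennreal e"
  proof (rule add_mono)
    have split: "a * f x = ennreal (w x) * f' x + a * g x" if "a = (if g x < f x then ennreal (w x) else 0)" for a x
      using that by (auto simp: f'_def diff_add_cancel_ennreal less_imp_le simp flip: distrib_left)
    have split': "a * g x = ennreal (w x) * g' x + a * f x" if "a = (if f x < g x then ennreal (w x) else 0)" for a x
      using that by (auto simp: g'_def diff_add_cancel_ennreal less_imp_le simp flip: distrib_left)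
    \<comment> \<open>The weight cut off to the set where \<open>f\<close> exceeds \<open>g\<close>:
      the difference of its integrals under the two laws is exactly the integral of \<open>w\<close>
      against the remainder \<open>f'\<close>. The function \<open>q\<close> does the same for
      \<open>g'\<close>.\<close>
    define p where "p x = (if g x < f x then w x else 0)" for x
    define q where "q x = (if f x < g x then w x else 0)" for x
    have [measurable]: "p \<in> borel_measurable \<rho>" "q \<in> borel_measurable \<rho>" unfolding p_def q_def by measurable
    have pS: "p \<in> borel_measurable S" "q \<in> borel_measurable S"
      by (simp_all add: measurable_cong_sets[OF s\<rho>[symmetric] refl])
    have pw: "0 \<le> p x \<and> p x \<le> w x" "0 \<le> q x \<and> q x \<le> w x" for x using w(2) by (auto simp: p_def q_def)
    have "(\<integral>\<^sup>+x. ennreal (p x) \<partial>\<nu>) \<le> (\<integral>\<^sup>+x. ennreal (w x) \<partial>\<nu>)"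
      using pw by (intro nn_integral_mono ennreal_leI) auto
    then have pf: "(\<integral>\<^sup>+x. ennreal (p x) \<partial>\<nu>) \<noteq> \<top>" using fin(2) by (auto simp: top_unique)
    have "(\<integral>\<^sup>+x. ennreal (q x) \<partial>\<mu>) \<le> (\<integral>\<^sup>+x. ennreal (w x) \<partial>\<mu>)"
      using pw by (intro nn_integral_mono ennreal_leI) auto
    then have qf: "(\<integral>\<^sup>+x. ennreal (q x) \<partial>\<mu>) \<noteq> \<top>" using fin(1) by (auto simp: top_unique)
    have "(\<integral>\<^sup>+x. ennreal (p x) \<partial>\<mu>) = (\<integral>\<^sup>+x. ennreal (w x) * f' x + ennreal (p x) * g x \<partial>\<rho>)"
      unfolding fd by (subst nn_integral_density)
        (auto simp: mult.commute[of "f _"] intro!: nn_integral_cong split simp: p_def)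
    also have "\<dots> = (\<integral>\<^sup>+x. ennreal (w x) * f' x \<partial>\<rho>) + (\<integral>\<^sup>+x. ennreal (p x) \<partial>\<nu>)"
      unfolding gd by (simp add: nn_integral_add nn_integral_density mult.commute)
    finally have "(\<integral>\<^sup>+x. ennreal (p x) \<partial>\<nu>) + (\<integral>\<^sup>+x. ennreal (w x) * f' x \<partial>\<rho>) \<le> (\<integral>\<^sup>+x. ennreal (p x) \<partial>\<nu>) + ennreal e"
      using test[OF pS(1) pw(1)] by (simp add: add.commute)
    then show "(\<integral>\<^sup>+x. ennreal (w x) * f' x \<partial>\<rho>) \<le> ennreal e"
      using pf by (simp add: ennreal_add_left_cancel_le)
    have "(\<integral>\<^sup>+x. ennreal (q x) \<partial>\<nu>) = (\<integral>\<^sup>+x. ennreal (w x) * g' x + ennreal (q x) * f x \<partial>\<rho>)"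
      unfolding gd by (subst nn_integral_density)
        (auto simp: mult.commute[of "g _"] intro!: nn_integral_cong split' simp: q_def)
    also have "\<dots> = (\<integral>\<^sup>+x. ennreal (w x) * g' x \<partial>\<rho>) + (\<integral>\<^sup>+x. ennreal (q x) \<partial>\<mu>)"
      unfolding fd by (simp add: nn_integral_add nn_integral_density mult.commute)
    finally have "(\<integral>\<^sup>+x. ennreal (q x) \<partial>\<mu>) + (\<integral>\<^sup>+x. ennreal (w x) * g' x \<partial>\<rho>) \<le> (\<integral>\<^sup>+x. ennreal (q x) \<partial>\<mu>) + ennreal e"
      using test[OF pS(2) pw(2)] by (simp add: add.commute)
    then show "(\<integral>\<^sup>+x. ennreal (w x) * g' x \<partial>\<rho>) \<le> ennreal e"
      using qf by (simp add: ennreal_add_left_cancel_le)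
  qed
  finally show ?thesis .
qed

section \<open>From weighted total variation to posteriors\<close>

lemma sqrt_normsq: "sqrt (normsq m X z) = L2_set (\<lambda>(k, p). z k p) ({..<m} \<times> X)"
  by (simp add: normsq_def L2_set_def sum.cartesian_product' case_prod_beta)

lemma sqrt_normsq_le: "sqrt (normsq m X z) \<le> 1 + normsq m X z"
proof -
  have "normsq m X z \<le> (1 + normsq m X z)\<^sup>2"
    using normsq_nonneg[of m X z] by (simp add: power2_eq_square algebra_simps)
  then show ?thesis using normsq_nonneg[of m X z] by (intro real_le_lsqrt) auto
qed

lemma output_dist_le: "output_dist m X z z' \<le> sqrt (normsq m X z) + sqrt (normsq m X z')"
proof -
  have "output_dist m X z z' = L2_set (\<lambda>i. (\<lambda>(k, p). z k p) i + (\<lambda>(k, p). - z' k p) i) ({..<m} \<times> X)"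
    unfolding output_dist_def by (rule L2_set_cong) auto
  also have "\<dots> \<le> L2_set (\<lambda>(k, p). z k p) ({..<m} \<times> X) + L2_set (\<lambda>(k, p). - z' k p) ({..<m} \<times> X)"
    by (rule L2_set_triangle_ineq)
  also have "L2_set (\<lambda>(k, p). - z' k p) ({..<m} \<times> X) = L2_set (\<lambda>(k, p). z' k p) ({..<m} \<times> X)"
    by (simp add: L2_set_def case_prod_beta)
  finally show ?thesis by (simp only: sqrt_normsq)
qed

lemma output_dist_measurable:
  "(\<lambda>z. output_dist m X (fst z) (snd z)) \<in> borel_measurable (output_space m X \<Otimes>\<^sub>M output_space m X)"
  unfolding output_dist_def L2_set_def case_prod_beta
  by (intro measurable_compose[OF _ borel_measurable_sqrt] borel_measurable_sum borel_measurable_power borel_measurable_diff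
      measurable_compose[OF measurable_fst output_space_component]
      measurable_compose[OF measurable_snd output_space_component]) auto

text \<open>The likelihood lies between \<open>0\<close> and \<open>1\<close>, so multiplying a test
  function bounded by the norm with it gives an admissible test for the priors. Numerators and
  normalising constants of the posteriors thus differ by at most \<open>e\<close>, and a lower bound
  on the constants, valid for all priors with second moment at most \<open>b\<close>, controls the
  quotients.\<close>

lemma posterior_wasserstein1_bound:
  fixes y :: "'i \<Rightarrow> vec"
  assumes fin: "finite D" "finite X" and x: "x ` D \<subseteq> X" and b: "b \<ge> 0"
  obtains C where "C \<ge> 0"
    and "\<And>\<mu> \<nu> e. prob_space \<mu> \<Longrightarrow> sets \<mu> = sets (output_space m X) \<Longrightarrow>
      prob_space \<nu> \<Longrightarrow> sets \<nu> = sets (output_space m X) \<Longrightarrow>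
      integrable \<mu> (normsq m X) \<Longrightarrow> (\<integral>z. normsq m X z \<partial>\<mu>) \<le> b \<Longrightarrow>
      integrable \<nu> (normsq m X) \<Longrightarrow> (\<integral>z. normsq m X z \<partial>\<nu>) \<le> b \<Longrightarrow> e \<ge> 0 \<Longrightarrow>
      (\<And>f. f \<in> borel_measurable (output_space m X) \<Longrightarrow>
        (\<And>z. z \<in> space (output_space m X) \<Longrightarrow> \<bar>f z\<bar> \<le> 1 + normsq m X z) \<Longrightarrow>
        \<bar>(\<integral>z. f z \<partial>\<mu>) - (\<integral>z. f z \<partial>\<nu>)\<bar> \<le> e) \<Longrightarrow>
      wasserstein1 (output_dist m X) (posterior (gaussian_likelihood m D y) x \<mu>)
        (posterior (gaussian_likelihood m D y) x \<nu>) \<le> ennreal (C * e)"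
proof -
  let ?S = "output_space m X"
  define Lk where "Lk z = gaussian_likelihood m D y (\<lambda>i k. z k (x i))" for z
  define Y where "Y = (\<Sum>i\<in>D. \<Sum>k<m. (y i k)\<^sup>2)"
  define n where "n = real (card D)"
  define q where "q = 2 * n * b + 2 * Y"
  \<comment> \<open>Jensen's inequality made explicit: minus the log likelihood is at most
    \<open>2 * n * normsq m X z + 2 * Y\<close>, whose mean is at most \<open>q\<close>, so the
    normalising constant is at least \<open>exp (- q)\<close>.\<close>
  define z0 where "z0 = exp (- q)"
  define C where "C = 2 * (1 / z0 + (1 + b) / z0\<^sup>2)"
  have z0: "z0 > 0" by (simp add: z0_def)
  have C0: "C \<ge> 0" using b z0 by (simp add: C_def)
  have Lk_eq: "Lk z = exp (- (\<Sum>i\<in>D. \<Sum>k<m. (z k (x i) - y i k)\<^sup>2))" for z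
    by (simp add: Lk_def gaussian_likelihood_def L2_set_def sum_nonneg)
  have Lk_pos: "0 < Lk z" and Lk_le: "Lk z \<le> 1" for z
    by (simp_all add: Lk_eq sum_nonneg)
  have Lk_meas[measurable]: "Lk \<in> borel_measurable ?S"
    unfolding Lk_eq[abs_def]
    by (intro measurable_compose[OF _ borel_measurable_exp] borel_measurable_uminus borel_measurable_sum borel_measurable_power
        borel_measurable_diff output_space_component borel_measurable_const) (use x in auto)
  \<comment> \<open>The tangent of the exponential at \<open>- q\<close> bounds the likelihood from
    below by a function affine in \<open>normsq m X z\<close>, which can be integrated using the
    second moment only.\<close>
  have Lk_ge: "z0 * (1 + q - (2 * n * normsq m X z + 2 * Y)) \<le> Lk z" for z
  proof -
    have "(\<Sum>i\<in>D. \<Sum>k<m. (z k (x i) - y i k)\<^sup>2) \<le> (\<Sum>i\<in>D. 2 * normsq m X z + 2 * (\<Sum>k<m. (y i k)\<^sup>2))"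
    proof (rule sum_mono)
      fix i assume i: "i \<in> D"
      have sq: "(a - c)\<^sup>2 \<le> 2 * a\<^sup>2 + 2 * c\<^sup>2" for a c :: real
        using zero_le_power2[of "a + c"] by (simp add: power2_eq_square algebra_simps)
      have "(\<Sum>k<m. (z k (x i) - y i k)\<^sup>2) \<le> (\<Sum>k<m. 2 * (z k (x i))\<^sup>2 + 2 * (y i k)\<^sup>2)"
        by (intro sum_mono sq)
      also have "\<dots> = 2 * (\<Sum>k<m. (z k (x i))\<^sup>2) + 2 * (\<Sum>k<m. (y i k)\<^sup>2)"
        by (simp add: sum.distrib sum_distrib_left)
      also have "(\<Sum>k<m. (z k (x i))\<^sup>2) \<le> normsq m X z"
        unfolding normsq_def using x i fin(2)
        by (intro sum_mono member_le_sum[where f="\<lambda>p. (z _ p)\<^sup>2"]) auto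
      finally show "(\<Sum>k<m. (z k (x i) - y i k)\<^sup>2) \<le> 2 * normsq m X z + 2 * (\<Sum>k<m. (y i k)\<^sup>2)" by simp
    qed
    also have "\<dots> = 2 * n * normsq m X z + 2 * Y"
      by (simp add: Y_def n_def sum.distrib sum_distrib_left)
    finally have "exp (- (2 * n * normsq m X z + 2 * Y)) \<le> Lk z" by (simp add: Lk_eq)
    moreover have "z0 * (1 + (q - (2 * n * normsq m X z + 2 * Y))) \<le> z0 * exp (q - (2 * n * normsq m X z + 2 * Y))"
      using z0 exp_ge_add_one_self by (intro mult_left_mono) auto
    moreover have "z0 * exp (q - (2 * n * normsq m X z + 2 * Y)) = exp (- (2 * n * normsq m X z + 2 * Y))"
      by (simp add: z0_def flip: exp_add)
    ultimately show ?thesis by (simp add: add_diff_eq)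
  qed
  have main: "wasserstein1 (output_dist m X) (posterior (gaussian_likelihood m D y) x \<mu>)
        (posterior (gaussian_likelihood m D y) x \<nu>) \<le> ennreal (C * e)"
    if \<mu>: "prob_space \<mu>" "sets \<mu> = sets ?S" "integrable \<mu> (normsq m X)" "(\<integral>z. normsq m X z \<partial>\<mu>) \<le> b"
      and \<nu>: "prob_space \<nu>" "sets \<nu> = sets ?S" "integrable \<nu> (normsq m X)" "(\<integral>z. normsq m X z \<partial>\<nu>) \<le> b"
      and e: "e \<ge> 0"
      and test: "\<And>f. f \<in> borel_measurable ?S \<Longrightarrow>
        (\<And>z. z \<in> space ?S \<Longrightarrow> \<bar>f z\<bar> \<le> 1 + normsq m X z) \<Longrightarrow> \<bar>(\<integral>z. f z \<partial>\<mu>) - (\<integral>z. f z \<partial>\<nu>)\<bar> \<le> e"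
    for \<mu> \<nu> e
  proof -
    define Z where "Z \<mu> = (\<integral>z. Lk z \<partial>\<mu>)" for \<mu>
    have post: "posterior (gaussian_likelihood m D y) x \<mu> = density \<mu> (\<lambda>z. ennreal (Lk z / Z \<mu>))" for \<mu>
      by (simp add: posterior_def Lk_def Z_def)
    define P where "P \<mu> = density \<mu> (\<lambda>z. ennreal (Lk z / Z \<mu>))" for \<mu>
    have basics: "z0 \<le> Z \<mu> \<and> prob_space (P \<mu>) \<and> sets (P \<mu>) = sets ?S \<and>
       (\<forall>f. f \<in> borel_measurable ?S \<longrightarrow> (\<forall>z. 0 \<le> f z \<and> f z \<le> sqrt (normsq m X z)) \<longrightarrow>
         (\<integral>\<^sup>+z. ennreal (f z) \<partial>P \<mu>) = ennreal ((\<integral>z. f z * Lk z \<partial>\<mu>) / Z \<mu>) \<and>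
         0 \<le> (\<integral>z. f z * Lk z \<partial>\<mu>) \<and> (\<integral>z. f z * Lk z \<partial>\<mu>) \<le> 1 + b)"
      if \<mu>: "prob_space \<mu>" "sets \<mu> = sets ?S" "integrable \<mu> (normsq m X)" "(\<integral>z. normsq m X z \<partial>\<mu>) \<le> b" for \<mu>
    proof -
      interpret prob_space \<mu> by fact
      have [measurable_cong]: "sets \<mu> = sets ?S" by fact
      have iL: "integrable \<mu> Lk"
        by (rule integrable_const_bound[where B=1]) (auto simp: Lk_le less_imp_le[OF Lk_pos])
      have "z0 * 1 \<le> z0 * (1 + q - (2 * n * (\<integral>z. normsq m X z \<partial>\<mu>) + 2 * Y))"
        using z0 \<mu>(4) by (intro mult_left_mono) (auto simp: q_def n_def intro!: mult_left_mono)
      also have "\<dots> = (\<integral>z. z0 * (1 + q - (2 * n * normsq m X z + 2 * Y)) \<partial>\<mu>)"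
        using \<mu>(3) by (simp add: prob_space)
      also have "\<dots> \<le> Z \<mu>"
        unfolding Z_def using \<mu>(3) iL by (intro integral_mono Lk_ge) auto
      finally have Zge: "z0 \<le> Z \<mu>" by simp
      then have Zpos: "Z \<mu> > 0" using z0 by simp
      have "(\<integral>\<^sup>+z. ennreal (Lk z / Z \<mu>) \<partial>\<mu>) = ennreal (\<integral>z. Lk z / Z \<mu> \<partial>\<mu>)"
        using iL Zpos by (intro nn_integral_eq_integral) (auto simp: less_imp_le[OF Lk_pos])
      also have "\<dots> = 1" using Zpos by (simp add: Z_def)
      finally have pp: "prob_space (P \<mu>)"
        unfolding P_def by (intro prob_spaceI) (simp add: emeasure_density cong: nn_integral_cong)
      have "(\<integral>\<^sup>+z. ennreal (f z) \<partial>P \<mu>) = ennreal ((\<integral>z. f z * Lk z \<partial>\<mu>) / Z \<mu>) \<and>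
         0 \<le> (\<integral>z. f z * Lk z \<partial>\<mu>) \<and> (\<integral>z. f z * Lk z \<partial>\<mu>) \<le> 1 + b"
        if f[measurable]: "f \<in> borel_measurable ?S" and fb: "\<forall>z. 0 \<le> f z \<and> f z \<le> sqrt (normsq m X z)" for f
      proof -
        have fL: "0 \<le> f z * Lk z" "f z * Lk z \<le> 1 + normsq m X z" for z
        proof -
          show "0 \<le> f z * Lk z" using fb less_imp_le[OF Lk_pos] by simp
          have "f z * Lk z \<le> f z * 1" using fb Lk_le by (intro mult_left_mono) auto
          then show "f z * Lk z \<le> 1 + normsq m X z" using fb sqrt_normsq_le[of m X z] by (smt (verit))
        qed
        have i: "integrable \<mu> (\<lambda>z. f z * Lk z)"
          by (rule Bochner_Integration.integrable_bound[where f="\<lambda>z. 1 + normsq m X z"])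
            (use \<mu>(3) fL in \<open>auto intro!: AE_I2 intro: order_trans[OF _ abs_ge_self]\<close>)
        have "(\<integral>\<^sup>+z. ennreal (f z) \<partial>P \<mu>) = (\<integral>\<^sup>+z. ennreal (f z * Lk z / Z \<mu>) \<partial>\<mu>)"
          unfolding P_def using fb Zpos
          by (subst nn_integral_density) (auto simp: less_imp_le[OF Lk_pos] mult.commute intro!: nn_integral_cong simp flip: ennreal_mult)
        also have "\<dots> = ennreal (\<integral>z. f z * Lk z / Z \<mu> \<partial>\<mu>)"
          using i fL Zpos by (intro nn_integral_eq_integral) auto
        finally have 1: "(\<integral>\<^sup>+z. ennreal (f z) \<partial>P \<mu>) = ennreal ((\<integral>z. f z * Lk z \<partial>\<mu>) / Z \<mu>)" by simp
        have 2: "0 \<le> (\<integral>z. f z * Lk z \<partial>\<mu>)" using fL by (intro integral_nonneg_AE) auto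
        have "(\<integral>z. f z * Lk z \<partial>\<mu>) \<le> (\<integral>z. 1 + normsq m X z \<partial>\<mu>)"
          using i \<mu>(3) fL by (intro integral_mono) auto
        also have "\<dots> \<le> 1 + b" using \<mu>(3,4) by (simp add: prob_space)
        finally show ?thesis using 1 2 by blast
      qed
      then show ?thesis using Zge pp \<mu>(2) by (auto simp: P_def)
    qed
    note bm = basics[OF \<mu>] and bn = basics[OF \<nu>]
    have ZZ: "\<bar>Z \<mu> - Z \<nu>\<bar> \<le> e"
      unfolding Z_def
    proof (rule test[OF Lk_meas])
      show "\<bar>Lk z\<bar> \<le> 1 + normsq m X z" for z
        using Lk_le[of z] Lk_pos[of z] normsq_nonneg[of m X z] by linarith
    qed
    define e' where "e' = e / z0 + (1 + b) * e / z0\<^sup>2"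
    \<comment> \<open>Stated with free numerators and a free second constant so that it can be used
      again with the two laws exchanged.\<close>
    have quot: "a / Z \<mu> \<le> a' / Z' + e'"
      if "\<bar>a - a'\<bar> \<le> e" "\<bar>Z \<mu> - Z'\<bar> \<le> e" "z0 \<le> Z \<mu>" "z0 \<le> Z'" "0 \<le> a'" "a' \<le> 1 + b" for a a' Z' \<mu>
    proof -
      have Zp: "Z \<mu> > 0" "Z' > 0" using that z0 by auto
      have "a / Z \<mu> - a' / Z' = (a - a') / Z \<mu> + a' * (Z' - Z \<mu>) / (Z \<mu> * Z')"
        using Zp by (simp add: field_simps)
      also have "(a - a') / Z \<mu> \<le> e / z0" using that Zp z0 e by (intro frac_le) auto
      also have "a' * (Z' - Z \<mu>) / (Z \<mu> * Z') \<le> (1 + b) * e / z0\<^sup>2"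
      proof -
        have "a' * (Z' - Z \<mu>) \<le> a' * e" using that by (intro mult_left_mono) auto
        also have "\<dots> \<le> (1 + b) * e" using that e by (intro mult_right_mono) auto
        finally have "a' * (Z' - Z \<mu>) / (Z \<mu> * Z') \<le> (1 + b) * e / (Z \<mu> * Z')"
          using Zp by (intro divide_right_mono) auto
        also have "\<dots> \<le> (1 + b) * e / z0\<^sup>2"
          using that Zp z0 e b unfolding power2_eq_square by (intro frac_le mult_mono) auto
        finally show ?thesis .
      qed
      finally show ?thesis by (simp add: e'_def)
    qed
    have e'0: "e' \<ge> 0" using e b z0 by (simp add: e'_def)
    have "wasserstein1 (output_dist m X) (P \<mu>) (P \<nu>) \<le> ennreal e' + ennreal e'"
    proof (rule wasserstein1_le_weighted_total_variation[where S="?S" and w="\<lambda>z. sqrt (normsq m X z)"])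
      show "prob_space (P \<mu>)" "sets (P \<mu>) = sets ?S" "prob_space (P \<nu>)" "sets (P \<nu>) = sets ?S"
        using bm bn by auto
      show "(\<lambda>z. sqrt (normsq m X z)) \<in> borel_measurable ?S" by measurable
      show "0 \<le> sqrt (normsq m X z)" for z by (simp add: normsq_nonneg)
      show "(\<lambda>z. output_dist m X (fst z) (snd z)) \<in> borel_measurable (?S \<Otimes>\<^sub>M ?S)"
        by (rule output_dist_measurable)
      show "output_dist m X z z = 0" for z by (simp add: output_dist_def L2_set_def case_prod_beta)
      show "output_dist m X z z' \<le> sqrt (normsq m X z) + sqrt (normsq m X z')" for z z'
        by (rule output_dist_le)
      have "(\<lambda>z. sqrt (normsq m X z)) \<in> borel_measurable ?S" by measurable
      then show "(\<integral>\<^sup>+z. ennreal (sqrt (normsq m X z)) \<partial>P \<mu>) < \<infinity>" "(\<integral>\<^sup>+z. ennreal (sqrt (normsq m X z)) \<partial>P \<nu>) < \<infinity>"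
        using bm bn by (simp_all add: normsq_nonneg)
    next
      fix f assume f: "f \<in> borel_measurable ?S" and fb: "\<And>z. 0 \<le> f z \<and> f z \<le> sqrt (normsq m X z)"
      define a a' where "a = (\<integral>z. f z * Lk z \<partial>\<mu>)" and "a' = (\<integral>z. f z * Lk z \<partial>\<nu>)"
      have fm: "(\<integral>\<^sup>+z. ennreal (f z) \<partial>P \<mu>) = ennreal (a / Z \<mu>)" "0 \<le> a" "a \<le> 1 + b"
        using bm f fb by (auto simp: a_def)
      have fn: "(\<integral>\<^sup>+z. ennreal (f z) \<partial>P \<nu>) = ennreal (a' / Z \<nu>)" "0 \<le> a'" "a' \<le> 1 + b"
        using bn f fb by (auto simp: a'_def)
      have "\<bar>a - a'\<bar> \<le> e" unfolding a_def a'_def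
      proof (rule test)
        show "(\<lambda>z. f z * Lk z) \<in> borel_measurable ?S" using f by measurable
        show "\<bar>f z * Lk z\<bar> \<le> 1 + normsq m X z" for z
        proof -
          have "\<bar>f z * Lk z\<bar> = f z * Lk z" using fb less_imp_le[OF Lk_pos] by simp
          also have "\<dots> \<le> f z * 1" using fb Lk_le by (intro mult_left_mono) auto
          finally show ?thesis using fb[of z] sqrt_normsq_le[of m X z] by linarith
        qed
      qed
      then have "a / Z \<mu> \<le> a' / Z \<nu> + e'" "a' / Z \<nu> \<le> a / Z \<mu> + e'"
        using quot[of a a' \<mu> "Z \<nu>"] quot[of a' a \<nu> "Z \<mu>"] ZZ bm bn fm fn by (auto simp: abs_minus_commute)
      moreover have "0 \<le> a / Z \<mu>" "0 \<le> a' / Z \<nu>" using fm fn bm bn z0 by auto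
      ultimately show "(\<integral>\<^sup>+z. ennreal (f z) \<partial>P \<mu>) \<le> (\<integral>\<^sup>+z. ennreal (f z) \<partial>P \<nu>) + ennreal e' \<and>
        (\<integral>\<^sup>+z. ennreal (f z) \<partial>P \<nu>) \<le> (\<integral>\<^sup>+z. ennreal (f z) \<partial>P \<mu>) + ennreal e'"
        using e'0 by (simp add: fm(1) fn(1) ennreal_leI flip: ennreal_plus)
    qed
    also have "\<dots> = ennreal (C * e)"
      using e'0 by (simp add: C_def e'_def algebra_simps flip: ennreal_plus)
    finally show ?thesis by (simp add: post P_def)
  qed
  show ?thesis
  proof (rule that[OF C0], goal_cases)
    case (1 \<mu> \<nu> e)
    show ?case by (rule main[OF 1(1,2,5,6,3,4,7,8,9) 1(10)])
  qed
qed

section \<open>Covariances of the activations\<close>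

text \<open>Covariance of one row of an affine Gaussian layer with frozen input features: the
  \<open>1\<close> is the variance of the bias, the average comes from weights of variance
  \<open>1 / n\<close>. Coordinates as features give the first layer, activations the later
  ones.\<close>

definition feature_cov :: "nat \<Rightarrow> (nat \<Rightarrow> vec \<Rightarrow> real) \<Rightarrow> vec \<Rightarrow> vec \<Rightarrow> real" where
  "feature_cov n \<phi> p q = 1 + (\<Sum>j<n. \<phi> j p * \<phi> j q) / real n"

definition emp_cov :: "nat \<Rightarrow> (real \<Rightarrow> real) \<Rightarrow> outputs \<Rightarrow> vec \<Rightarrow> vec \<Rightarrow> real" where
  "emp_cov n \<sigma> z p q = 1 + (\<Sum>j<n. \<sigma> (z j p) * \<sigma> (z j q)) / real n"

text \<open>One step of the recursion for the limit covariances, as an operator that can be applied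
  to any covariance.\<close>

definition next_cov :: "(real \<Rightarrow> real) \<Rightarrow> vec set \<Rightarrow> (vec \<Rightarrow> vec \<Rightarrow> real) \<Rightarrow> vec \<Rightarrow> vec \<Rightarrow> real" where
  "next_cov \<sigma> X K p q = 1 + (\<integral>g. \<sigma> (g p) * \<sigma> (g q) \<partial>centered_gaussian X K)"

lemma quadratic_form_ones:
  fixes t :: "'a \<Rightarrow> real"
  shows "(\<Sum>p\<in>X. \<Sum>q\<in>X. t p * (1 + B p q) * t q) = (\<Sum>p\<in>X. t p)\<^sup>2 + (\<Sum>p\<in>X. \<Sum>q\<in>X. t p * B p q * t q)"
  unfolding power2_eq_square sum_product by (simp add: algebra_simps sum.distrib)

lemma psd_feature_cov: "psd_on X (feature_cov n \<phi>)"
proof -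
  have "(\<Sum>p\<in>X. \<Sum>q\<in>X. t p * ((\<Sum>j<n. \<phi> j p * \<phi> j q) / real n) * t q)
    = (\<Sum>j<n. (\<Sum>p\<in>X. t p * \<phi> j p)\<^sup>2) / real n" for t
  proof -
    have "(\<Sum>p\<in>X. \<Sum>q\<in>X. t p * ((\<Sum>j<n. \<phi> j p * \<phi> j q) / real n) * t q)
      = (\<Sum>p\<in>X. \<Sum>q\<in>X. \<Sum>j<n. (t p * \<phi> j p) * (t q * \<phi> j q)) / real n"
      by (simp add: sum_divide_distrib sum_distrib_left sum_distrib_right mult_ac)
    also have "(\<Sum>p\<in>X. \<Sum>q\<in>X. \<Sum>j<n. (t p * \<phi> j p) * (t q * \<phi> j q))
      = (\<Sum>p\<in>X. \<Sum>j<n. \<Sum>q\<in>X. (t p * \<phi> j p) * (t q * \<phi> j q))"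
      by (intro sum.cong refl sum.swap)
    also have "\<dots> = (\<Sum>j<n. \<Sum>p\<in>X. \<Sum>q\<in>X. (t p * \<phi> j p) * (t q * \<phi> j q))"
      by (rule sum.swap)
    also have "\<dots> = (\<Sum>j<n. (\<Sum>p\<in>X. t p * \<phi> j p)\<^sup>2)"
      by (simp only: power2_eq_square sum_product)
    finally show ?thesis .
  qed
  then show ?thesis
    unfolding psd_on_def feature_cov_def quadratic_form_ones
    by (auto simp: mult.commute sum_nonneg)
qed

lemma emp_cov_eq_feature_cov: "emp_cov n \<sigma> z = feature_cov n (\<lambda>j p. \<sigma> (z j p))"
  by (simp add: fun_eq_iff emp_cov_def feature_cov_def)

lemma psd_emp_cov: "psd_on X (emp_cov n \<sigma> z)"
  by (simp add: emp_cov_eq_feature_cov psd_feature_cov)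

section \<open>Lipschitz activations and the covariance recursion\<close>

locale lipschitz_activation =
  fixes \<sigma> :: "real \<Rightarrow> real" and Lip :: real
  assumes lip: "Lip-lipschitz_on UNIV \<sigma>"
begin

lemma Lip_nonneg: "0 \<le> Lip"
  using lip by (rule lipschitz_on_nonneg)

lemma activation_diff: "\<bar>\<sigma> x - \<sigma> y\<bar> \<le> Lip * \<bar>x - y\<bar>"
  using lipschitz_onD[OF lip, of x y] by (simp add: dist_real_def)

lemma activation_measurable [measurable]: "\<sigma> \<in> borel_measurable borel"
  using lipschitz_on_continuous_on[OF lip] by (rule borel_measurable_continuous_onI)

text \<open>A common constant for the quadratic growth of products of activations; the summand
  \<open>1\<close> makes it positive, so that dividing by a multiple of it turns such products into
  admissible test functions.\<close>

definition growth :: real where "growth = 2 * (\<sigma> 0)\<^sup>2 + Lip\<^sup>2 + 1"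

lemma growth_pos: "growth \<ge> 1"
  by (simp add: growth_def)

lemma activation_sq: "(\<sigma> x)\<^sup>2 \<le> 2 * (\<sigma> 0)\<^sup>2 + 2 * Lip\<^sup>2 * x\<^sup>2"
proof -
  have "\<bar>\<sigma> x\<bar> \<le> \<bar>\<sigma> 0\<bar> + Lip * \<bar>x\<bar>" using activation_diff[of x 0] by simp
  then have "(\<sigma> x)\<^sup>2 \<le> (\<bar>\<sigma> 0\<bar> + Lip * \<bar>x\<bar>)\<^sup>2"
    by (metis abs_ge_zero power2_abs power_mono)
  also have "\<dots> \<le> 2 * \<bar>\<sigma> 0\<bar>\<^sup>2 + 2 * (Lip * \<bar>x\<bar>)\<^sup>2"
    using zero_le_power2[of "\<bar>\<sigma> 0\<bar> - Lip * \<bar>x\<bar>"] by (simp add: power2_eq_square algebra_simps)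
  finally show ?thesis by (simp add: power_mult_distrib)
qed

lemma activation_prod: "\<bar>\<sigma> x * \<sigma> y\<bar> \<le> growth * (1 + x\<^sup>2 + y\<^sup>2)"
proof -
  have "2 * \<bar>\<sigma> x * \<sigma> y\<bar> \<le> (\<sigma> x)\<^sup>2 + (\<sigma> y)\<^sup>2"
    using sum_squares_bound[of "\<bar>\<sigma> x\<bar>" "\<bar>\<sigma> y\<bar>"] by (simp add: abs_mult)
  also have "\<dots> \<le> 2 * (2 * (\<sigma> 0)\<^sup>2 + Lip\<^sup>2 * (x\<^sup>2 + y\<^sup>2))"
    using activation_sq[of x] activation_sq[of y] by (simp add: algebra_simps)
  also have "\<dots> \<le> 2 * (growth * (1 + x\<^sup>2 + y\<^sup>2))"
  proof -
    have "0 \<le> (2 * (\<sigma> 0)\<^sup>2 + 1) * (x\<^sup>2 + y\<^sup>2) + Lip\<^sup>2 + 1" by simp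
    then show ?thesis by (simp add: growth_def algebra_simps)
  qed
  finally show ?thesis by simp
qed

lemma activation_prod_sq: "(\<sigma> x * \<sigma> y)\<^sup>2 \<le> 3 * growth\<^sup>2 * (1 + x ^ 4 + y ^ 4)"
proof -
  have "(\<sigma> x * \<sigma> y)\<^sup>2 \<le> (growth * (1 + x\<^sup>2 + y\<^sup>2))\<^sup>2"
    using activation_prod[of x y] by (metis abs_ge_zero power2_abs power_mono)
  also have "\<dots> = growth\<^sup>2 * (1 + x\<^sup>2 + y\<^sup>2)\<^sup>2" by (simp add: power_mult_distrib)
  also have "\<dots> \<le> growth\<^sup>2 * (3 * (1 + (x\<^sup>2)\<^sup>2 + (y\<^sup>2)\<^sup>2))"
  proof (rule mult_left_mono)
    have "(1 + a + b)\<^sup>2 \<le> 3 * (1 + a\<^sup>2 + b\<^sup>2)" for a b :: real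
      using zero_le_power2[of "a - b"] zero_le_power2[of "a - 1"] zero_le_power2[of "b - 1"]
      by (simp add: power2_eq_square algebra_simps)
    then show "(1 + x\<^sup>2 + y\<^sup>2)\<^sup>2 \<le> 3 * (1 + (x\<^sup>2)\<^sup>2 + (y\<^sup>2)\<^sup>2)" .
  qed simp
  also have "\<dots> = 3 * growth\<^sup>2 * (1 + x ^ 4 + y ^ 4)" by (simp flip: power_mult)
  finally show ?thesis .
qed

context
  fixes X :: "vec set"
  assumes fin: "finite X"
begin

lemma integrable_activation_prod:
  assumes A: "psd_on X A" and pq: "p \<in> X" "q \<in> X"
  shows "integrable (centered_gaussian X A) (\<lambda>g. \<sigma> (g p) * \<sigma> (g q))"
    and "integrable (centered_gaussian X A) (\<lambda>g. (\<sigma> (g p) * \<sigma> (g q))\<^sup>2)"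
    and "(\<integral>g. (\<sigma> (g p) * \<sigma> (g q))\<^sup>2 \<partial>centered_gaussian X A)
      \<le> 3 * growth\<^sup>2 * (1 + 3 * (A p p)\<^sup>2 + 3 * (A q q)\<^sup>2)"
proof -
  interpret prob_space "centered_gaussian X A" by (rule prob_space_centered_gaussian[OF fin A])
  note mom = is_centered_gaussian_moments[OF is_centered_gaussian_centered_gaussian[OF fin A] fin]
  note mp = mom[OF pq(1) psd_on_diag[OF A fin pq(1)]] and mq = mom[OF pq(2) psd_on_diag[OF A fin pq(2)]]
  note [measurable_cong] = sets_centered_gaussian[OF fin A]
  have [measurable]: "(\<lambda>g. g p) \<in> borel_measurable (centered_gaussian X A)"
    "(\<lambda>g. g q) \<in> borel_measurable (centered_gaussian X A)" using pq by measurable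
  show 1: "integrable (centered_gaussian X A) (\<lambda>g. \<sigma> (g p) * \<sigma> (g q))"
    by (rule Bochner_Integration.integrable_bound[where f="\<lambda>g. growth * (1 + (g p)\<^sup>2 + (g q)\<^sup>2)"])
      (use mp(1)[of 2] mq(1)[of 2] activation_prod in \<open>auto intro!: AE_I2 intro: order_trans[OF _ abs_ge_self]\<close>)
  have i4: "integrable (centered_gaussian X A) (\<lambda>g. 3 * growth\<^sup>2 * (1 + (g p) ^ 4 + (g q) ^ 4))"
    using mp(1)[of 4] mq(1)[of 4] by auto
  show 2: "integrable (centered_gaussian X A) (\<lambda>g. (\<sigma> (g p) * \<sigma> (g q))\<^sup>2)"
    by (rule Bochner_Integration.integrable_bound[OF i4])
      (use activation_prod_sq in \<open>auto intro!: AE_I2 intro: order_trans[OF _ abs_ge_self]\<close>)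
  have "(\<integral>g. (\<sigma> (g p) * \<sigma> (g q))\<^sup>2 \<partial>centered_gaussian X A)
      \<le> (\<integral>g. 3 * growth\<^sup>2 * (1 + (g p) ^ 4 + (g q) ^ 4) \<partial>centered_gaussian X A)"
    by (rule integral_mono[OF 2 i4]) (rule activation_prod_sq)
  also have "\<dots> = 3 * growth\<^sup>2 * (1 + 3 * (A p p)\<^sup>2 + 3 * (A q q)\<^sup>2)"
    using mp mq by (simp add: prob_space)
  finally show "(\<integral>g. (\<sigma> (g p) * \<sigma> (g q))\<^sup>2 \<partial>centered_gaussian X A)
      \<le> 3 * growth\<^sup>2 * (1 + 3 * (A p p)\<^sup>2 + 3 * (A q q)\<^sup>2)" .
qed

text \<open>Besides positivity, this form as a sum of two nonnegative terms shows what a null vector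
  \<open>t\<close> means: its entries sum to \<open>0\<close>, and the combination of activations
  with coefficients \<open>t\<close> vanishes almost surely.\<close>

lemma quadratic_form_next_cov:
  assumes A: "psd_on X A"
  shows "(\<Sum>p\<in>X. \<Sum>q\<in>X. t p * next_cov \<sigma> X A p q * t q)
    = (\<Sum>p\<in>X. t p)\<^sup>2 + (\<integral>g. (\<Sum>p\<in>X. t p * \<sigma> (g p))\<^sup>2 \<partial>centered_gaussian X A)"
    and "integrable (centered_gaussian X A) (\<lambda>g. (\<Sum>p\<in>X. t p * \<sigma> (g p))\<^sup>2)"
proof -
  have eq: "(\<Sum>p\<in>X. t p * \<sigma> (g p))\<^sup>2 = (\<Sum>p\<in>X. \<Sum>q\<in>X. t p * t q * (\<sigma> (g p) * \<sigma> (g q)))" for g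
    unfolding power2_eq_square sum_product by (simp add: mult_ac)
  note i = integrable_activation_prod(1)[OF A]
  show "integrable (centered_gaussian X A) (\<lambda>g. (\<Sum>p\<in>X. t p * \<sigma> (g p))\<^sup>2)"
    unfolding eq by (intro Bochner_Integration.integrable_sum integrable_mult_right i)
  have "(\<integral>g. (\<Sum>p\<in>X. t p * \<sigma> (g p))\<^sup>2 \<partial>centered_gaussian X A)
      = (\<Sum>p\<in>X. \<Sum>q\<in>X. t p * t q * (\<integral>g. \<sigma> (g p) * \<sigma> (g q) \<partial>centered_gaussian X A))"
    unfolding eq by (simp add: Bochner_Integration.integral_sum i)
  then show "(\<Sum>p\<in>X. \<Sum>q\<in>X. t p * next_cov \<sigma> X A p q * t q)
    = (\<Sum>p\<in>X. t p)\<^sup>2 + (\<integral>g. (\<Sum>p\<in>X. t p * \<sigma> (g p))\<^sup>2 \<partial>centered_gaussian X A)"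
    unfolding next_cov_def quadratic_form_ones by (simp add: mult_ac)
qed

lemma psd_next_cov:
  assumes A: "psd_on X A" shows "psd_on X (next_cov \<sigma> X A)"
  unfolding psd_on_def quadratic_form_next_cov(1)[OF A]
  by (auto simp: next_cov_def mult.commute intro!: add_nonneg_nonneg integral_nonneg_AE)

end

text \<open>
  A relation between the activations that holds almost surely under the Gaussian law with
  covariance \<open>K\<close> holds, by continuity, on its whole support.
\<close>

lemma activation_relation_on_support:
  fixes w :: "nat \<Rightarrow> vec \<Rightarrow> real"
  assumes fin: "finite X" and psd: "psd_on X K"
    and K: "\<forall>p\<in>X. \<forall>q\<in>X. K p q = (\<Sum>i<r. w i p * w i q)"
    and zero: "(\<integral>g. (\<Sum>p\<in>X. t p * \<sigma> (g p))\<^sup>2 \<partial>centered_gaussian X K) = 0"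
  shows "(\<Sum>p\<in>X. t p * \<sigma> (\<Sum>i<r. w i p * y i)) = 0"
proof (rule ccontr)
  define H where "H y = (\<Sum>p\<in>X. t p * \<sigma> (\<Sum>i<r. w i p * y i))" for y :: "nat \<Rightarrow> real"
  assume "(\<Sum>p\<in>X. t p * \<sigma> (\<Sum>i<r. w i p * y i)) \<noteq> 0"
  then have Hy: "\<bar>H y\<bar> > 0" by (simp add: H_def)
  let ?S = "normal_prod {..<r} (\<lambda>_. 1)"
  interpret prob_space ?S by (rule prob_space_normal_prod) simp
  have "is_centered_gaussian X K (distr ?S (\<Pi>\<^sub>M p\<in>X. borel) (\<lambda>\<omega>. \<lambda>p\<in>X. \<Sum>q\<in>{..<r}. w q p * \<omega> q))"
  proof (rule is_centered_gaussian_linear[where s="\<lambda>_. 1", OF _ fin])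
    show "(\<Sum>q<r. 1\<^sup>2 * (w q p * w q p')) = K p p'" if "p \<in> X" "p' \<in> X" for p p'
      using K that by simp
  qed (rule normal_prod_coordinates; simp | simp)+
  then have cg: "centered_gaussian X K = distr ?S (\<Pi>\<^sub>M p\<in>X. borel) (\<lambda>\<omega>. \<lambda>p\<in>X. \<Sum>q\<in>{..<r}. w q p * \<omega> q)"
    by (rule centered_gaussian_eqI[OF fin])
  have meas: "(\<lambda>\<omega>. \<lambda>p\<in>X. \<Sum>q\<in>{..<r}. w q p * \<omega> q) \<in> ?S \<rightarrow>\<^sub>M (\<Pi>\<^sub>M p\<in>X. borel)" by measurable
  have m2: "(\<lambda>g. (\<Sum>p\<in>X. t p * \<sigma> (g p))\<^sup>2) \<in> borel_measurable (\<Pi>\<^sub>M p\<in>X. borel)" by measurable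
  have Hg: "(\<Sum>p\<in>X. t p * \<sigma> ((\<lambda>p\<in>X. \<Sum>q\<in>{..<r}. w q p * \<omega> q) p)) = H \<omega>" for \<omega>
    unfolding H_def by (intro sum.cong) auto
  have "integrable ?S (\<lambda>\<omega>. (H \<omega>)\<^sup>2)"
    using quadratic_form_next_cov(2)[OF fin psd, of t] unfolding cg integrable_distr_eq[OF meas m2] Hg .
  moreover have "(\<integral>\<omega>. (H \<omega>)\<^sup>2 \<partial>?S) = 0"
    using zero unfolding cg integral_distr[OF meas m2] Hg .
  ultimately have AE0: "AE \<omega> in ?S. H \<omega> = 0"
    by (subst (asm) integral_nonneg_eq_0_iff_AE) auto
  \<comment> \<open>\<open>c\<close> is a Lipschitz constant of \<open>H\<close> for the maximum
    norm. With the \<open>\<delta>\<close> below, \<open>H\<close> changes by at most half of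
    \<open>\<bar>H y\<bar>\<close> on the box around \<open>y\<close>.\<close>
  define c where "c = (\<Sum>p\<in>X. \<bar>t p\<bar> * (Lip * (\<Sum>i<r. \<bar>w i p\<bar>)))"
  have c0: "c \<ge> 0" unfolding c_def by (intro sum_nonneg mult_nonneg_nonneg Lip_nonneg) auto
  define \<delta> where "\<delta> = \<bar>H y\<bar> / (2 * (c + 1))"
  have \<delta>: "\<delta> > 0" using Hy c0 by (simp add: \<delta>_def)
  define I where "I i = {y i - \<delta> .. y i + \<delta>}" for i
  have near: "H \<omega> \<noteq> 0" if \<omega>: "\<omega> \<in> PiE {..<r} I" for \<omega>
  proof -
    have wi: "\<bar>\<omega> i - y i\<bar> \<le> \<delta>" if "i < r" for i
    proof -
      have "\<omega> i \<in> I i" using \<omega> that by (auto simp: PiE_iff)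
      then show ?thesis unfolding I_def by (simp add: abs_le_iff)
    qed
    have "\<bar>H \<omega> - H y\<bar> \<le> (\<Sum>p\<in>X. \<bar>t p\<bar> * \<bar>\<sigma> (\<Sum>i<r. w i p * \<omega> i) - \<sigma> (\<Sum>i<r. w i p * y i)\<bar>)"
      unfolding H_def sum_subtractf[symmetric] right_diff_distrib[symmetric] abs_mult[symmetric] by (rule sum_abs)
    also have "\<dots> \<le> (\<Sum>p\<in>X. \<bar>t p\<bar> * (Lip * (\<Sum>i<r. \<bar>w i p\<bar>) * \<delta>))"
    proof (intro sum_mono mult_left_mono)
      fix p
      have "\<bar>(\<Sum>i<r. w i p * \<omega> i) - (\<Sum>i<r. w i p * y i)\<bar> \<le> (\<Sum>i<r. \<bar>w i p\<bar> * \<bar>\<omega> i - y i\<bar>)"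
        unfolding sum_subtractf[symmetric] right_diff_distrib[symmetric] abs_mult[symmetric] by (rule sum_abs)
      also have "\<dots> \<le> (\<Sum>i<r. \<bar>w i p\<bar> * \<delta>)" using wi by (intro sum_mono mult_left_mono) auto
      finally have "Lip * \<bar>(\<Sum>i<r. w i p * \<omega> i) - (\<Sum>i<r. w i p * y i)\<bar> \<le> Lip * ((\<Sum>i<r. \<bar>w i p\<bar>) * \<delta>)"
        using Lip_nonneg by (intro mult_left_mono) (auto simp: sum_distrib_right)
      then show "\<bar>\<sigma> (\<Sum>i<r. w i p * \<omega> i) - \<sigma> (\<Sum>i<r. w i p * y i)\<bar> \<le> Lip * (\<Sum>i<r. \<bar>w i p\<bar>) * \<delta>"
        using activation_diff[of "\<Sum>i<r. w i p * \<omega> i" "\<Sum>i<r. w i p * y i"] by (simp add: mult.assoc)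
    qed simp
    also have "\<dots> = c * \<delta>" by (simp only: c_def sum_distrib_right mult.assoc)
    also have "\<dots> \<le> (c + 1) * \<delta>" using \<delta> by (intro mult_right_mono) auto
    also have "\<dots> = \<bar>H y\<bar> / 2"
    proof -
      have "c + 1 \<noteq> 0" using c0 by simp
      then show ?thesis
        by (simp only: \<delta>_def times_divide_eq_right mult.commute[of 2]) (rule nonzero_mult_divide_mult_cancel_left)
    qed
    finally show ?thesis using Hy by linarith
  qed
  \<comment> \<open>The normal density is positive, so the box has positive probability, although
    \<open>H\<close> vanishes almost surely and nowhere on the box.\<close>
  have pos: "emeasure (density lborel (normal_density 0 1)) (I i) \<noteq> 0" for i
  proof
    assume "emeasure (density lborel (normal_density 0 1)) (I i) = 0"
    then have "(\<integral>\<^sup>+x. ennreal (normal_density 0 1 x) * indicator (I i) x \<partial>lborel) = 0"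
      by (subst (asm) emeasure_density) (auto simp: I_def)
    then have "AE x in lborel. ennreal (normal_density 0 1 x) * indicator (I i) x = 0"
      by (subst (asm) nn_integral_0_iff_AE) (auto simp: I_def)
    then have "AE x in lborel. x \<notin> I i"
    proof (rule AE_mp, intro AE_I2 impI)
      fix x assume "ennreal (normal_density 0 1 x) * indicator (I i) x = 0"
      then show "x \<notin> I i" using normal_density_pos[of 1 0 x] by (auto simp: indicator_def split: if_splits)
    qed
    then have "I i \<in> null_sets lborel" by (subst AE_iff_null_sets) (auto simp: I_def)
    then have "emeasure lborel (I i) = 0" by auto
    then show False using \<delta> by (simp add: I_def)
  qed
  interpret pp: product_prob_space "\<lambda>_::nat. density lborel (normal_density 0 1)" UNIV
    by (intro product_prob_spaceI prob_space_normal_density) auto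
  have "emeasure ?S (PiE {..<r} I) = (\<Prod>i<r. emeasure (density lborel (normal_density 0 1)) (I i))"
    by (rule pp.emeasure_PiM) (auto simp: I_def)
  then have "emeasure ?S (PiE {..<r} I) \<noteq> 0" using pos by simp
  moreover have "PiE {..<r} I \<in> sets ?S" by (auto simp: I_def intro!: sets_PiM_I_finite)
  moreover have "AE \<omega> in ?S. \<omega> \<notin> PiE {..<r} I" using AE0 near by (auto elim!: AE_mp)
  ultimately show False by (simp add: AE_iff_null_sets[symmetric] null_sets_def)
qed

text \<open>A null vector of the next limit covariance is an almost sure relation between
  activations together with a vanishing sum of entries. The relation extends to the support, where
  \<open>supp\<close> places the rows \<open>z j\<close>; hence each summand of
  \<open>emp_cov\<close> annihilates the vector too.\<close>

lemma emp_cov_cov_below: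
  fixes w :: "nat \<Rightarrow> vec \<Rightarrow> real"
  assumes fin: "finite X" and psd: "psd_on X K"
    and K: "\<forall>p\<in>X. \<forall>q\<in>X. K p q = (\<Sum>i<r. w i p * w i q)"
    and supp: "\<forall>j<n. \<forall>p\<in>X. z j p = (\<Sum>i<r. w i p * y j i)"
  shows "cov_below X (next_cov \<sigma> X K) (emp_cov n \<sigma> z)"
  unfolding cov_below_def
proof (intro conjI allI impI ballI psd_emp_cov)
  fix t p
  assume t: "\<forall>p\<in>X. (\<Sum>q\<in>X. next_cov \<sigma> X K p q * t q) = 0" and p: "p \<in> X"
  have "(\<Sum>p\<in>X. \<Sum>q\<in>X. t p * next_cov \<sigma> X K p q * t q) = (\<Sum>p\<in>X. t p * (\<Sum>q\<in>X. next_cov \<sigma> X K p q * t q))"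
    by (simp add: sum_distrib_left mult.assoc)
  also have "\<dots> = 0" using t by simp
  finally have "(\<Sum>p\<in>X. t p)\<^sup>2 + (\<integral>g. (\<Sum>p\<in>X. t p * \<sigma> (g p))\<^sup>2 \<partial>centered_gaussian X K) = 0"
    unfolding quadratic_form_next_cov(1)[OF fin psd] .
  moreover have "0 \<le> (\<integral>g. (\<Sum>p\<in>X. t p * \<sigma> (g p))\<^sup>2 \<partial>centered_gaussian X K)"
    by (intro integral_nonneg_AE) auto
  ultimately have 1: "(\<Sum>p\<in>X. t p) = 0"
    and 2: "(\<integral>g. (\<Sum>p\<in>X. t p * \<sigma> (g p))\<^sup>2 \<partial>centered_gaussian X K) = 0"
    by (auto simp: add_nonneg_eq_0_iff)
  have 3: "(\<Sum>q\<in>X. \<sigma> (z j q) * t q) = 0" if "j < n" for j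
    using activation_relation_on_support[OF fin psd K 2, of "y j"] supp that
    by (simp add: mult.commute cong: sum.cong)
  have "(\<Sum>q\<in>X. emp_cov n \<sigma> z p q * t q) = (\<Sum>q\<in>X. t q) + (\<Sum>q\<in>X. \<Sum>j<n. \<sigma> (z j p) * (\<sigma> (z j q) * t q)) / real n"
    by (simp add: emp_cov_def distrib_right sum.distrib sum_distrib_right mult.assoc flip: sum_divide_distrib)
  also have "(\<Sum>q\<in>X. \<Sum>j<n. \<sigma> (z j p) * (\<sigma> (z j q) * t q)) = (\<Sum>j<n. \<sigma> (z j p) * (\<Sum>q\<in>X. \<sigma> (z j q) * t q))"
    by (subst sum.swap) (simp add: sum_distrib_left)
  finally show "(\<Sum>q\<in>X. emp_cov n \<sigma> z p q * t q) = 0" using 1 3 by simp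
qed

end

text \<open>The difference of the two sides is a linear functional whose coefficient vector lies in
  the null space of \<open>K\<close>, hence in that of \<open>A\<close>. Its variance is therefore
  \<open>0\<close> and its law is the point mass at \<open>0\<close>.\<close>

lemma centered_gaussian_support:
  fixes r :: nat and X :: "vec set"
  assumes fin: "finite X" and A: "cov_below X K A"
    and K: "\<forall>p\<in>X. \<forall>q\<in>X. K p q = (\<Sum>i<r. w i p * w i q)"
    and u: "\<forall>i<r. \<forall>j<r. (\<Sum>p\<in>X. u i p * w j p) = (if i = j then 1 else 0)"
    and p: "p \<in> X"
  shows "AE g in centered_gaussian X A. g p = (\<Sum>i<r. w i p * (\<Sum>q\<in>X. u i q * g q))"
proof -
  have psd: "psd_on X A" using A by (simp add: cov_below_def)
  note [measurable_cong] = sets_centered_gaussian[OF fin psd]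
  define t where "t q = (if q = p then 1 else 0) - (\<Sum>i<r. w i p * u i q)" for q
  have tg: "(\<Sum>q\<in>X. t q * g q) = g p - (\<Sum>i<r. w i p * (\<Sum>q\<in>X. u i q * g q))" for g
  proof -
    have "(\<Sum>q\<in>X. (if q = p then 1 else 0) * g q) = g p"
      using fin p by (simp add: if_distrib[of "\<lambda>x. x * _"] cong: if_cong)
    moreover have "(\<Sum>q\<in>X. (\<Sum>i<r. w i p * u i q) * g q) = (\<Sum>i<r. w i p * (\<Sum>q\<in>X. u i q * g q))"
      unfolding sum_distrib_right sum_distrib_left by (subst sum.swap) (simp add: mult.assoc)
    ultimately show ?thesis by (simp add: t_def left_diff_distrib sum_subtractf)
  qed
  have tw: "(\<Sum>q\<in>X. t q * w j q) = 0" if "j < r" for j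
  proof -
    have "(\<Sum>i<r. w i p * (\<Sum>q\<in>X. u i q * w j q)) = (\<Sum>i<r. if i = j then w i p else 0)"
      using u that by (intro sum.cong) auto
    also have "\<dots> = w j p" using that by (subst sum.delta) auto
    finally show ?thesis unfolding tg by simp
  qed
  have "(\<Sum>i\<in>X. \<Sum>j\<in>X. t i * A i j * t j) = 0"
  proof -
    have "(\<Sum>q\<in>X. K i q * t q) = 0" if "i \<in> X" for i
    proof -
      have "(\<Sum>q\<in>X. K i q * t q) = (\<Sum>q\<in>X. \<Sum>j<r. w j i * (t q * w j q))"
        using K that by (intro sum.cong refl) (simp add: sum_distrib_left mult_ac)
      also have "\<dots> = (\<Sum>j<r. w j i * (\<Sum>q\<in>X. t q * w j q))"
        by (subst sum.swap) (simp add: sum_distrib_left)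
      finally show ?thesis using tw by simp
    qed
    then have "(\<Sum>j\<in>X. A i j * t j) = 0" if "i \<in> X" for i using A that by (simp add: cov_below_def)
    then show ?thesis by (simp add: mult.assoc flip: sum_distrib_left)
  qed
  then have "distr (centered_gaussian X A) borel (\<lambda>g. \<Sum>q\<in>X. t q * g q) = return borel 0"
    using is_centered_gaussian_distr[OF is_centered_gaussian_centered_gaussian[OF fin psd], of t]
    by (simp add: centered_normal_def)
  moreover have "AE x in return borel (0::real). x = 0" by (subst AE_return) auto
  ultimately have "AE x in distr (centered_gaussian X A) borel (\<lambda>g. \<Sum>q\<in>X. t q * g q). x = 0" by (simp only:)
  then have "AE g in centered_gaussian X A. (\<Sum>q\<in>X. t q * g q) = 0"
    by (subst (asm) AE_distr_iff) auto
  then show ?thesis unfolding tg by simp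
qed

section \<open>Gaussian mixtures with concentrated covariance\<close>

text \<open>Fubini's theorem for a kernel, obtained from the nonnegative case by positive and
  negative parts. The hypothesis only makes the inner integral of the absolute value finite for
  almost every \<open>z\<close>, so the parts are compared almost everywhere.\<close>

lemma integral_bind_prob:
  fixes f :: "'b \<Rightarrow> real"
  assumes N: "prob_space N" and \<kappa>: "\<kappa> \<in> N \<rightarrow>\<^sub>M subprob_algebra S" and f: "f \<in> borel_measurable S"
    and fin: "(\<integral>\<^sup>+z. \<integral>\<^sup>+y. ennreal \<bar>f y\<bar> \<partial>\<kappa> z \<partial>N) < \<infinity>"
  shows "integrable (N \<bind> \<kappa>) f"
    and "integrable N (\<lambda>z. \<integral>y. f y \<partial>\<kappa> z)"
    and "(\<integral>y. f y \<partial>(N \<bind> \<kappa>)) = (\<integral>z. \<integral>y. f y \<partial>\<kappa> z \<partial>N)"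
proof -
  interpret prob_space N by fact
  have sk: "sets (\<kappa> z) = sets S" if "z \<in> space N" for z using sets_kernel[OF \<kappa> that] .
  have sb: "sets (N \<bind> \<kappa>) = sets S"
    using sk not_empty by (rule sets_bind)
  have fk: "f \<in> borel_measurable (\<kappa> z)" if "z \<in> space N" for z
    using f by (simp add: sk[OF that] cong: measurable_cong_sets)
  define P where "P z = (\<integral>\<^sup>+y. ennreal (f y) \<partial>\<kappa> z)" for z
  define M where "M z = (\<integral>\<^sup>+y. ennreal (- f y) \<partial>\<kappa> z)" for z
  define T where "T z = (\<integral>\<^sup>+y. ennreal \<bar>f y\<bar> \<partial>\<kappa> z)" for z
  have meas: "(\<lambda>z. \<integral>\<^sup>+y. g y \<partial>\<kappa> z) \<in> borel_measurable N" if "g \<in> borel_measurable S" for g :: "_ \<Rightarrow> ennreal"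
    using measurable_compose[OF \<kappa> nn_integral_measurable_subprob_algebra[OF that]] .
  have [measurable]: "P \<in> borel_measurable N" "M \<in> borel_measurable N" "T \<in> borel_measurable N"
    unfolding P_def M_def T_def using f by (auto intro!: meas)
  have b: "(\<integral>\<^sup>+y. g y \<partial>(N \<bind> \<kappa>)) = (\<integral>\<^sup>+z. \<integral>\<^sup>+y. g y \<partial>\<kappa> z \<partial>N)" if "g \<in> borel_measurable S" for g
    by (rule nn_integral_bind[OF that \<kappa>])
  show i: "integrable (N \<bind> \<kappa>) f"
    using f fin by (intro integrableI_bounded) (auto simp: b sb cong: measurable_cong_sets)
  have PT: "P z \<le> T z" "M z \<le> T z" for z
    unfolding P_def M_def T_def by (auto intro!: nn_integral_mono ennreal_leI)
  have PiT: "(\<integral>\<^sup>+z. P z \<partial>N) < \<infinity>" "(\<integral>\<^sup>+z. M z \<partial>N) < \<infinity>"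
    using fin PT unfolding T_def[symmetric] by (auto intro: le_less_trans[OF nn_integral_mono])
  have TAE: "AE z in N. T z \<noteq> \<infinity>"
    using fin unfolding T_def[symmetric] by (intro nn_integral_PInf_AE) auto
  have fz: "(\<integral>y. f y \<partial>\<kappa> z) = enn2real (P z) - enn2real (M z)" if "z \<in> space N" "T z \<noteq> \<infinity>" for z
  proof -
    have "integrable (\<kappa> z) f" using that fk by (intro integrableI_bounded) (auto simp: T_def less_top)
    then show ?thesis unfolding P_def M_def by (rule real_lebesgue_integral_def)
  qed
  have enn: "integrable N (\<lambda>z. enn2real (g z)) \<and> (\<integral>z. enn2real (g z) \<partial>N) = enn2real (\<integral>\<^sup>+z. g z \<partial>N)"
    if [measurable]: "g \<in> borel_measurable N" and "(\<integral>\<^sup>+z. g z \<partial>N) < \<infinity>" for g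
  proof -
    have "AE z in N. g z \<noteq> \<infinity>" using that by (intro nn_integral_PInf_AE) auto
    then have "(\<integral>\<^sup>+z. ennreal (enn2real (g z)) \<partial>N) = (\<integral>\<^sup>+z. g z \<partial>N)"
      by (intro nn_integral_cong_AE) (auto simp: less_top)
    moreover have "(\<lambda>z. enn2real (g z)) \<in> borel_measurable N" by measurable
    ultimately show ?thesis using that(2)
      by (intro conjI integrableI_nonneg) (simp_all add: integral_eq_nn_integral)
  qed
  have AEf: "AE z in N. enn2real (P z) - enn2real (M z) = (\<integral>y. f y \<partial>\<kappa> z)"
    using TAE AE_space by eventually_elim (simp add: fz)
  have mf: "(\<lambda>z. \<integral>y. f y \<partial>\<kappa> z) \<in> borel_measurable N"
    using measurable_compose[OF \<kappa> integral_measurable_subprob_algebra[OF f]] .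
  have id: "integrable N (\<lambda>z. enn2real (P z) - enn2real (M z))"
    using enn[of P] enn[of M] PiT by auto
  show "integrable N (\<lambda>z. \<integral>y. f y \<partial>\<kappa> z)"
    by (rule integrable_cong_AE[THEN iffD1, OF borel_measurable_integrable[OF id] mf AEf id])
  have "(\<integral>z. \<integral>y. f y \<partial>\<kappa> z \<partial>N) = (\<integral>z. enn2real (P z) - enn2real (M z) \<partial>N)"
    by (rule integral_cong_AE[OF mf borel_measurable_integrable[OF id]]) (use AEf in \<open>simp add: eq_commute\<close>)
  also have "\<dots> = enn2real (\<integral>\<^sup>+z. P z \<partial>N) - enn2real (\<integral>\<^sup>+z. M z \<partial>N)"
    using enn[of P] enn[of M] PiT by simp
  also have "\<dots> = (\<integral>y. f y \<partial>(N \<bind> \<kappa>))"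
    unfolding real_lebesgue_integral_def[OF i] P_def M_def using f by (simp add: b)
  finally show "(\<integral>y. f y \<partial>(N \<bind> \<kappa>)) = (\<integral>z. \<integral>y. f y \<partial>\<kappa> z \<partial>N)" ..
qed

text \<open>
  The covariances are positive semidefinite everywhere, so that the Gaussian laws form a
  probability kernel; the condition on their null spaces only holds almost surely.
\<close>

definition cov_mixture :: "vec set \<Rightarrow> nat \<Rightarrow> (vec \<Rightarrow> vec \<Rightarrow> real) \<Rightarrow> real \<Rightarrow> outputs measure \<Rightarrow>
    (outputs \<Rightarrow> vec \<Rightarrow> vec \<Rightarrow> real) \<Rightarrow> bool" where
  "cov_mixture X n K e N A \<longleftrightarrow> prob_space N \<and>
    (\<lambda>z. gaussian_outputs n X (A z)) \<in> N \<rightarrow>\<^sub>M subprob_algebra (output_space n X) \<and>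
    (\<forall>z. psd_on X (A z)) \<and> (AE z in N. cov_below X K (A z)) \<and>
    (\<forall>p\<in>X. \<forall>q\<in>X. (\<lambda>z. A z p q) \<in> borel_measurable N \<and>
      integrable N (\<lambda>z. (A z p q - K p q)\<^sup>2) \<and>
      (\<integral>z. (A z p q - K p q)\<^sup>2 \<partial>N) \<le> e \<and> \<bar>\<integral>z. A z p q - K p q \<partial>N\<bar> \<le> e)"

definition mixture :: "vec set \<Rightarrow> nat \<Rightarrow> outputs measure \<Rightarrow> (outputs \<Rightarrow> vec \<Rightarrow> vec \<Rightarrow> real) \<Rightarrow> outputs measure" where
  "mixture X n N A = N \<bind> (\<lambda>z. gaussian_outputs n X (A z))"

context
  fixes X :: "vec set" and n :: nat and K :: "vec \<Rightarrow> vec \<Rightarrow> real" and e :: real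
    and N :: "outputs measure" and A :: "outputs \<Rightarrow> vec \<Rightarrow> vec \<Rightarrow> real"
  assumes fin: "finite X" and mix: "cov_mixture X n K e N A"
begin

interpretation N: prob_space N
  using mix by (simp add: cov_mixture_def)

lemma mix_kernel: "(\<lambda>z. gaussian_outputs n X (A z)) \<in> N \<rightarrow>\<^sub>M subprob_algebra (output_space n X)"
  using mix by (simp add: cov_mixture_def)

lemma mix_psd: "psd_on X (A z)"
  using mix by (simp add: cov_mixture_def)

lemma mix_below: "AE z in N. cov_below X K (A z)"
  using mix by (simp add: cov_mixture_def)

lemma mix_entry:
  assumes "p \<in> X" "q \<in> X"
  shows "(\<lambda>z. A z p q) \<in> borel_measurable N" "integrable N (\<lambda>z. (A z p q - K p q)\<^sup>2)"
    "(\<integral>z. (A z p q - K p q)\<^sup>2 \<partial>N) \<le> e" "\<bar>\<integral>z. A z p q - K p q \<partial>N\<bar> \<le> e"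
    "integrable N (\<lambda>z. A z p q - K p q)"
proof -
  show 1: "(\<lambda>z. A z p q) \<in> borel_measurable N" "integrable N (\<lambda>z. (A z p q - K p q)\<^sup>2)"
    "(\<integral>z. (A z p q - K p q)\<^sup>2 \<partial>N) \<le> e" "\<bar>\<integral>z. A z p q - K p q \<partial>N\<bar> \<le> e"
    using mix assms by (auto simp: cov_mixture_def)
  show "integrable N (\<lambda>z. A z p q - K p q)"
  proof (rule N.square_integrable_imp_integrable)
    show "(\<lambda>z. A z p q - K p q) \<in> borel_measurable N"
      by (rule borel_measurable_diff[OF 1(1) borel_measurable_const])
  qed (rule 1(2))
qed

text \<open>Of the four factors \<open>card X\<close>, two come from Cauchy-Schwarz over the entries
  and two from adding up their mean squares.\<close>

lemma integral_cov_dist_sq: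
  shows "integrable N (\<lambda>z. (cov_dist X (A z) K)\<^sup>2)"
    and "(\<integral>z. (cov_dist X (A z) K)\<^sup>2 \<partial>N) \<le> real (card X) ^ 4 * e"
proof -
  have i: "integrable N (\<lambda>z. (real (card X))\<^sup>2 * (\<Sum>p\<in>X. \<Sum>q\<in>X. (A z p q - K p q)\<^sup>2))"
    by (intro integrable_mult_right Bochner_Integration.integrable_sum mix_entry)
  have [measurable]: "(\<lambda>z. cov_dist X (A z) K) \<in> borel_measurable N"
    unfolding cov_dist_def
    by (intro borel_measurable_sum borel_measurable_abs borel_measurable_diff borel_measurable_const mix_entry)
  show i2: "integrable N (\<lambda>z. (cov_dist X (A z) K)\<^sup>2)"
    by (rule Bochner_Integration.integrable_bound[OF i])
      (use cov_dist_sq_le in \<open>auto intro!: AE_I2 intro: order_trans[OF _ abs_ge_self]\<close>)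
  have "(\<integral>z. (cov_dist X (A z) K)\<^sup>2 \<partial>N) \<le> (\<integral>z. (real (card X))\<^sup>2 * (\<Sum>p\<in>X. \<Sum>q\<in>X. (A z p q - K p q)\<^sup>2) \<partial>N)"
    by (rule integral_mono[OF i2 i]) (rule cov_dist_sq_le)
  also have "\<dots> = (real (card X))\<^sup>2 * (\<Sum>p\<in>X. \<Sum>q\<in>X. (\<integral>z. (A z p q - K p q)\<^sup>2 \<partial>N))"
    by (simp add: Bochner_Integration.integral_sum mix_entry)
  also have "\<dots> \<le> (real (card X))\<^sup>2 * (\<Sum>p\<in>X. \<Sum>q\<in>X. e)"
    by (intro mult_left_mono sum_mono mix_entry) auto
  also have "\<dots> = real (card X) ^ 4 * e" by (simp add: power2_eq_square power4_eq_xxxx)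
  finally show "(\<integral>z. (cov_dist X (A z) K)\<^sup>2 \<partial>N) \<le> real (card X) ^ 4 * e" .
qed

text \<open>Averaging the expansion: the linear term only sees the mean of \<open>A z - K\<close>,
  the remainder its mean square. Both are of order \<open>e\<close>, so no square root of
  \<open>e\<close> appears.\<close>

lemma integral_first_order:
  assumes m: "(\<lambda>z. F (A z)) \<in> borel_measurable N" and C: "C \<ge> 0" and F: "first_order_at X K C F l"
  shows "\<bar>(\<integral>z. F (A z) \<partial>N) - F K\<bar> \<le> 2 * C * real (card X) ^ 4 * e"
proof -
  define \<phi> c where "\<phi> z = F (A z)" and "c = F K" for z
  have \<phi>: "\<phi> \<in> borel_measurable N" using m unfolding \<phi>_def .
  have l: "\<forall>p\<in>X. \<forall>q\<in>X. \<bar>l p q\<bar> \<le> C" using F unfolding first_order_at_def by blast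
  have exp: "AE z in N. \<bar>\<phi> z - c - (\<Sum>p\<in>X. \<Sum>q\<in>X. l p q * (A z p q - K p q))\<bar> \<le> C * (cov_dist X (A z) K)\<^sup>2"
  proof (rule AE_mp[OF mix_below], rule AE_I2, rule impI)
    fix z assume "cov_below X K (A z)"
    then show "\<bar>\<phi> z - c - (\<Sum>p\<in>X. \<Sum>q\<in>X. l p q * (A z p q - K p q))\<bar> \<le> C * (cov_dist X (A z) K)\<^sup>2"
      using F unfolding first_order_at_def \<phi>_def c_def by blast
  qed
  define S where "S z = (\<Sum>p\<in>X. \<Sum>q\<in>X. l p q * (A z p q - K p q))" for z
  have iS: "integrable N S" unfolding S_def
    by (intro integrable_mult_right Bochner_Integration.integrable_sum mix_entry)
  note icd = integral_cov_dist_sq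
  have ir: "integrable N (\<lambda>z. \<phi> z - c - S z)"
    by (rule Bochner_Integration.integrable_bound[where f="\<lambda>z. C * (cov_dist X (A z) K)\<^sup>2"])
      (use icd(1) \<phi> iS C exp in \<open>auto simp: S_def[symmetric]\<close>)
  have eq: "\<phi> z = (\<phi> z - c - S z) + S z + c" for z by simp
  have i\<phi>: "integrable N \<phi>"
    using ir iS by (subst eq[abs_def]) (intro Bochner_Integration.integrable_add, auto)
  have "(\<integral>z. \<phi> z \<partial>N) - c = (\<integral>z. \<phi> z - c - S z \<partial>N) + (\<integral>z. S z \<partial>N)"
    using i\<phi> iS by (simp add: N.prob_space)
  moreover have "\<bar>\<integral>z. \<phi> z - c - S z \<partial>N\<bar> \<le> C * (real (card X) ^ 4 * e)"
  proof -
    have "\<bar>\<integral>z. \<phi> z - c - S z \<partial>N\<bar> \<le> (\<integral>z. \<bar>\<phi> z - c - S z\<bar> \<partial>N)" by (rule integral_abs_bound)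
    also have "\<dots> \<le> (\<integral>z. C * (cov_dist X (A z) K)\<^sup>2 \<partial>N)"
      using ir icd(1) exp by (intro integral_mono_AE) (auto simp: S_def)
    also have "\<dots> \<le> C * (real (card X) ^ 4 * e)" using icd(2) C by (simp add: mult_left_mono)
    finally show ?thesis .
  qed
  moreover have "\<bar>\<integral>z. S z \<partial>N\<bar> \<le> C * (real (card X) ^ 4 * e)"
  proof -
    have "(\<integral>z. S z \<partial>N) = (\<Sum>p\<in>X. \<Sum>q\<in>X. l p q * (\<integral>z. A z p q - K p q \<partial>N))"
      unfolding S_def
    proof -
      have i: "integrable N (\<lambda>z. l p q * (A z p q - K p q))" if "p \<in> X" "q \<in> X" for p q
        by (intro integrable_mult_right mix_entry that)
      have "(\<integral>z. (\<Sum>q\<in>X. l p q * (A z p q - K p q)) \<partial>N) = (\<Sum>q\<in>X. l p q * (\<integral>z. A z p q - K p q \<partial>N))" if "p \<in> X" for p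
        by (subst Bochner_Integration.integral_sum[OF i[OF that]]) (simp_all only: integral_mult_right_zero)
      then show "(\<integral>z. (\<Sum>p\<in>X. \<Sum>q\<in>X. l p q * (A z p q - K p q)) \<partial>N) = (\<Sum>p\<in>X. \<Sum>q\<in>X. l p q * (\<integral>z. A z p q - K p q \<partial>N))"
        by (subst Bochner_Integration.integral_sum[OF Bochner_Integration.integrable_sum[OF i]]) simp_all
    qed
    also have "\<bar>\<dots>\<bar> \<le> (\<Sum>p\<in>X. \<Sum>q\<in>X. C * e)"
      using l mix_entry(4) C
      by (intro order_trans[OF sum_abs] sum_mono order_trans[OF sum_abs])
        (auto simp: abs_mult intro!: mult_mono)
    also have "\<dots> = C * ((real (card X))\<^sup>2 * e)" by (simp add: power2_eq_square)
    also have "\<dots> \<le> C * (real (card X) ^ 4 * e)"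
    proof (cases "X = {}")
      case True then show ?thesis by simp
    next
      case False
      then have "real (card X) \<ge> 1" using fin by (simp add: Suc_leI card_gt_0_iff)
      moreover obtain p where p: "p \<in> X" using False by blast
      have "e \<ge> 0" using mix_entry(4)[OF p p] by linarith
      ultimately show ?thesis using C by (intro mult_left_mono mult_right_mono power_increasing) auto
    qed
    finally show ?thesis .
  qed
  ultimately have "\<bar>(\<integral>z. \<phi> z \<partial>N) - c\<bar> \<le> 2 * C * real (card X) ^ 4 * e" by linarith
  then show ?thesis by (simp add: \<phi>_def c_def)
qed

lemma sets_mixture: "sets (mixture X n N A) = sets (output_space n X)"
  unfolding mixture_def using sets_gaussian_outputs[OF fin mix_psd] N.not_empty by (rule sets_bind)

lemma prob_space_mixture: "prob_space (mixture X n N A)"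
proof (rule prob_spaceI)
  have sp: "space (mixture X n N A) = space (output_space n X)"
    by (rule sets_eq_imp_space_eq[OF sets_mixture])
  have "emeasure (mixture X n N A) (space (output_space n X))
    = (\<integral>\<^sup>+z. emeasure (gaussian_outputs n X (A z)) (space (output_space n X)) \<partial>N)"
    unfolding mixture_def by (rule emeasure_bind[OF N.not_empty mix_kernel]) simp
  also have "\<dots> = (\<integral>\<^sup>+z. 1 \<partial>N)"
    using prob_space.emeasure_space_1[OF prob_space_gaussian_outputs[OF fin mix_psd]]
      sets_eq_imp_space_eq[OF sets_gaussian_outputs[OF fin mix_psd]] by (simp only:)
  also have "\<dots> = 1" by (simp add: N.emeasure_space_1)
  finally show "emeasure (mixture X n N A) (space (mixture X n N A)) = 1" by (simp only: sp)
qed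

text \<open>Given \<open>z\<close>, the integrand is controlled by the trace of \<open>A z\<close>,
  which is integrable; this is what the Fubini theorem for the kernel asks for.\<close>

lemma integral_mixture:
  assumes f: "f \<in> borel_measurable (output_space n X)"
    and fb: "\<And>z. z \<in> space (output_space n X) \<Longrightarrow> \<bar>f z\<bar> \<le> 1 + normsq n X z"
  shows "integrable (mixture X n N A) f"
    and "integrable N (\<lambda>z. \<integral>y. f y \<partial>gaussian_outputs n X (A z))"
    and "(\<integral>y. f y \<partial>mixture X n N A) = (\<integral>z. \<integral>y. f y \<partial>gaussian_outputs n X (A z) \<partial>N)"
proof -
  have iA: "integrable N (\<lambda>z. A z p p)" if "p \<in> X" for p
    using Bochner_Integration.integrable_add[OF mix_entry(5)[OF that that], of "\<lambda>_. K p p"] by simp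
  have "(\<integral>\<^sup>+z. \<integral>\<^sup>+y. ennreal \<bar>f y\<bar> \<partial>gaussian_outputs n X (A z) \<partial>N)
    \<le> (\<integral>\<^sup>+z. ennreal (1 + real n * (\<Sum>p\<in>X. A z p p)) \<partial>N)"
  proof (rule nn_integral_mono)
    fix z
    note q = integral_quadratic_bound[OF fin mix_psd[of z], of "\<lambda>y. \<bar>f y\<bar>" n]
    have fa: "(\<lambda>y. \<bar>f y\<bar>) \<in> borel_measurable (output_space n X)" using f by measurable
    have "(\<integral>\<^sup>+y. ennreal \<bar>f y\<bar> \<partial>gaussian_outputs n X (A z)) = ennreal (\<integral>y. \<bar>f y\<bar> \<partial>gaussian_outputs n X (A z))"
      using q(1)[OF fa] fb by (intro nn_integral_eq_integral) auto
    also have "\<dots> \<le> ennreal (1 + real n * (\<Sum>p\<in>X. A z p p))"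
      using q(2)[OF fa] fb by (intro ennreal_leI) (auto simp: abs_le_iff)
    finally show "(\<integral>\<^sup>+y. ennreal \<bar>f y\<bar> \<partial>gaussian_outputs n X (A z)) \<le> ennreal (1 + real n * (\<Sum>p\<in>X. A z p p))" .
  qed
  also have "\<dots> = ennreal (\<integral>z. 1 + real n * (\<Sum>p\<in>X. A z p p) \<partial>N)"
  proof (rule nn_integral_eq_integral)
    show "integrable N (\<lambda>z. 1 + real n * (\<Sum>p\<in>X. A z p p))" using iA by auto
    show "AE z in N. 0 \<le> 1 + real n * (\<Sum>p\<in>X. A z p p)"
      using psd_on_diag[OF mix_psd fin] by (intro AE_I2 add_nonneg_nonneg mult_nonneg_nonneg sum_nonneg) auto
  qed
  also have "\<dots> < \<infinity>" by simp
  finally have fini: "(\<integral>\<^sup>+z. \<integral>\<^sup>+y. ennreal \<bar>f y\<bar> \<partial>gaussian_outputs n X (A z) \<partial>N) < \<infinity>" .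
  note ib = integral_bind_prob[OF N.prob_space_axioms mix_kernel f fini]
  show "integrable (mixture X n N A) f"
    and "integrable N (\<lambda>z. \<integral>y. f y \<partial>gaussian_outputs n X (A z))"
    and "(\<integral>y. f y \<partial>mixture X n N A) = (\<integral>z. \<integral>y. f y \<partial>gaussian_outputs n X (A z) \<partial>N)"
    unfolding mixture_def using ib by blast+
qed

end

section \<open>The layers of the network\<close>

definition layer_row :: "nat \<Rightarrow> nat \<Rightarrow> nat \<Rightarrow> param set" where
  "layer_row l N k = insert (Bias l k) (Weight l k ` {..<N})"

definition layer_params :: "nat \<Rightarrow> nat \<Rightarrow> nat \<Rightarrow> param set" where
  "layer_params l N m = (\<Union>k<m. layer_row l N k)"

text \<open>A bias is a weight attached to the constant feature \<open>1\<close>. An affine layer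
  thus becomes a linear function of its parameters.\<close>

definition feature :: "(nat \<Rightarrow> vec \<Rightarrow> real) \<Rightarrow> param \<Rightarrow> vec \<Rightarrow> real" where
  "feature \<phi> q p = (case q of Weight _ _ j \<Rightarrow> \<phi> j p | Bias _ _ \<Rightarrow> 1)"

definition layer_out :: "nat \<Rightarrow> nat \<Rightarrow> nat \<Rightarrow> vec set \<Rightarrow> (nat \<Rightarrow> vec \<Rightarrow> real) \<Rightarrow> (param \<Rightarrow> real) \<Rightarrow> outputs" where
  "layer_out l N m X \<phi> \<theta> = (\<lambda>k\<in>{..<m}. \<lambda>p\<in>X. \<Sum>q\<in>layer_row l N k. feature \<phi> q p * \<theta> q)"

text \<open>The maximum only matters for indices outside the network, where it keeps the value positive.\<close>

definition param_sd :: "(nat \<Rightarrow> nat) \<Rightarrow> param \<Rightarrow> real" where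
  "param_sd n q = (case q of Weight l i j \<Rightarrow> sqrt (1 / real (max 1 (n (l - 1)))) | Bias l i \<Rightarrow> 1)"

lemma param_sd_pos: "param_sd n q > 0"
  by (simp add: param_sd_def less_max_iff_disj split: param.split)

lemma finite_layer_row [simp]: "finite (layer_row l N k)"
  by (simp add: layer_row_def)

lemma finite_layer_params [simp]: "finite (layer_params l N m)"
  by (simp add: layer_params_def)

lemma sum_layer_row: "sum f (layer_row l N k) = (\<Sum>j<N. f (Weight l k j)) + f (Bias l k)"
proof -
  have "Bias l k \<notin> Weight l k ` {..<N}" by auto
  moreover have "sum f (Weight l k ` {..<N}) = (\<Sum>j<N. f (Weight l k j))"
    by (subst sum.reindex) (auto simp: inj_on_def)
  ultimately show ?thesis by (simp add: layer_row_def add.commute)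
qed

lemma params_Suc: "l \<ge> 1 \<Longrightarrow> params n (Suc l) = params n l \<union> layer_params (Suc l) (n l) (n (Suc l))"
  unfolding params_def layer_params_def layer_row_def
  by (auto simp: le_Suc_eq)

lemma params_1: "params n (Suc 0) = layer_params (Suc 0) (n 0) (n (Suc 0))"
  unfolding params_def layer_params_def layer_row_def by auto

lemma params_disjoint: "params n l \<inter> layer_params (Suc l) N m = {}"
  unfolding params_def layer_params_def layer_row_def by auto

lemma params_0: "params n 0 = {}"
  by (auto simp: params_def)

lemma finite_params: "finite (params n l)"
proof (induction l)
  case (Suc l)
  then show ?case by (cases l) (simp_all add: params_1 params_Suc)
qed (simp add: params_0)

text \<open>With frozen features the layer is linear in independent normal parameters, and different
  output rows use different parameters.\<close>

lemma layer_out_law: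
  assumes N: "n l \<ge> 1" and m: "m \<ge> 1" and fin: "finite X"
  shows "distr (normal_prod (layer_params (Suc l) (n l) m) (param_sd n)) (output_space m X)
    (layer_out (Suc l) (n l) m X \<phi>) = gaussian_outputs m X (feature_cov (n l) \<phi>)"
proof -
  let ?Q = "layer_params (Suc l) (n l) m"
  interpret prob_space "normal_prod ?Q (param_sd n)"
    by (rule prob_space_normal_prod) (rule param_sd_pos)
  show ?thesis unfolding layer_out_def
  proof (rule distr_rows_eq_gaussian_outputs[OF m finite_layer_params fin normal_prod_coordinates(1) _ normal_prod_coordinates(2)])
    show "layer_row (Suc l) (n l) k \<subseteq> ?Q" if "k < m" for k using that by (auto simp: layer_params_def)
    show "disjoint_family_on (layer_row (Suc l) (n l)) {..<m}"
      by (auto simp: disjoint_family_on_def layer_row_def)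
    fix k p p'
    have "real (max 1 (n l)) = real (n l)" using N by simp
    then show "(\<Sum>q\<in>layer_row (Suc l) (n l) k. (param_sd n q)\<^sup>2 * (feature \<phi> q p * feature \<phi> q p')) = feature_cov (n l) \<phi> p p'"
      unfolding sum_layer_row by (simp add: param_sd_def feature_def feature_cov_def sum_divide_distrib)
  qed (simp_all add: param_sd_pos)
qed

lemma layer_out_measurable:
  assumes Q: "\<And>k. k < m \<Longrightarrow> layer_row l N k \<subseteq> Q"
    and \<phi>: "\<And>j p. j < N \<Longrightarrow> p \<in> X \<Longrightarrow> (\<lambda>z. \<phi> z j p) \<in> borel_measurable S"
  shows "(\<lambda>(z, \<theta>). layer_out l N m X (\<phi> z) \<theta>) \<in> S \<Otimes>\<^sub>M (\<Pi>\<^sub>M q\<in>Q. borel) \<rightarrow>\<^sub>M output_space m X"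
  unfolding layer_out_def output_space_def case_prod_beta
proof (intro measurable_restrict borel_measurable_sum borel_measurable_times)
  fix k p q assume k: "k \<in> {..<m}" and p: "p \<in> X" and q: "q \<in> layer_row l N k"
  show "(\<lambda>x. feature (\<phi> (fst x)) q p) \<in> borel_measurable (S \<Otimes>\<^sub>M (\<Pi>\<^sub>M q\<in>Q. borel))"
    using q measurable_compose[OF measurable_fst \<phi>[OF _ p]] by (auto simp: layer_row_def feature_def)
  have "q \<in> Q" using Q k q by auto
  then show "(\<lambda>x. snd x q) \<in> borel_measurable (S \<Otimes>\<^sub>M (\<Pi>\<^sub>M q\<in>Q. borel))"
    by (intro measurable_compose[OF measurable_snd measurable_component_singleton])
qed

section \<open>The network as a function of one parameter vector\<close>

definition network_out :: "(nat \<Rightarrow> nat) \<Rightarrow> (real \<Rightarrow> real) \<Rightarrow> nat \<Rightarrow> vec set \<Rightarrow> (param \<Rightarrow> real) \<Rightarrow> outputs" where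
  "network_out n \<sigma> l X \<theta> = (\<lambda>k\<in>{..<n l}. \<lambda>p\<in>X.
    network n \<sigma> (\<lambda>l i j. \<theta> (Weight l i j)) (\<lambda>l i. \<theta> (Bias l i)) l p k)"

lemma network_out_1: "network_out n \<sigma> (Suc 0) X \<theta> = layer_out (Suc 0) (n 0) (n (Suc 0)) X (\<lambda>j p. p j) \<theta>"
  unfolding network_out_def layer_out_def
  by (intro restrict_ext) (simp add: sum_layer_row feature_def mult.commute)

text \<open>Layer \<open>l\<close> reads no parameter beyond \<open>params n l\<close>. This is what
  makes the parameters of layer \<open>Suc l\<close> independent of its input.\<close>

lemma network_cong:
  assumes "\<And>q. q \<in> params n l \<Longrightarrow> \<theta> q = \<theta>' q" "k < n l"
  shows "network n \<sigma> (\<lambda>l i j. \<theta> (Weight l i j)) (\<lambda>l i. \<theta> (Bias l i)) l p k =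
    network n \<sigma> (\<lambda>l i j. \<theta>' (Weight l i j)) (\<lambda>l i. \<theta>' (Bias l i)) l p k"
  using assms
proof (induction l arbitrary: k)
  case (Suc l)
  have new: "\<theta> q = \<theta>' q" if "q \<in> layer_row (Suc l) (n l) k" for q
    using that Suc.prems(2) by (intro Suc.prems(1)) (cases l; auto simp: params_Suc params_1 layer_params_def)
  have wb: "\<theta> (Weight (Suc l) k j) = \<theta>' (Weight (Suc l) k j)" "\<theta> (Bias (Suc l) k) = \<theta>' (Bias (Suc l) k)" if "j < n l" for j
    using that by (auto intro!: new simp: layer_row_def)
  have b: "\<theta> (Bias (Suc l) k) = \<theta>' (Bias (Suc l) k)" by (rule new) (simp add: layer_row_def)
  have prev: "\<theta> q = \<theta>' q" if "q \<in> params n l" for q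
    using that by (intro Suc.prems(1)) (cases l; auto simp: params_Suc params_0)
  show ?case
  proof (cases l)
    case 0 then show ?thesis using wb b by simp
  next
    case (Suc l')
    then show ?thesis using wb b Suc.IH[OF prev] by (auto intro!: sum.cong)
  qed
qed simp

lemma network_out_cong:
  "(\<And>q. q \<in> params n l \<Longrightarrow> \<theta> q = \<theta>' q) \<Longrightarrow> network_out n \<sigma> l X \<theta> = network_out n \<sigma> l X \<theta>'"
  unfolding network_out_def by (intro restrict_ext network_cong) auto

lemma network_out_Suc:
  assumes "l \<ge> 1"
  shows "network_out n \<sigma> (Suc l) X \<theta> =
    layer_out (Suc l) (n l) (n (Suc l)) X (\<lambda>j p. \<sigma> (network_out n \<sigma> l X \<theta> j p)) \<theta>"
proof -
  obtain l' where l: "l = Suc l'" using assms by (cases l) auto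
  show ?thesis unfolding layer_out_def
    unfolding network_out_def[of n \<sigma> "Suc l"]
    by (intro restrict_ext) (simp add: sum_layer_row feature_def mult.commute l network_out_def)
qed

context lipschitz_activation
begin

lemma network_out_measurable:
  assumes "l \<ge> 1" shows "network_out n \<sigma> l X \<in> (\<Pi>\<^sub>M q\<in>params n l. borel) \<rightarrow>\<^sub>M output_space (n l) X"
  using assms
proof (induction l rule: dec_induct)
  case base
  have "(\<lambda>(z, \<theta>). layer_out (Suc 0) (n 0) (n (Suc 0)) X (\<lambda>j p. p j) \<theta>)
    \<in> (\<Pi>\<^sub>M q\<in>params n (Suc 0). (borel :: real measure)) \<Otimes>\<^sub>M (\<Pi>\<^sub>M q\<in>params n (Suc 0). borel) \<rightarrow>\<^sub>M output_space (n (Suc 0)) X"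
    by (rule layer_out_measurable) (auto simp: params_1 layer_params_def)
  from measurable_compose[OF measurable_Pair[OF measurable_ident measurable_ident] this]
  show ?case by (simp add: network_out_1[abs_def])
next
  case (step l)
  let ?P = "\<Pi>\<^sub>M q\<in>params n (Suc l). (borel :: real measure)"
  have l: "l \<ge> 1" using step by simp
  have "(\<lambda>\<theta>. network_out n \<sigma> l X (restrict \<theta> (params n l))) \<in> ?P \<rightarrow>\<^sub>M output_space (n l) X"
    by (rule measurable_compose[OF measurable_restrict_subset step.IH]) (use l in \<open>auto simp: params_Suc\<close>)
  moreover have "network_out n \<sigma> l X (restrict \<theta> (params n l)) = network_out n \<sigma> l X \<theta>" for \<theta>
    by (rule network_out_cong) simp
  ultimately have prev: "network_out n \<sigma> l X \<in> ?P \<rightarrow>\<^sub>M output_space (n l) X" by (simp cong: measurable_cong)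
  have "(\<lambda>(\<theta>', \<theta>). layer_out (Suc l) (n l) (n (Suc l)) X (\<lambda>j p. \<sigma> (network_out n \<sigma> l X \<theta>' j p)) \<theta>)
    \<in> ?P \<Otimes>\<^sub>M ?P \<rightarrow>\<^sub>M output_space (n (Suc l)) X"
  proof (rule layer_out_measurable)
    show "layer_row (Suc l) (n l) k \<subseteq> params n (Suc l)" if "k < n (Suc l)" for k
      using that l by (auto simp: params_Suc layer_params_def)
    show "(\<lambda>\<theta>'. \<sigma> (network_out n \<sigma> l X \<theta>' j p)) \<in> borel_measurable ?P" if "j < n l" "p \<in> X" for j p
      by (rule measurable_compose[OF measurable_compose[OF prev output_space_component[OF that]] activation_measurable])
  qed
  note m = measurable_compose[OF measurable_Pair[OF measurable_ident measurable_ident] this]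
  have "network_out n \<sigma> (Suc l) X =
      (\<lambda>\<theta>. layer_out (Suc l) (n l) (n (Suc l)) X (\<lambda>j p. \<sigma> (network_out n \<sigma> l X \<theta> j p)) \<theta>)"
    by (rule ext) (rule network_out_Suc[OF l])
  with m show ?case by simp
qed

lemma layer_out_activation_measurable:
  "(\<lambda>(z, \<theta>). layer_out l N m X (\<lambda>j p. \<sigma> (z j p)) \<theta>)
    \<in> output_space N X \<Otimes>\<^sub>M normal_prod (layer_params l N m) s \<rightarrow>\<^sub>M output_space m X"
proof -
  have "(\<lambda>(z, \<theta>). layer_out l N m X (\<lambda>j p. \<sigma> (z j p)) \<theta>)
    \<in> output_space N X \<Otimes>\<^sub>M (\<Pi>\<^sub>M q\<in>layer_params l N m. borel) \<rightarrow>\<^sub>M output_space m X"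
    by (rule layer_out_measurable)
      (auto simp: layer_params_def intro!: measurable_compose[OF output_space_component activation_measurable])
  then show ?thesis
    by (subst measurable_cong_sets[OF sets_pair_measure_cong[OF refl sets_normal_prod] refl])
qed

text \<open>Measurability in \<open>z\<close> comes from realising all these Gaussian laws as images
  of one fixed parameter law under \<open>layer_out\<close>, which is jointly measurable in the
  input and the parameters.\<close>

lemma emp_cov_kernel:
  assumes N: "N \<ge> 1" and m: "m \<ge> 1" and fin: "finite X"
  shows "(\<lambda>z. gaussian_outputs m X (emp_cov N \<sigma> z)) \<in> output_space N X \<rightarrow>\<^sub>M subprob_algebra (output_space m X)"
proof -
  let ?G = "normal_prod (layer_params 1 N m) (param_sd (\<lambda>_. N))"
  have G: "prob_space ?G" by (rule prob_space_normal_prod) (rule param_sd_pos)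
  have "(\<lambda>z. distr ?G (output_space m X) (\<lambda>\<theta>. layer_out 1 N m X (\<lambda>j p. \<sigma> (z j p)) \<theta>))
    \<in> output_space N X \<rightarrow>\<^sub>M subprob_algebra (output_space m X)"
    using layer_out_activation_measurable
    by (rule measurable_distr2) (use G in \<open>auto simp: space_subprob_algebra prob_space_imp_subprob_space\<close>)
  then show ?thesis using layer_out_law[of "\<lambda>_. N" 0 m X, OF N m fin]
    by (simp add: emp_cov_eq_feature_cov)
qed

text \<open>Replaces the given probability space by the canonical product space of the parameters,
  where restricting and merging sets of coordinates are available.\<close>

lemma network_law_eq:
  assumes g: "gaussian_params M n L W b" and l: "1 \<le> l" "l \<le> L" and n: "\<And>i. i \<le> l \<Longrightarrow> n i \<ge> 1"
  shows "network_law M n \<sigma> W b l X = distr (normal_prod (params n l) (param_sd n)) (output_space (n l) X) (network_out n \<sigma> l X)"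
proof -
  interpret prob_space M using g by (simp add: gaussian_params_def)
  define V where "V q = (case q of Weight l i j \<Rightarrow> W l i j | Bias l i \<Rightarrow> b l i)" for q
  let ?P = "params n l"
  have sub: "?P \<subseteq> params n L" using l by (force simp: params_def)
  have "indep_vars (\<lambda>_. borel) V (params n L)"
    using g by (simp add: gaussian_params_def V_def[abs_def])
  then have ind: "indep_vars (\<lambda>_. borel) V ?P" using sub by (rule indep_vars_subset)
  have Vd: "distributed M lborel (V q) (normal_density 0 (param_sd n q))" if q: "q \<in> ?P" for q
  proof (cases q)
    case (Weight l' i j)
    have "l' \<in> {1..l}" "i < n l'" "j < n (l' - 1)" using q Weight by (auto simp: params_def)
    moreover have "n (l' - 1) \<ge> 1" using calculation by (intro n) auto
    ultimately show ?thesis using g l Weight by (auto simp: gaussian_params_def V_def param_sd_def max_def)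
  next
    case (Bias l' i)
    have "l' \<in> {1..l}" "i < n l'" using q Bias by (auto simp: params_def)
    then show ?thesis using g l Bias by (auto simp: gaussian_params_def V_def param_sd_def)
  qed
  have rv: "random_variable borel (V q)" if "q \<in> ?P" for q using ind that by (auto simp: indep_vars_def)
  have law: "distr M (\<Pi>\<^sub>M q\<in>?P. borel) (\<lambda>\<omega>. \<lambda>q\<in>?P. V q \<omega>) = normal_prod ?P (param_sd n)"
  proof -
    \<comment> \<open>The characterisation of independence by product measures needs a nonempty
      index set.\<close>
    have "Bias l 0 \<in> ?P" using l n[of l] by (auto simp: params_def)
    then have "?P \<noteq> {}" by blast
    have "distr M (\<Pi>\<^sub>M q\<in>?P. borel) (\<lambda>\<omega>. \<lambda>q\<in>?P. V q \<omega>) = (\<Pi>\<^sub>M q\<in>?P. distr M borel (V q))"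
      using ind indep_vars_iff_distr_eq_PiM'[where I="?P" and X=V and M'="\<lambda>_. borel"] \<open>?P \<noteq> {}\<close> rv by simp
    also have "\<dots> = normal_prod ?P (param_sd n)"
    proof (rule PiM_cong[OF refl])
      fix q assume "q \<in> ?P"
      have "distr M borel (V q) = distr M lborel (V q)" by (rule distr_cong) auto
      then show "distr M borel (V q) = density lborel (normal_density 0 (param_sd n q))"
        using Vd[OF \<open>q \<in> ?P\<close>] by (simp add: distributed_def)
    qed
    finally show ?thesis .
  qed
  have "network_law M n \<sigma> W b l X = distr M (output_space (n l) X) (\<lambda>\<omega>. network_out n \<sigma> l X (\<lambda>q\<in>?P. V q \<omega>))"
  proof -
    have "network_out n \<sigma> l X (\<lambda>q\<in>?P. V q \<omega>) = network_out n \<sigma> l X (\<lambda>q. V q \<omega>)" for \<omega>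
      by (rule network_out_cong) simp
    then show ?thesis by (simp add: network_law_def network_out_def V_def)
  qed
  also have "\<dots> = distr (distr M (\<Pi>\<^sub>M q\<in>?P. borel) (\<lambda>\<omega>. \<lambda>q\<in>?P. V q \<omega>)) (output_space (n l) X) (network_out n \<sigma> l X)"
    by (subst distr_distr[OF network_out_measurable[OF l(1)]]) (auto simp: comp_def intro!: measurable_restrict rv)
  finally show ?thesis by (simp only: law)
qed

lemma network_law_1:
  assumes g: "gaussian_params M n L W b" and L: "1 \<le> L" and n: "n 0 \<ge> 1" "n 1 \<ge> 1" and fin: "finite X"
  shows "network_law M n \<sigma> W b 1 X = gaussian_outputs (n 1) X (limit_cov (n 0) \<sigma> X 1)"
proof -
  have "network_law M n \<sigma> W b 1 X = distr (normal_prod (params n 1) (param_sd n)) (output_space (n 1) X) (network_out n \<sigma> 1 X)"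
    by (rule network_law_eq[OF g]) (use L n in \<open>auto simp: le_Suc_eq\<close>)
  also have "\<dots> = gaussian_outputs (n 1) X (feature_cov (n 0) (\<lambda>j p. p j))"
    using layer_out_law[of n 0 "n 1" X "\<lambda>j p. p j"] n fin by (simp add: params_1 network_out_1[abs_def])
  also have "feature_cov (n 0) (\<lambda>j p. p j) = limit_cov (n 0) \<sigma> X 1"
    by (simp add: fun_eq_iff feature_cov_def)
  finally show ?thesis .
qed

text \<open>The parameters split into those of the first \<open>l\<close> layers and those of the
  new one, which are disjoint and hence independent. Integrating out the new ones first gives the
  Gaussian kernel at the output of layer \<open>l\<close>.\<close>

lemma network_law_Suc:
  assumes g: "gaussian_params M n L W b" and l: "1 \<le> l" "Suc l \<le> L"
    and n: "\<And>i. i \<le> Suc l \<Longrightarrow> n i \<ge> 1" and fin: "finite X"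
  shows "network_law M n \<sigma> W b (Suc l) X =
    mixture X (n (Suc l)) (network_law M n \<sigma> W b l X) (emp_cov (n l) \<sigma>)"
proof -
  let ?I = "params n l" and ?J = "layer_params (Suc l) (n l) (n (Suc l))"
  let ?PI = "normal_prod ?I (param_sd n)" and ?PJ = "normal_prod ?J (param_sd n)"
  let ?S = "output_space (n l) X" and ?S' = "output_space (n (Suc l)) X"
  interpret pp: product_prob_space "\<lambda>q. density lborel (normal_density 0 (param_sd n q))" UNIV
    by (intro product_prob_spaceI prob_space_normal_density param_sd_pos)
  interpret J: prob_space ?PJ by (rule prob_space_normal_prod) (rule param_sd_pos)
  interpret I: prob_space ?PI by (rule prob_space_normal_prod) (rule param_sd_pos)
  have Pu: "params n (Suc l) = ?I \<union> ?J" using l by (simp add: params_Suc)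
  define out where "out = network_out n \<sigma> l X"
  define lay where "lay z \<theta> = layer_out (Suc l) (n l) (n (Suc l)) X (\<lambda>j p. \<sigma> (z j p)) \<theta>" for z :: outputs and \<theta>
  have om: "out \<in> ?PI \<rightarrow>\<^sub>M ?S"
    unfolding out_def using network_out_measurable[OF l(1)] by (simp cong: measurable_cong_sets)
  have lm: "(\<lambda>(z, \<theta>). lay z \<theta>) \<in> ?S \<Otimes>\<^sub>M ?PJ \<rightarrow>\<^sub>M ?S'"
    unfolding lay_def by (rule layer_out_activation_measurable)
  have N1: "network_law M n \<sigma> W b l X = distr ?PI ?S out"
    unfolding out_def by (rule network_law_eq[OF g]) (use l n in auto)
  interpret NL: prob_space "network_law M n \<sigma> W b l X" unfolding N1 by (rule I.prob_space_distr[OF om])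
  have cov: "gaussian_outputs (n (Suc l)) X (emp_cov (n l) \<sigma> z) = distr ?PJ ?S' (lay z)" for z
    unfolding lay_def emp_cov_eq_feature_cov using layer_out_law[of n l "n (Suc l)" X] n fin by simp
  have kern: "(\<lambda>z. gaussian_outputs (n (Suc l)) X (emp_cov (n l) \<sigma> z)) \<in> ?S \<rightarrow>\<^sub>M subprob_algebra ?S'"
    by (rule emp_cov_kernel) (use n fin in auto)
  then have kern': "(\<lambda>z. gaussian_outputs (n (Suc l)) X (emp_cov (n l) \<sigma> z))
      \<in> network_law M n \<sigma> W b l X \<rightarrow>\<^sub>M subprob_algebra ?S'"
    unfolding N1 by simp
  have mg: "network_out n \<sigma> (Suc l) X (merge ?I ?J (x, y)) = lay (out x) y" for x y
  proof -
    have "out (merge ?I ?J (x, y)) = out x"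
      unfolding out_def by (rule network_out_cong) (simp add: merge_def)
    moreover have "layer_out (Suc l) (n l) (n (Suc l)) X \<phi> (merge ?I ?J (x, y)) = layer_out (Suc l) (n l) (n (Suc l)) X \<phi> y" for \<phi>
      unfolding layer_out_def
      by (intro restrict_ext sum.cong refl)
        (use params_disjoint[of n l] in \<open>auto simp: layer_params_def merge_def\<close>)
    ultimately show ?thesis using network_out_Suc[OF l(1), of n \<sigma> X] by (simp add: lay_def out_def)
  qed
  have mm: "merge ?I ?J \<in> ?PI \<Otimes>\<^sub>M ?PJ \<rightarrow>\<^sub>M normal_prod (?I \<union> ?J) (param_sd n)" by (rule measurable_merge)
  have om': "network_out n \<sigma> (Suc l) X \<in> normal_prod (?I \<union> ?J) (param_sd n) \<rightarrow>\<^sub>M ?S'"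
    using network_out_measurable[of "Suc l" n X] unfolding Pu by (simp cong: measurable_cong_sets)
  have "network_law M n \<sigma> W b (Suc l) X = distr (normal_prod (?I \<union> ?J) (param_sd n)) ?S' (network_out n \<sigma> (Suc l) X)"
    unfolding Pu[symmetric] by (rule network_law_eq[OF g]) (use l n in auto)
  also have "\<dots> = distr (distr (?PI \<Otimes>\<^sub>M ?PJ) (normal_prod (?I \<union> ?J) (param_sd n)) (merge ?I ?J)) ?S' (network_out n \<sigma> (Suc l) X)"
    using pp.distr_merge[OF params_disjoint finite_params finite_layer_params] by simp
  also have "\<dots> = distr (?PI \<Otimes>\<^sub>M ?PJ) ?S' (\<lambda>(x, y). lay (out x) y)"
    by (subst distr_distr[OF om' mm]) (auto simp: comp_def mg intro!: distr_cong)
  finally have NS: "network_law M n \<sigma> W b (Suc l) X = distr (?PI \<Otimes>\<^sub>M ?PJ) ?S' (\<lambda>(x, y). lay (out x) y)" .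
  have lom: "(\<lambda>(x, y). lay (out x) y) \<in> ?PI \<Otimes>\<^sub>M ?PJ \<rightarrow>\<^sub>M ?S'"
    using measurable_compose[OF measurable_Pair[OF measurable_compose[OF measurable_fst om] measurable_snd] lm]
    by (simp add: case_prod_beta)
  show ?thesis unfolding mixture_def
  proof (rule measure_eqI)
    show s: "sets (network_law M n \<sigma> W b (Suc l) X) = sets (network_law M n \<sigma> W b l X \<bind> (\<lambda>z. gaussian_outputs (n (Suc l)) X (emp_cov (n l) \<sigma> z)))"
      using sets_bind[OF sets_gaussian_outputs[OF fin psd_emp_cov] NL.not_empty]
      by (simp add: network_law_def)
    fix B assume "B \<in> sets (network_law M n \<sigma> W b (Suc l) X)"
    then have B: "B \<in> sets ?S'" by (simp add: network_law_def)
    have "emeasure (network_law M n \<sigma> W b (Suc l) X) B = (\<integral>\<^sup>+w. indicator B ((\<lambda>(x, y). lay (out x) y) w) \<partial>(?PI \<Otimes>\<^sub>M ?PJ))"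
      unfolding NS using nn_integral_distr[OF lom, of "indicator B"] B by simp
    also have "\<dots> = (\<integral>\<^sup>+x. \<integral>\<^sup>+y. indicator B (lay (out x) y) \<partial>?PJ \<partial>?PI)"
      using measurable_compose[OF lom borel_measurable_indicator[OF B]]
      by (subst J.nn_integral_fst[symmetric]) auto
    also have "\<dots> = (\<integral>\<^sup>+x. emeasure (gaussian_outputs (n (Suc l)) X (emp_cov (n l) \<sigma> (out x))) B \<partial>?PI)"
    proof (rule nn_integral_cong)
      fix x assume x: "x \<in> space ?PI"
      have "out x \<in> space ?S" using om x by (rule measurable_space)
      then have "lay (out x) \<in> ?PJ \<rightarrow>\<^sub>M ?S'" using measurable_Pair2[OF lm] by simp
      then show "(\<integral>\<^sup>+y. indicator B (lay (out x) y) \<partial>?PJ) = emeasure (gaussian_outputs (n (Suc l)) X (emp_cov (n l) \<sigma> (out x))) B"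
        unfolding cov using nn_integral_distr[of "lay (out x)" ?PJ ?S' "indicator B"] B by simp
    qed
    also have "\<dots> = (\<integral>\<^sup>+z. emeasure (gaussian_outputs (n (Suc l)) X (emp_cov (n l) \<sigma> z)) B \<partial>network_law M n \<sigma> W b l X)"
      unfolding N1 by (rule nn_integral_distr[OF om, symmetric]) (use measurable_emeasure_kernel[OF kern B] in simp)
    also have "\<dots> = emeasure (network_law M n \<sigma> W b l X \<bind> (\<lambda>z. gaussian_outputs (n (Suc l)) X (emp_cov (n l) \<sigma> z))) B"
      by (rule emeasure_bind[OF NL.not_empty kern' B, symmetric])
    finally show "emeasure (network_law M n \<sigma> W b (Suc l) X) B = emeasure (network_law M n \<sigma> W b l X \<bind> (\<lambda>z. gaussian_outputs (n (Suc l)) X (emp_cov (n l) \<sigma> z))) B" .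
  qed
qed

end

section \<open>Propagation of the covariance error\<close>

text \<open>Decomposition into variance and squared bias for a mean of independent copies, around an
  arbitrary centre \<open>c\<close>: after centering \<open>h\<close>, the mixed terms integrate to
  \<open>0\<close>.\<close>

lemma PiM_sample_mean_square:
  fixes h :: "'a \<Rightarrow> real"
  assumes P: "prob_space P" and n: "n \<ge> 1" and h: "h \<in> borel_measurable P" "integrable P (\<lambda>x. (h x)\<^sup>2)"
  shows "integrable (\<Pi>\<^sub>M j\<in>{..<n}. P) (\<lambda>z. ((\<Sum>j<n. h (z j)) / real n - c)\<^sup>2)"
    and "(\<integral>z. ((\<Sum>j<n. h (z j)) / real n - c)\<^sup>2 \<partial>(\<Pi>\<^sub>M j\<in>{..<n}. P))
      \<le> (\<integral>x. (h x)\<^sup>2 \<partial>P) / real n + ((\<integral>x. h x \<partial>P) - c)\<^sup>2"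
proof -
  interpret P: prob_space P by fact
  interpret pp: product_prob_space "\<lambda>_::nat. P" UNIV by (rule product_prob_spaceI) fact
  let ?Q = "\<Pi>\<^sub>M j\<in>{..<n}. P"
  interpret Q: prob_space ?Q by (intro prob_space_PiM P)
  have ih: "integrable P h" by (rule P.square_integrable_imp_integrable[OF h])
  define \<mu> where "\<mu> = (\<integral>x. h x \<partial>P)"
  define k where "k x = h x - \<mu>" for x
  have km: "k \<in> borel_measurable P" unfolding k_def using h(1) by measurable
  have ik: "integrable P k" unfolding k_def using ih by simp
  have k0: "(\<integral>x. k x \<partial>P) = 0" unfolding k_def using ih by (simp add: \<mu>_def P.prob_space)
  have k2eq: "(k x)\<^sup>2 = (h x)\<^sup>2 - 2 * \<mu> * h x + \<mu>\<^sup>2" for x by (simp add: k_def power2_eq_square algebra_simps)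
  have ik2: "integrable P (\<lambda>x. (k x)\<^sup>2)" unfolding k2eq using ih h(2) by simp
  have "(\<integral>x. (k x)\<^sup>2 \<partial>P) = (\<integral>x. (h x)\<^sup>2 \<partial>P) - 2 * \<mu> * \<mu> + \<mu>\<^sup>2"
    unfolding k2eq using ih h(2) by (simp add: \<mu>_def P.prob_space)
  then have k2: "(\<integral>x. (k x)\<^sup>2 \<partial>P) \<le> (\<integral>x. (h x)\<^sup>2 \<partial>P)" by (simp add: power2_eq_square)
  have comp: "distr ?Q P (\<lambda>z. z a) = P" if "a < n" for a
    using that by (intro distr_PiM_component P) auto
  have cm: "(\<lambda>z. z a) \<in> ?Q \<rightarrow>\<^sub>M P" if "a < n" for a using that by (intro measurable_component_singleton) simp
  have one: "integrable ?Q (\<lambda>z. g (z a)) \<and> (\<integral>z. g (z a) \<partial>?Q) = (\<integral>x. g x \<partial>P)" if a: "a < n" and g: "integrable P g" for a and g :: "'a \<Rightarrow> real"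
    using integrable_distr_eq[OF cm[OF a], of g] integral_distr[OF cm[OF a], of g] g unfolding comp[OF a] by simp
  have cross: "integrable ?Q (\<lambda>z. k (z a) * k (z b)) \<and> (\<integral>z. k (z a) * k (z b) \<partial>?Q) = (if a = b then (\<integral>x. (k x)\<^sup>2 \<partial>P) else 0)"
    if ab: "a < n" "b < n" for a b
  proof (cases "a = b")
    case True then show ?thesis using one[OF ab(1) ik2] by (simp add: power2_eq_square)
  next
    case False
    \<comment> \<open>Padding with the constant \<open>1\<close> writes the product of two
      coordinates as a product over all of them, for which the product formula holds.\<close>
    define f where "f i = (if i \<in> {a, b} then k else (\<lambda>_. 1))" for i :: nat
    have fi: "integrable P (f i)" for i using ik by (simp add: f_def)
    have fp: "(\<Prod>i<n. f i (z i)) = k (z a) * k (z b)" for z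
    proof -
      have "(\<Prod>i<n. f i (z i)) = (\<Prod>i\<in>{a, b}. k (z i))"
        by (rule prod.mono_neutral_cong_right) (use ab in \<open>auto simp: f_def\<close>)
      then show ?thesis using False by simp
    qed
    have "(\<Prod>i<n. \<integral>x. f i x \<partial>P) = 0"
      using ab k0 by (intro prod_zero) (auto simp: f_def intro!: bexI[of _ a])
    then show ?thesis
      using pp.product_integrable_prod[of "{..<n}" f] pp.product_integral_prod[of "{..<n}" f] fi False
      by (simp add: fp)
  qed
  have sq: "(\<Sum>j<n. k (z j))\<^sup>2 = (\<Sum>a<n. \<Sum>b<n. k (z a) * k (z b))" for z
    by (simp only: power2_eq_square sum_product)
  have iS2: "integrable ?Q (\<lambda>z. (\<Sum>j<n. k (z j))\<^sup>2)"
    unfolding sq using cross by (intro Bochner_Integration.integrable_sum) auto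
  have "(\<integral>z. (\<Sum>j<n. k (z j))\<^sup>2 \<partial>?Q) = (\<Sum>a<n. \<Sum>b<n. \<integral>z. k (z a) * k (z b) \<partial>?Q)"
    unfolding sq using cross
    by (subst Bochner_Integration.integral_sum; (intro Bochner_Integration.integrable_sum sum.cong refl)?; simp add: Bochner_Integration.integral_sum)
  also have "\<dots> = (\<Sum>a<n. \<Sum>b<n. if a = b then (\<integral>x. (k x)\<^sup>2 \<partial>P) else 0)"
    using cross by (intro sum.cong refl) auto
  also have "\<dots> = real n * (\<integral>x. (k x)\<^sup>2 \<partial>P)" by simp
  finally have S2: "(\<integral>z. (\<Sum>j<n. k (z j))\<^sup>2 \<partial>?Q) = real n * (\<integral>x. (k x)\<^sup>2 \<partial>P)" .
  have iS: "integrable ?Q (\<lambda>z. \<Sum>j<n. k (z j))" and S1: "(\<integral>z. (\<Sum>j<n. k (z j)) \<partial>?Q) = 0"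
    using one[OF _ ik] k0 by (auto simp: Bochner_Integration.integral_sum)
  have eq: "((\<Sum>j<n. h (z j)) / real n - c)\<^sup>2
    = (\<Sum>j<n. k (z j))\<^sup>2 / (real n)\<^sup>2 + 2 * (\<mu> - c) / real n * (\<Sum>j<n. k (z j)) + (\<mu> - c)\<^sup>2" for z
  proof -
    have "(\<Sum>j<n. k (z j)) = (\<Sum>j<n. h (z j)) - real n * \<mu>" by (simp add: k_def sum_subtractf)
    then have "(\<Sum>j<n. h (z j)) / real n - c = (\<Sum>j<n. k (z j)) / real n + (\<mu> - c)"
      using n by (simp add: diff_divide_distrib)
    moreover have "(a / m + d)\<^sup>2 = a\<^sup>2 / m\<^sup>2 + 2 * d / m * a + d\<^sup>2" for a m d :: real
      by (simp add: power2_sum power_divide)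
    ultimately show ?thesis by (simp only:)
  qed
  show "integrable ?Q (\<lambda>z. ((\<Sum>j<n. h (z j)) / real n - c)\<^sup>2)"
    unfolding eq using iS iS2 by simp
  have "(\<integral>z. ((\<Sum>j<n. h (z j)) / real n - c)\<^sup>2 \<partial>?Q) = (\<integral>x. (k x)\<^sup>2 \<partial>P) / real n + (\<mu> - c)\<^sup>2"
  proof -
    have "real n * V / (real n)\<^sup>2 = V / real n" for V using n by (simp add: power2_eq_square)
    then show ?thesis unfolding eq using iS iS2 by (simp add: S1 S2 Q.prob_space)
  qed
  also have "\<dots> \<le> (\<integral>x. (h x)\<^sup>2 \<partial>P) / real n + (\<mu> - c)\<^sup>2"
    using k2 by (intro add_right_mono divide_right_mono) auto
  finally show "(\<integral>z. ((\<Sum>j<n. h (z j)) / real n - c)\<^sup>2 \<partial>?Q)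
      \<le> (\<integral>x. (h x)\<^sup>2 \<partial>P) / real n + ((\<integral>x. h x \<partial>P) - c)\<^sup>2" by (simp add: \<mu>_def)
qed

lemma cov_mixture_mono: "cov_mixture X n K e N A \<Longrightarrow> e \<le> e' \<Longrightarrow> cov_mixture X n K e' N A"
  unfolding cov_mixture_def by (meson order_trans)

context lipschitz_activation
begin

text \<open>Given the covariance \<open>A z\<close>, the rows of the layer are independent, and the
  product of activations at \<open>p\<close>, \<open>q\<close> has mean
  \<open>\<psi> (A z) p q\<close> in each of them. For the bias, \<open>\<psi>\<close> is expanded
  at \<open>K\<close> and averaged. The mean square is a sampling error of order
  \<open>1 / n\<close> plus the square of \<open>\<psi> (A z) p q - \<psi> K p q\<close>, which the
  Lipschitz estimate bounds. The bound \<open>emax\<close> on \<open>e\<close> keeps the second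
  moments of \<open>A z\<close> bounded.\<close>

lemma cov_mixture_step:
  assumes fin: "finite X" and psd: "psd_on X K" and emax: "emax \<ge> 0"
  obtains C where "C \<ge> 0"
    and "\<And>n m e N A. n \<ge> 1 \<Longrightarrow> m \<ge> 1 \<Longrightarrow> 0 \<le> e \<Longrightarrow> e \<le> emax \<Longrightarrow> cov_mixture X n K e N A \<Longrightarrow>
      cov_mixture X m (next_cov \<sigma> X K) (C * (e + 1 / real n)) (mixture X n N A) (emp_cov n \<sigma>)"
proof -
  obtain r :: nat and w u where K: "\<forall>p\<in>X. \<forall>q\<in>X. K p q = (\<Sum>i<r. w i p * w i q)"
    and u: "\<forall>i<r. \<forall>j<r. (\<Sum>p\<in>X. u i p * w j p) = (if i = j then 1 else 0)"
    using psd_on_factorization[OF fin psd] by (elim exE conjE)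
  \<comment> \<open>The expansion is taken for a single row, since \<open>\<psi>\<close> only
    involves the law of one row; this keeps \<open>C1\<close> independent of the width
    \<open>n\<close>.\<close>
  obtain C1 where C1: "C1 \<ge> 0"
    and expan: "\<And>f. f \<in> borel_measurable (output_space 1 X) \<Longrightarrow>
      (\<And>z. z \<in> space (output_space 1 X) \<Longrightarrow> \<bar>f z\<bar> \<le> 1 + normsq 1 X z) \<Longrightarrow>
      \<exists>l. first_order_at X K C1 (\<lambda>A. \<integral>z. f z \<partial>gaussian_outputs 1 X A) l"
    using gaussian_outputs_expansion[OF fin psd order_refl] by blast
  \<comment> \<open>The factor \<open>2\<close> allows for the two squares in the growth bound, each
    of which is at most \<open>normsq\<close>.\<close>
  define G where "G = 2 * growth"
  have G: "G > 0" using growth_pos by (simp add: G_def)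
  define card4 where "card4 = real (card X) ^ 4"
  define Kb where "Kb = (\<Sum>p\<in>X. (K p p)\<^sup>2)"
  \<comment> \<open>The fourth moments contribute \<open>3\<close> times the squares of two diagonal
    entries of \<open>A z\<close>, and the mean of each square is at most
    \<open>2 * emax + 2 * Kb\<close>; this gives the factors \<open>12\<close>.\<close>
  define C2 where "C2 = 3 * growth\<^sup>2 * (1 + 12 * emax + 12 * Kb)"
  define C3 where "C3 = G\<^sup>2 * C1\<^sup>2 * card4"
  define C4 where "C4 = G * (2 * C1 * card4)"
  have nn: "0 \<le> C2" "0 \<le> C3" "0 \<le> C4"
    using emax C1 G by (auto simp: C2_def C3_def C4_def Kb_def card4_def sum_nonneg)
  have main: "cov_mixture X m (next_cov \<sigma> X K) ((C2 + C3 + C4) * (e + 1 / real n)) (mixture X n N A) (emp_cov n \<sigma>)"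
    if n: "n \<ge> 1" and m: "m \<ge> 1" and e: "0 \<le> e" "e \<le> emax" and mix: "cov_mixture X n K e N A" for n m e N A
  proof -
    note pm = prob_space_mixture[OF fin mix] and sm = sets_mixture[OF fin mix]
      and ie = mix_entry[OF fin mix] and psdA = mix_psd[OF fin mix] and ker = mix_kernel[OF fin mix]
    interpret N: prob_space N using mix by (simp add: cov_mixture_def)
    interpret mu: prob_space "mixture X n N A" by (rule pm)
    define \<psi> where "\<psi> B p q = (\<integral>g. \<sigma> (g p) * \<sigma> (g q) \<partial>centered_gaussian X B)" for B p q
    have hm: "(\<lambda>g. \<sigma> (g p) * \<sigma> (g q)) \<in> borel_measurable (\<Pi>\<^sub>M p\<in>X. borel)" if "p \<in> X" "q \<in> X" for p q
      using that by measurable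
    have zm: "(\<lambda>z. \<sigma> (z j p) * \<sigma> (z j q)) \<in> borel_measurable (output_space k X)" if "j < k" "p \<in> X" "q \<in> X" for j k p q
      using that by (intro borel_measurable_times measurable_compose[OF output_space_component activation_measurable])
    have zb: "\<bar>\<sigma> (z j p) * \<sigma> (z j q) / G\<bar> \<le> 1 + normsq k X z" if "j < k" "p \<in> X" "q \<in> X" for j k p q z
    proof -
      have s: "(z j p)\<^sup>2 \<le> normsq k X z" if "p \<in> X" for p
      proof -
        have "(z j p)\<^sup>2 \<le> (\<Sum>p\<in>X. (z j p)\<^sup>2)" using fin that by (intro member_le_sum) auto
        also have "\<dots> \<le> normsq k X z" unfolding normsq_def
          using \<open>j < k\<close> by (intro member_le_sum[where f="\<lambda>j. \<Sum>p\<in>X. (z j p)\<^sup>2"]) (auto intro: sum_nonneg)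
        finally show ?thesis .
      qed
      have "\<bar>\<sigma> (z j p) * \<sigma> (z j q)\<bar> \<le> growth * (1 + (z j p)\<^sup>2 + (z j q)\<^sup>2)" by (rule activation_prod)
      also have "\<dots> \<le> growth * (2 * (1 + normsq k X z))"
        using s[OF that(2)] s[OF that(3)] growth_pos by (intro mult_left_mono) auto
      also have "\<dots> = G * (1 + normsq k X z)" by (simp add: G_def)
      finally show ?thesis using G by (simp add: abs_divide pos_divide_le_eq mult.commute)
    qed
    have row: "(\<integral>z. \<sigma> (z j p) * \<sigma> (z j q) / G \<partial>gaussian_outputs k X B) = \<psi> B p q / G"
      if "j < k" "p \<in> X" "q \<in> X" "psd_on X B" for j k p q B
      using integral_gaussian_outputs_component(1)[OF fin that(4,1) hm[OF that(2,3)]] by (simp add: \<psi>_def)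
    have \<psi>N: "(\<lambda>z. \<psi> (A z) p q / G) \<in> borel_measurable N"
      and rowmu: "integrable (mixture X n N A) (\<lambda>z. \<sigma> (z j p) * \<sigma> (z j q) / G)"
        "(\<integral>z. \<sigma> (z j p) * \<sigma> (z j q) / G \<partial>mixture X n N A) = (\<integral>z. \<psi> (A z) p q / G \<partial>N)"
      if pq: "p \<in> X" "q \<in> X" and j: "j < n" for p q j
    proof -
      have fm: "(\<lambda>z. \<sigma> (z j p) * \<sigma> (z j q) / G) \<in> borel_measurable (output_space n X)"
        using zm[OF j pq] by measurable
      note im = integral_mixture[OF fin mix fm zb[OF j pq]]
      show "(\<lambda>z. \<psi> (A z) p q / G) \<in> borel_measurable N"
        using borel_measurable_integrable[OF im(2)] unfolding row[OF j pq psdA] .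
      show "integrable (mixture X n N A) (\<lambda>z. \<sigma> (z j p) * \<sigma> (z j q) / G)" by (rule im(1))
      show "(\<integral>z. \<sigma> (z j p) * \<sigma> (z j q) / G \<partial>mixture X n N A) = (\<integral>z. \<psi> (A z) p q / G \<partial>N)"
        using im(3) unfolding row[OF j pq psdA] .
    qed
    have ex: "\<exists>l. first_order_at X K C1 (\<lambda>B. \<psi> B p q / G) l" if pq: "p \<in> X" "q \<in> X" for p q
    proof -
      have fm: "(\<lambda>z. \<sigma> (z 0 p) * \<sigma> (z 0 q) / G) \<in> borel_measurable (output_space 1 X)"
        using zm[of 0 1, OF _ pq] by measurable
      have r: "(\<integral>z. \<sigma> (z 0 p) * \<sigma> (z 0 q) / G \<partial>gaussian_outputs 1 X B) = \<psi> B p q / G" if "cov_below X K B" for B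
        using row[of 0 1, OF _ pq] that by (simp only: cov_below_def zero_less_one)
      obtain l where l: "first_order_at X K C1 (\<lambda>B. \<integral>z. \<sigma> (z 0 p) * \<sigma> (z 0 q) / G \<partial>gaussian_outputs 1 X B) l"
        using expan[OF fm zb[OF zero_less_one pq]] by blast
      have "first_order_at X K C1 (\<lambda>B. \<psi> B p q / G) l"
        by (rule first_order_at_cong[OF psd _ l]) (rule r)
      then show ?thesis by blast
    qed
    have bias: "\<bar>\<integral>z. emp_cov n \<sigma> z p q - next_cov \<sigma> X K p q \<partial>mixture X n N A\<bar> \<le> C4 * e" if pq: "p \<in> X" "q \<in> X" for p q
    proof -
      obtain l where l: "first_order_at X K C1 (\<lambda>B. \<psi> B p q / G) l" using ex[OF pq] by blast
      have *: "\<bar>(\<integral>z. \<psi> (A z) p q / G \<partial>N) - \<psi> K p q / G\<bar> \<le> 2 * C1 * card4 * e"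
        using integral_first_order[OF fin mix \<psi>N[OF pq, of 0] C1 l] n by (simp add: card4_def)
      have eq: "emp_cov n \<sigma> z p q - next_cov \<sigma> X K p q = G / real n * (\<Sum>j<n. \<sigma> (z j p) * \<sigma> (z j q) / G) - \<psi> K p q" for z
        using G by (simp add: emp_cov_def next_cov_def \<psi>_def flip: sum_divide_distrib)
      have "(\<integral>z. emp_cov n \<sigma> z p q - next_cov \<sigma> X K p q \<partial>mixture X n N A)
        = G / real n * (\<Sum>j<n. \<integral>z. \<sigma> (z j p) * \<sigma> (z j q) / G \<partial>mixture X n N A) - \<psi> K p q"
      proof -
        have "(\<integral>z. (\<Sum>j<n. \<sigma> (z j p) * \<sigma> (z j q) / G) \<partial>mixture X n N A) = (\<Sum>j<n. \<integral>z. \<sigma> (z j p) * \<sigma> (z j q) / G \<partial>mixture X n N A)"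
          by (rule Bochner_Integration.integral_sum) (use rowmu(1)[OF pq] in simp)
        moreover have "integrable (mixture X n N A) (\<lambda>z. \<Sum>j<n. \<sigma> (z j p) * \<sigma> (z j q) / G)"
          by (rule Bochner_Integration.integrable_sum) (use rowmu(1)[OF pq] in simp)
        ultimately show ?thesis unfolding eq
          by (subst Bochner_Integration.integral_diff) (auto simp only: integral_mult_right_zero integrable_mult_right
            lebesgue_integral_const mu.prob_space mu.integrable_const real_scaleR_def mult_1_left intro!: integrable_mult_right)
      qed
      also have "\<dots> = G / real n * (\<Sum>j<n. \<integral>z. \<psi> (A z) p q / G \<partial>N) - \<psi> K p q"
      proof -
        have "(\<Sum>j<n. \<integral>z. \<sigma> (z j p) * \<sigma> (z j q) / G \<partial>mixture X n N A) = (\<Sum>j<n. \<integral>z. \<psi> (A z) p q / G \<partial>N)"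
          by (rule sum.cong[OF refl]) (simp only: lessThan_iff rowmu(2)[OF pq])
        then show ?thesis by (simp only:)
      qed
      also have "\<dots> = G * ((\<integral>z. \<psi> (A z) p q / G \<partial>N) - \<psi> K p q / G)"
        using n G by (simp add: right_diff_distrib)
      finally have "\<bar>\<integral>z. emp_cov n \<sigma> z p q - next_cov \<sigma> X K p q \<partial>mixture X n N A\<bar>
        = G * \<bar>(\<integral>z. \<psi> (A z) p q / G \<partial>N) - \<psi> K p q / G\<bar>" using G by (simp only: abs_mult abs_of_pos)
      also have "\<dots> \<le> G * (2 * C1 * card4 * e)" using * G by (intro mult_left_mono) auto
      finally show ?thesis by (simp add: C4_def mult.assoc)
    qed
    have var: "integrable (mixture X n N A) (\<lambda>z. (emp_cov n \<sigma> z p q - next_cov \<sigma> X K p q)\<^sup>2) \<and>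
      (\<integral>z. (emp_cov n \<sigma> z p q - next_cov \<sigma> X K p q)\<^sup>2 \<partial>mixture X n N A) \<le> C2 * (1 / real n) + C3 * e"
      if pq: "p \<in> X" "q \<in> X" for p q
    proof -
      define f where "f z = (emp_cov n \<sigma> z p q - next_cov \<sigma> X K p q)\<^sup>2" for z
      have em: "(\<lambda>z. emp_cov n \<sigma> z p q) \<in> borel_measurable (output_space n X)"
        unfolding emp_cov_def using zm[OF _ pq, of _ n]
        by (intro borel_measurable_add borel_measurable_const borel_measurable_divide borel_measurable_sum) auto
      have fm: "f \<in> borel_measurable (output_space n X)"
        unfolding f_def using em by measurable
      have feq: "f z = ((\<Sum>j<n. \<sigma> (z j p) * \<sigma> (z j q)) / real n - \<psi> K p q)\<^sup>2" for z
        by (simp add: f_def emp_cov_def next_cov_def \<psi>_def)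
      \<comment> \<open>Conditional mean square given \<open>z\<close>: sampling error and squared
        deviation of the conditional mean, for those \<open>z\<close> with
        \<open>cov_below X K (A z)\<close>.\<close>
      define bd where "bd z = 3 * growth\<^sup>2 * (1 + 3 * (A z p p)\<^sup>2 + 3 * (A z q q)\<^sup>2) / real n + G\<^sup>2 * C1\<^sup>2 * (cov_dist X (A z) K)\<^sup>2" for z
      have Asq: "integrable N (\<lambda>z. (A z p p)\<^sup>2) \<and> (\<integral>z. (A z p p)\<^sup>2 \<partial>N) \<le> 2 * emax + 2 * Kb" if p: "p \<in> X" for p
      proof -
        have eq: "(A z p p)\<^sup>2 = (A z p p - K p p)\<^sup>2 + 2 * K p p * (A z p p - K p p) + (K p p)\<^sup>2" for z
          by (simp add: power2_eq_square algebra_simps)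
        have i: "integrable N (\<lambda>z. (A z p p)\<^sup>2)"
          unfolding eq using ie(2)[OF p p] ie(5)[OF p p] by simp
        have "(\<integral>z. (A z p p)\<^sup>2 \<partial>N) \<le> (\<integral>z. 2 * (A z p p - K p p)\<^sup>2 + 2 * (K p p)\<^sup>2 \<partial>N)"
        proof (rule integral_mono[OF i])
          show "integrable N (\<lambda>z. 2 * (A z p p - K p p)\<^sup>2 + 2 * (K p p)\<^sup>2)" using ie(2)[OF p p] by simp
          have "a\<^sup>2 \<le> 2 * (a - c)\<^sup>2 + 2 * c\<^sup>2" for a c :: real
            using zero_le_power2[of "a - 2 * c"] by (simp add: power2_eq_square algebra_simps)
          then show "(A z p p)\<^sup>2 \<le> 2 * (A z p p - K p p)\<^sup>2 + 2 * (K p p)\<^sup>2" for z .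
        qed
        also have "\<dots> = 2 * (\<integral>z. (A z p p - K p p)\<^sup>2 \<partial>N) + 2 * (K p p)\<^sup>2"
          using ie(2)[OF p p] by (simp add: N.prob_space)
        also have "\<dots> \<le> 2 * emax + 2 * Kb"
        proof -
          have "(K p p)\<^sup>2 \<le> Kb" unfolding Kb_def using fin p by (intro member_le_sum) auto
          then show ?thesis using ie(3)[OF p p] e by simp
        qed
        finally show ?thesis using i by blast
      qed
      have ibd: "integrable N bd"
        unfolding bd_def using Asq[OF pq(1)] Asq[OF pq(2)] integral_cov_dist_sq(1)[OF fin mix] by simp
      have bd0: "0 \<le> bd z" for z by (simp add: bd_def)
      have inner: "integrable (gaussian_outputs n X (A z)) f \<and>
        (\<integral>y. f y \<partial>gaussian_outputs n X (A z)) \<le> bd z" if B: "cov_below X K (A z)" for z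
      proof -
        let ?P = "centered_gaussian X (A z)"
        have hm': "(\<lambda>g. \<sigma> (g p) * \<sigma> (g q)) \<in> borel_measurable ?P"
          using hm[OF pq] by (simp add: sets_centered_gaussian[OF fin psdA] cong: measurable_cong_sets)
        note ms = PiM_sample_mean_square[OF prob_space_centered_gaussian[OF fin psdA] n hm' integrable_activation_prod(2)[OF fin psdA pq], of "\<psi> K p q"]
        have "(\<psi> (A z) p q - \<psi> K p q)\<^sup>2 \<le> G\<^sup>2 * C1\<^sup>2 * (cov_dist X (A z) K)\<^sup>2"
        proof -
          have "\<bar>\<psi> (A z) p q / G - \<psi> K p q / G\<bar> \<le> C1 * cov_dist X (A z) K"
            using ex[OF pq] B by (auto simp: first_order_at_def)
          then have "\<bar>\<psi> (A z) p q - \<psi> K p q\<bar> \<le> G * (C1 * cov_dist X (A z) K)"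
            using G by (simp add: abs_divide pos_divide_le_eq mult.commute flip: diff_divide_distrib)
          then have "(\<psi> (A z) p q - \<psi> K p q)\<^sup>2 \<le> (G * (C1 * cov_dist X (A z) K))\<^sup>2"
            by (metis abs_ge_zero power2_abs power_mono)
          then show ?thesis by (simp add: power_mult_distrib)
        qed
        moreover have "(\<integral>g. (\<sigma> (g p) * \<sigma> (g q))\<^sup>2 \<partial>?P) / real n \<le> 3 * growth\<^sup>2 * (1 + 3 * (A z p p)\<^sup>2 + 3 * (A z q q)\<^sup>2) / real n"
          using integrable_activation_prod(3)[OF fin psdA pq] by (intro divide_right_mono) auto
        ultimately show ?thesis using ms unfolding feq bd_def \<psi>_def[symmetric] by auto
      qed
      have nnb: "(\<integral>\<^sup>+y. ennreal \<bar>f y\<bar> \<partial>gaussian_outputs n X (A z)) \<le> ennreal (bd z)" if "cov_below X K (A z)" for z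
      proof -
        have "(\<integral>\<^sup>+y. ennreal \<bar>f y\<bar> \<partial>gaussian_outputs n X (A z)) = ennreal (\<integral>y. f y \<partial>gaussian_outputs n X (A z))"
          using inner[OF that] by (subst nn_integral_eq_integral[symmetric]) (auto simp: f_def)
        then show ?thesis using inner[OF that] by (simp add: ennreal_leI)
      qed
      have "(\<integral>\<^sup>+z. \<integral>\<^sup>+y. ennreal \<bar>f y\<bar> \<partial>gaussian_outputs n X (A z) \<partial>N) \<le> (\<integral>\<^sup>+z. ennreal (bd z) \<partial>N)"
        by (rule nn_integral_mono_AE, rule AE_mp[OF mix_below[OF fin mix]]) (intro AE_I2 impI nnb)
      also have "\<dots> = ennreal (\<integral>z. bd z \<partial>N)" using ibd bd0 by (intro nn_integral_eq_integral) auto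
      also have "\<dots> < \<infinity>" by simp
      finally have fini: "(\<integral>\<^sup>+z. \<integral>\<^sup>+y. ennreal \<bar>f y\<bar> \<partial>gaussian_outputs n X (A z) \<partial>N) < \<infinity>" .
      note ib = integral_bind_prob[OF N.prob_space_axioms ker fm fini, folded mixture_def]
      have "(\<integral>z. f z \<partial>mixture X n N A) \<le> (\<integral>z. bd z \<partial>N)"
        unfolding ib(3) using mix_below[OF fin mix] inner
        by (intro integral_mono_AE ib(2) ibd) (auto elim!: AE_mp)
      also have "\<dots> = 3 * growth\<^sup>2 * (1 + 3 * (\<integral>z. (A z p p)\<^sup>2 \<partial>N) + 3 * (\<integral>z. (A z q q)\<^sup>2 \<partial>N)) / real n
         + G\<^sup>2 * C1\<^sup>2 * (\<integral>z. (cov_dist X (A z) K)\<^sup>2 \<partial>N)"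
        unfolding bd_def using Asq[OF pq(1)] Asq[OF pq(2)] integral_cov_dist_sq(1)[OF fin mix]
        by (simp add: N.prob_space)
      also have "\<dots> \<le> C2 / real n + C3 * e"
      proof (rule add_mono)
        have "1 + 3 * (\<integral>z. (A z p p)\<^sup>2 \<partial>N) + 3 * (\<integral>z. (A z q q)\<^sup>2 \<partial>N) \<le> 1 + 12 * emax + 12 * Kb"
          using Asq[OF pq(1)] Asq[OF pq(2)] by linarith
        then show "3 * growth\<^sup>2 * (1 + 3 * (\<integral>z. (A z p p)\<^sup>2 \<partial>N) + 3 * (\<integral>z. (A z q q)\<^sup>2 \<partial>N)) / real n \<le> C2 / real n"
          unfolding C2_def by (intro divide_right_mono mult_left_mono) auto
        have "G\<^sup>2 * C1\<^sup>2 * (\<integral>z. (cov_dist X (A z) K)\<^sup>2 \<partial>N) \<le> G\<^sup>2 * C1\<^sup>2 * (card4 * e)"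
          unfolding card4_def by (intro mult_left_mono integral_cov_dist_sq(2)[OF fin mix]) auto
        then show "G\<^sup>2 * C1\<^sup>2 * (\<integral>z. (cov_dist X (A z) K)\<^sup>2 \<partial>N) \<le> C3 * e" by (simp add: C3_def mult.assoc)
      qed
      finally show ?thesis using ib(1) by (simp add: f_def[abs_def])
    qed
    have below: "AE z in mixture X n N A. cov_below X (next_cov \<sigma> X K) (emp_cov n \<sigma> z)"
    proof -
      \<comment> \<open>The rows lie in the support of the limit law. Unlike the null-space
        condition itself, this is a finite conjunction of linear equations, hence visibly a
        measurable predicate, as the transfer through the kernel requires.\<close>
      define R where "R z \<longleftrightarrow> (\<forall>j\<in>{..<n}. \<forall>p\<in>X. z j p = (\<Sum>i<r. w i p * (\<Sum>q\<in>X. u i q * z j q)))" for z :: outputs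
      have Rm: "Measurable.pred (output_space n X) R"
      proof -
        have a: "(\<lambda>z. \<Sum>i<r. w i p * (\<Sum>q\<in>X. u i q * z j q)) \<in> borel_measurable (output_space n X)" if "j < n" for j p
          using that by (intro borel_measurable_sum borel_measurable_times borel_measurable_const output_space_component)
        have "Measurable.pred (output_space n X) (\<lambda>z. z j p = (\<Sum>i<r. w i p * (\<Sum>q\<in>X. u i q * z j q)))" if "j < n" "p \<in> X" for j p
          unfolding pred_def by (rule borel_measurable_eq[OF output_space_component[OF that] a[OF that(1)]])
        then show ?thesis unfolding R_def using fin by (intro pred_intros_finite) auto
      qed
      have "AE z in N. AE y in gaussian_outputs n X (A z). R y"
      proof (rule AE_mp[OF mix_below[OF fin mix]], rule AE_I2, rule impI)
        fix z assume B: "cov_below X K (A z)"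
        have "AE y in gaussian_outputs n X (A z). y j p = (\<Sum>i<r. w i p * (\<Sum>q\<in>X. u i q * y j q))"
          if j: "j < n" and p: "p \<in> X" for j p
        proof -
          have mj: "(\<lambda>y. y j) \<in> gaussian_outputs n X (A z) \<rightarrow>\<^sub>M centered_gaussian X (A z)"
            using j by (intro measurable_component_singleton) simp
          have "AE g in distr (gaussian_outputs n X (A z)) (centered_gaussian X (A z)) (\<lambda>y. y j). g p = (\<Sum>i<r. w i p * (\<Sum>q\<in>X. u i q * g q))"
            unfolding distr_gaussian_outputs_component[OF fin psdA j]
            by (rule centered_gaussian_support[OF fin B K u p])
          then show ?thesis by (rule AE_distrD[OF mj])
        qed
        then show "AE y in gaussian_outputs n X (A z). R y"
          unfolding R_def using fin by (intro AE_finite_allI) auto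
      qed
      then have "AE z in mixture X n N A. R z"
        unfolding mixture_def by (subst AE_bind[OF ker Rm])
      then show ?thesis
      proof (rule AE_mp, intro AE_I2 impI)
        fix z assume "R z"
        then show "cov_below X (next_cov \<sigma> X K) (emp_cov n \<sigma> z)"
          by (intro emp_cov_cov_below[OF fin psd K, where y="\<lambda>j i. \<Sum>q\<in>X. u i q * z j q"]) (auto simp: R_def)
      qed
    qed
    have le1: "C4 * e \<le> (C2 + C3 + C4) * (e + 1 / real n)"
      using nn e by (intro mult_mono) auto
    have le2: "C2 * (1 / real n) + C3 * e \<le> (C2 + C3 + C4) * (e + 1 / real n)"
    proof -
      have "C2 * (1 / real n) \<le> C2 * (e + 1 / real n)" "C3 * e \<le> C3 * (e + 1 / real n)" "0 \<le> C4 * (e + 1 / real n)"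
        by (intro mult_left_mono mult_nonneg_nonneg nn; use e in simp)+
      then show ?thesis by (simp only: distrib_right)
    qed
    show ?thesis unfolding cov_mixture_def
    proof (intro conjI allI ballI pm below psd_emp_cov)
      show "(\<lambda>z. gaussian_outputs m X (emp_cov n \<sigma> z)) \<in> mixture X n N A \<rightarrow>\<^sub>M subprob_algebra (output_space m X)"
        using emp_cov_kernel[OF n m fin] by (simp add: measurable_cong_sets[OF sm refl])
      fix p q assume pq: "p \<in> X" "q \<in> X"
      have "(\<lambda>z. emp_cov n \<sigma> z p q) \<in> borel_measurable (output_space n X)"
        unfolding emp_cov_def using zm[OF _ pq, of _ n]
        by (intro borel_measurable_add borel_measurable_const borel_measurable_divide borel_measurable_sum) auto
      then show "(\<lambda>z. emp_cov n \<sigma> z p q) \<in> borel_measurable (mixture X n N A)"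
        by (simp add: measurable_cong_sets[OF sm refl])
      show "integrable (mixture X n N A) (\<lambda>z. (emp_cov n \<sigma> z p q - next_cov \<sigma> X K p q)\<^sup>2)"
        using var[OF pq] by blast
      show "(\<integral>z. (emp_cov n \<sigma> z p q - next_cov \<sigma> X K p q)\<^sup>2 \<partial>mixture X n N A) \<le> (C2 + C3 + C4) * (e + 1 / real n)"
        using var[OF pq] le2 by linarith
      show "\<bar>\<integral>z. emp_cov n \<sigma> z p q - next_cov \<sigma> X K p q \<partial>mixture X n N A\<bar> \<le> (C2 + C3 + C4) * (e + 1 / real n)"
        using bias[OF pq] le1 by linarith
    qed
  qed
  have "0 \<le> C2 + C3 + C4" using nn by simp
  from that[OF this main] show ?thesis by blast
qed

end

section \<open>Convergence rate\<close>

lemma limit_cov_Suc: "l \<ge> 1 \<Longrightarrow> limit_cov n\<^sub>0 \<sigma> X (Suc l) = next_cov \<sigma> X (limit_cov n\<^sub>0 \<sigma> X l)"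
  by (cases l) (simp_all add: fun_eq_iff next_cov_def)

context lipschitz_activation
begin

lemma psd_limit_cov:
  assumes fin: "finite X" and l: "l \<ge> 1"
  shows "psd_on X (limit_cov n\<^sub>0 \<sigma> X l)"
  using l
proof (induction l rule: dec_induct)
  case base
  have "limit_cov n\<^sub>0 \<sigma> X 1 = feature_cov n\<^sub>0 (\<lambda>j p. p j)"
    by (simp add: fun_eq_iff feature_cov_def)
  then show ?case using psd_feature_cov by metis
next
  case (step l)
  then show ?case using psd_next_cov[OF fin step.IH] by (simp add: limit_cov_Suc)
qed

text \<open>The constant is quantified before the widths and the probability space; it may depend on
  the limit covariances, which only involve the input dimension, the activation and the
  data.\<close>

lemma network_law_cov_mixture:
  fixes X :: "vec set"
  assumes fin: "finite X" and l: "l \<ge> 1"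
  shows "\<exists>C\<ge>0. \<forall>n (M :: 'w measure) W b L. gaussian_params M n L W b \<longrightarrow> n 0 = n\<^sub>0 \<longrightarrow> l \<le> L \<longrightarrow>
    (\<forall>i\<le>l. n i \<ge> 1) \<longrightarrow> (\<exists>N A. cov_mixture X (n l) (limit_cov n\<^sub>0 \<sigma> X l) (C * (\<Sum>i=1..<l. 1 / real (n i))) N A \<and>
      network_law M n \<sigma> W b l X = mixture X (n l) N A)"
  using l
proof (induction l rule: dec_induct)
  case base
  show ?case
  proof (intro exI[of _ 0] conjI allI impI)
    fix n and M :: "'w measure" and W b L
    assume g: "gaussian_params M n L W b" and n0: "n 0 = n\<^sub>0" and L: "1 \<le> L" and n: "\<forall>i\<le>1. n i \<ge> 1"
    let ?K = "limit_cov n\<^sub>0 \<sigma> X 1"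
    have psd: "psd_on X ?K" by (rule psd_limit_cov[OF fin order_refl])
    interpret N: prob_space "gaussian_outputs (n 1) X ?K" by (rule prob_space_gaussian_outputs[OF fin psd])
    have sub: "subprob_space (gaussian_outputs (n 1) X ?K)"
      by (rule prob_space_imp_subprob_space) (rule N.prob_space_axioms)
    have "gaussian_outputs (n 1) X ?K \<in> space (subprob_algebra (output_space (n 1) X))"
      unfolding space_subprob_algebra by (intro CollectI conjI sub sets_gaussian_outputs[OF fin psd])
    \<comment> \<open>The first layer is exactly Gaussian, so the error is \<open>0\<close> and the
      kernel constant. A mixing law on outputs still has to be named; the layer's own law
      serves.\<close>
    then have "cov_mixture X (n 1) ?K (0 * (\<Sum>i=1..<1. 1 / real (n i))) (gaussian_outputs (n 1) X ?K) (\<lambda>_. ?K)"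
      using psd N.prob_space_axioms by (simp add: cov_mixture_def cov_below_refl)
    moreover have "network_law M n \<sigma> W b 1 X = gaussian_outputs (n 1) X ?K"
      unfolding n0[symmetric] using n by (intro network_law_1[OF g L _ _ fin]) auto
    then have "network_law M n \<sigma> W b 1 X = mixture X (n 1) (gaussian_outputs (n 1) X ?K) (\<lambda>_. ?K)"
      unfolding mixture_def bind_const'[OF N.prob_space_axioms sub] .
    ultimately show "\<exists>N A. cov_mixture X (n 1) ?K (0 * (\<Sum>i=1..<1. 1 / real (n i))) N A \<and>
      network_law M n \<sigma> W b 1 X = mixture X (n 1) N A" by blast
  qed simp
next
  case (step l)
  then have l: "l \<ge> 1" by simp
  obtain C where C: "C \<ge> 0" and IH: "\<And>n (M :: 'w measure) W b L. gaussian_params M n L W b \<Longrightarrow> n 0 = n\<^sub>0 \<Longrightarrow> l \<le> L \<Longrightarrow>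
    \<forall>i\<le>l. n i \<ge> 1 \<Longrightarrow> \<exists>N A. cov_mixture X (n l) (limit_cov n\<^sub>0 \<sigma> X l) (C * (\<Sum>i=1..<l. 1 / real (n i))) N A \<and>
      network_law M n \<sigma> W b l X = mixture X (n l) N A"
    using step.IH by blast
  have psd: "psd_on X (limit_cov n\<^sub>0 \<sigma> X l)" by (rule psd_limit_cov[OF fin l])
  \<comment> \<open>Each \<open>1 / n i\<close> is at most \<open>1\<close>, so the error before the
    step is at most \<open>C * real l\<close> whatever the widths.\<close>
  have emax: "0 \<le> C * real l" using C by simp
  obtain C' where C': "C' \<ge> 0" and st: "\<And>n m e N A. n \<ge> 1 \<Longrightarrow> m \<ge> 1 \<Longrightarrow> 0 \<le> e \<Longrightarrow> e \<le> C * real l \<Longrightarrow>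
      cov_mixture X n (limit_cov n\<^sub>0 \<sigma> X l) e N A \<Longrightarrow>
      cov_mixture X m (next_cov \<sigma> X (limit_cov n\<^sub>0 \<sigma> X l)) (C' * (e + 1 / real n)) (mixture X n N A) (emp_cov n \<sigma>)"
    using cov_mixture_step[OF fin psd emax] by blast
  show ?case
  \<comment> \<open>The step turns \<open>C * s\<close> into \<open>C' * (C * s + 1 / n l)\<close>;
    the factor \<open>C + 1\<close> dominates both the coefficient \<open>C\<close> of the old sum
    and the coefficient \<open>1\<close> of the new term.\<close>
  proof (intro exI[of _ "C' * (C + 1)"] conjI allI impI)
    show "0 \<le> C' * (C + 1)" using C C' by simp
    fix n and M :: "'w measure" and W b L
    assume g: "gaussian_params M n L W b" and n0: "n 0 = n\<^sub>0" and L: "Suc l \<le> L" and n: "\<forall>i\<le>Suc l. n i \<ge> 1"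
    define s where "s = (\<Sum>i=1..<l. 1 / real (n i))"
    have s0: "s \<ge> 0" by (simp add: s_def sum_nonneg)
    have inv: "1 / real k \<le> 1" if "k \<ge> 1" for k using that by simp
    have "s \<le> (\<Sum>i=1..<l. 1)" unfolding s_def by (intro sum_mono inv) (use n in auto)
    also have "\<dots> \<le> real l" by simp
    finally have sl: "s \<le> real l" .
    obtain N A where mix: "cov_mixture X (n l) (limit_cov n\<^sub>0 \<sigma> X l) (C * s) N A"
      and law: "network_law M n \<sigma> W b l X = mixture X (n l) N A"
      using IH[OF g n0] L n unfolding s_def by auto
    have "cov_mixture X (n (Suc l)) (limit_cov n\<^sub>0 \<sigma> X (Suc l)) (C' * (C * s + 1 / real (n l))) (mixture X (n l) N A) (emp_cov (n l) \<sigma>)"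
      unfolding limit_cov_Suc[OF l] using n C s0 sl by (intro st mix) (auto intro!: mult_left_mono)
    moreover have "C' * (C * s + 1 / real (n l)) \<le> C' * (C + 1) * (\<Sum>i=1..<Suc l. 1 / real (n i))"
    proof -
      have "C * s + t \<le> (C + 1) * (s + t)" if "0 \<le> t" for t
        using C s0 mult_nonneg_nonneg[OF C that] by (simp add: algebra_simps)
      from this[of "1 / real (n l)"] have "C * s + 1 / real (n l) \<le> (C + 1) * (s + 1 / real (n l))" by simp
      then show ?thesis using C' l by (simp add: mult.assoc mult_left_mono s_def)
    qed
    ultimately have "cov_mixture X (n (Suc l)) (limit_cov n\<^sub>0 \<sigma> X (Suc l)) (C' * (C + 1) * (\<Sum>i=1..<Suc l. 1 / real (n i)))
        (mixture X (n l) N A) (emp_cov (n l) \<sigma>)" by (rule cov_mixture_mono)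
    moreover have "network_law M n \<sigma> W b (Suc l) X = mixture X (n (Suc l)) (mixture X (n l) N A) (emp_cov (n l) \<sigma>)"
      unfolding law[symmetric] using n by (intro network_law_Suc[OF g l L _ fin]) auto
    ultimately show "\<exists>N A. cov_mixture X (n (Suc l)) (limit_cov n\<^sub>0 \<sigma> X (Suc l)) (C' * (C + 1) * (\<Sum>i=1..<Suc l. 1 / real (n i))) N A \<and>
      network_law M n \<sigma> W b (Suc l) X = mixture X (n (Suc l)) N A" by blast
  qed
qed

text \<open>The expansion at the last limit covariance, averaged over the mixture, bounds all
  admissible tests by a multiple of the sum of inverse widths. What the posterior bound needs in
  addition is a second moment bound fixed before the widths are known.\<close>

lemma posterior_wasserstein1_rate:
  fixes x y :: "'i \<Rightarrow> vec" and X :: "vec set"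
  assumes fin: "finite X" "finite D" and x: "x ` D \<subseteq> X" and L: "L \<ge> 1" and n0: "n\<^sub>0 \<ge> 1" and nL: "n\<^sub>L \<ge> 1"
  obtains c where "c \<ge> 0"
    and "\<And>n (M :: 'w measure) W b. n 0 = n\<^sub>0 \<Longrightarrow> n L = n\<^sub>L \<Longrightarrow> \<forall>l\<in>{1..<L}. n l \<ge> 1 \<Longrightarrow> gaussian_params M n L W b \<Longrightarrow>
      wasserstein1 (output_dist n\<^sub>L X)
        (posterior (gaussian_likelihood n\<^sub>L D y) x (network_law M n \<sigma> W b L X))
        (posterior (gaussian_likelihood n\<^sub>L D y) x (limit_law n\<^sub>0 \<sigma> L n\<^sub>L X))
      \<le> ennreal (c * (\<Sum>l=1..<L. 1 / real (n l)))"
proof -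
  let ?K = "limit_cov n\<^sub>0 \<sigma> X L"
  let ?\<nu> = "gaussian_outputs n\<^sub>L X ?K"
  have psd: "psd_on X ?K" by (rule psd_limit_cov[OF fin(1) L])
  have "\<exists>C\<ge>0. \<forall>n (M :: 'w measure) W b L'. gaussian_params M n L' W b \<longrightarrow> n 0 = n\<^sub>0 \<longrightarrow> L \<le> L' \<longrightarrow>
    (\<forall>i\<le>L. n i \<ge> 1) \<longrightarrow> (\<exists>N A. cov_mixture X (n L) ?K (C * (\<Sum>i=1..<L. 1 / real (n i))) N A \<and>
      network_law M n \<sigma> W b L X = mixture X (n L) N A)"
    by (rule network_law_cov_mixture[OF fin(1) L])
  then obtain C where C: "C \<ge> 0" and net: "\<And>n (M :: 'w measure) W b L'. gaussian_params M n L' W b \<Longrightarrow> n 0 = n\<^sub>0 \<Longrightarrow> L \<le> L' \<Longrightarrow>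
    \<forall>i\<le>L. n i \<ge> 1 \<Longrightarrow> \<exists>N A. cov_mixture X (n L) ?K (C * (\<Sum>i=1..<L. 1 / real (n i))) N A \<and>
      network_law M n \<sigma> W b L X = mixture X (n L) N A" by blast
  obtain C1 where C1: "C1 \<ge> 0"
    and expan: "\<And>f. f \<in> borel_measurable (output_space n\<^sub>L X) \<Longrightarrow>
      (\<And>z. z \<in> space (output_space n\<^sub>L X) \<Longrightarrow> \<bar>f z\<bar> \<le> 1 + normsq n\<^sub>L X z) \<Longrightarrow>
      \<exists>l. first_order_at X ?K C1 (\<lambda>A. \<integral>z. f z \<partial>gaussian_outputs n\<^sub>L X A) l"
    using gaussian_outputs_expansion[OF fin(1) psd nL] by blast
  define C2 where "C2 = 2 * C1 * real (card X) ^ 4 * C"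
  have C2: "C2 \<ge> 0" using C C1 by (simp add: C2_def)
  define tr where "tr = real n\<^sub>L * (\<Sum>p\<in>X. ?K p p)"
  have tr0: "tr \<ge> 0" unfolding tr_def by (intro mult_nonneg_nonneg sum_nonneg psd_on_diag[OF psd fin(1)]) auto
  \<comment> \<open>\<open>normsq\<close> is itself an admissible test, so its mean under the
    network law exceeds the limit value \<open>tr\<close> by at most \<open>C2 * s\<close>, and
    \<open>s\<close> is at most \<open>L\<close>.\<close>
  have b0: "tr + C2 * real L \<ge> 0" using tr0 C2 by simp
  obtain C3 where C3: "C3 \<ge> 0" and post: "\<And>\<mu> \<nu> e. prob_space \<mu> \<Longrightarrow> sets \<mu> = sets (output_space n\<^sub>L X) \<Longrightarrow>
      prob_space \<nu> \<Longrightarrow> sets \<nu> = sets (output_space n\<^sub>L X) \<Longrightarrow>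
      integrable \<mu> (normsq n\<^sub>L X) \<Longrightarrow> (\<integral>z. normsq n\<^sub>L X z \<partial>\<mu>) \<le> tr + C2 * real L \<Longrightarrow>
      integrable \<nu> (normsq n\<^sub>L X) \<Longrightarrow> (\<integral>z. normsq n\<^sub>L X z \<partial>\<nu>) \<le> tr + C2 * real L \<Longrightarrow> e \<ge> 0 \<Longrightarrow>
      (\<And>f. f \<in> borel_measurable (output_space n\<^sub>L X) \<Longrightarrow>
        (\<And>z. z \<in> space (output_space n\<^sub>L X) \<Longrightarrow> \<bar>f z\<bar> \<le> 1 + normsq n\<^sub>L X z) \<Longrightarrow>
        \<bar>(\<integral>z. f z \<partial>\<mu>) - (\<integral>z. f z \<partial>\<nu>)\<bar> \<le> e) \<Longrightarrow>
      wasserstein1 (output_dist n\<^sub>L X) (posterior (gaussian_likelihood n\<^sub>L D y) x \<mu>)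
        (posterior (gaussian_likelihood n\<^sub>L D y) x \<nu>) \<le> ennreal (C3 * e)"
    using posterior_wasserstein1_bound[OF fin(2,1) x b0] by blast
  have main: "wasserstein1 (output_dist n\<^sub>L X)
        (posterior (gaussian_likelihood n\<^sub>L D y) x (network_law M n \<sigma> W b L X))
        (posterior (gaussian_likelihood n\<^sub>L D y) x (limit_law n\<^sub>0 \<sigma> L n\<^sub>L X))
      \<le> ennreal (C3 * C2 * (\<Sum>l=1..<L. 1 / real (n l)))"
    if n: "n 0 = n\<^sub>0" "n L = n\<^sub>L" "\<forall>l\<in>{1..<L}. n l \<ge> 1" and g: "gaussian_params M n L W b"
    for n and M :: "'w measure" and W b
  proof -
    define s where "s = (\<Sum>l=1..<L. 1 / real (n l))"
    have s0: "s \<ge> 0" by (simp add: s_def sum_nonneg)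
    have inv: "1 / real k \<le> 1" if "k \<ge> 1" for k using that by simp
    have "s \<le> (\<Sum>l=1..<L. 1)" unfolding s_def by (intro sum_mono inv) (use n(3) in auto)
    also have "\<dots> \<le> real L" by simp
    finally have sL: "s \<le> real L" .
    have n1: "\<forall>i\<le>L. n i \<ge> 1"
    proof (intro allI impI)
      fix i assume "i \<le> L"
      then consider "i = 0" | "i = L" | "i \<in> {1..<L}" by force
      then show "n i \<ge> 1" using n n0 nL by cases auto
    qed
    obtain N A where mix: "cov_mixture X n\<^sub>L ?K (C * s) N A" and law: "network_law M n \<sigma> W b L X = mixture X n\<^sub>L N A"
      using net[OF g n(1) order_refl n1] n(2) unfolding s_def by auto
    have test: "\<bar>(\<integral>z. f z \<partial>mixture X n\<^sub>L N A) - (\<integral>z. f z \<partial>?\<nu>)\<bar> \<le> C2 * s"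
      if f: "f \<in> borel_measurable (output_space n\<^sub>L X)"
        and fb: "\<And>z. z \<in> space (output_space n\<^sub>L X) \<Longrightarrow> \<bar>f z\<bar> \<le> 1 + normsq n\<^sub>L X z" for f
    proof -
      obtain l where l: "first_order_at X ?K C1 (\<lambda>A. \<integral>z. f z \<partial>gaussian_outputs n\<^sub>L X A) l"
        using expan[OF f fb] by blast
      note im = integral_mixture[OF fin(1) mix f fb]
      show ?thesis
        using integral_first_order[OF fin(1) mix borel_measurable_integrable[OF im(2)] C1 l] im(3)
        by (simp add: C2_def mult.assoc)
    qed
    have nsb: "\<bar>normsq n\<^sub>L X z\<bar> \<le> 1 + normsq n\<^sub>L X z" for z using normsq_nonneg[of n\<^sub>L X z] by simp
    have ns\<nu>: "(\<integral>z. normsq n\<^sub>L X z \<partial>?\<nu>) = tr" unfolding tr_def by (rule integral_normsq(2)[OF fin(1) psd])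
    have "C2 * s \<le> C2 * real L" using sL C2 by (rule mult_left_mono)
    moreover have "(\<integral>z. normsq n\<^sub>L X z \<partial>mixture X n\<^sub>L N A) \<le> tr + C2 * s"
      using test[OF normsq_measurable nsb] unfolding ns\<nu> by linarith
    ultimately have ns\<mu>: "(\<integral>z. normsq n\<^sub>L X z \<partial>mixture X n\<^sub>L N A) \<le> tr + C2 * real L" by linarith
    have "wasserstein1 (output_dist n\<^sub>L X) (posterior (gaussian_likelihood n\<^sub>L D y) x (mixture X n\<^sub>L N A))
        (posterior (gaussian_likelihood n\<^sub>L D y) x ?\<nu>) \<le> ennreal (C3 * (C2 * s))"
    proof (rule post[OF prob_space_mixture[OF fin(1) mix] sets_mixture[OF fin(1) mix]
          prob_space_gaussian_outputs[OF fin(1) psd] sets_gaussian_outputs[OF fin(1) psd]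
          integral_mixture(1)[OF fin(1) mix normsq_measurable nsb] ns\<mu> integral_normsq(1)[OF fin(1) psd] _ _ test])
      show "(\<integral>z. normsq n\<^sub>L X z \<partial>?\<nu>) \<le> tr + C2 * real L" using ns\<nu> C2 by simp
      show "0 \<le> C2 * s" using C2 s0 by simp
    qed
    then show ?thesis by (simp add: law limit_law_def s_def mult.assoc)
  qed
  have "C3 * C2 \<ge> 0" using C2 C3 by simp
  from that[OF this main] show ?thesis .
qed

end

theorem corollary1p2:
  fixes L n\<^sub>0 n\<^sub>L :: nat
    and \<sigma> :: "real \<Rightarrow> real"
    and D T :: "'i set"
    and x y :: "'i \<Rightarrow> vec"
    and X :: "vec set"
  assumes "L \<ge> 1" and "n\<^sub>0 \<ge> 1" and "n\<^sub>L \<ge> 1"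
    and "\<exists>C. C-lipschitz_on UNIV \<sigma>"
    and "finite D" and "finite T"
    and "\<forall>i\<in>D \<union> T. x i \<in> {..<n\<^sub>0} \<rightarrow>\<^sub>E UNIV"
    and "\<forall>i\<in>D. y i \<in> {..<n\<^sub>L} \<rightarrow>\<^sub>E UNIV"
    and "X = x ` D \<union> x ` T"
  shows
    "((\<forall>l\<in>{1..L}. invertible_matrix_on X (limit_cov n\<^sub>0 \<sigma> X l)) \<longrightarrow>
      (\<exists>c::real. c \<ge> 0 \<and>
        (\<forall>n (M :: 'w measure) W b.
          n 0 = n\<^sub>0 \<longrightarrow> n L = n\<^sub>L \<longrightarrow> (\<forall>l\<in>{1..<L}. n l \<ge> 1) \<longrightarrow> gaussian_params M n L W b \<longrightarrow>
          wasserstein1 (output_dist n\<^sub>L X)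
            (posterior (gaussian_likelihood n\<^sub>L D y) x (network_law M n \<sigma> W b L X))
            (posterior (gaussian_likelihood n\<^sub>L D y) x (limit_law n\<^sub>0 \<sigma> L n\<^sub>L X))
          \<le> ennreal (c * (\<Sum>l=1..<L. 1 / real (n l))))))
     \<and>
     (\<exists>c::real. c \<ge> 0 \<and>
        (\<forall>n (M :: 'w measure) W b.
          n 0 = n\<^sub>0 \<longrightarrow> n L = n\<^sub>L \<longrightarrow> (\<forall>l\<in>{1..<L}. n l \<ge> 1) \<longrightarrow> gaussian_params M n L W b \<longrightarrow>
          wasserstein1 (output_dist n\<^sub>L X)
            (posterior (gaussian_likelihood n\<^sub>L D y) x (network_law M n \<sigma> W b L X))
            (posterior (gaussian_likelihood n\<^sub>L D y) x (limit_law n\<^sub>0 \<sigma> L n\<^sub>L X))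
          \<le> ennreal (c * (\<Sum>l=1..<L. 1 / sqrt (real (n l))))))"
proof -
  obtain Lip where "Lip-lipschitz_on UNIV \<sigma>" using assms(4) by blast
  then interpret lipschitz_activation \<sigma> Lip by unfold_locales
  have "finite X" "x ` D \<subseteq> X" using assms(5,6,9) by auto
  then obtain c where c: "c \<ge> 0"
    and rate: "\<And>n (M :: 'w measure) W b. n 0 = n\<^sub>0 \<Longrightarrow> n L = n\<^sub>L \<Longrightarrow> \<forall>l\<in>{1..<L}. n l \<ge> 1 \<Longrightarrow> gaussian_params M n L W b \<Longrightarrow>
      wasserstein1 (output_dist n\<^sub>L X)
        (posterior (gaussian_likelihood n\<^sub>L D y) x (network_law M n \<sigma> W b L X))
        (posterior (gaussian_likelihood n\<^sub>L D y) x (limit_law n\<^sub>0 \<sigma> L n\<^sub>L X))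
      \<le> ennreal (c * (\<Sum>l=1..<L. 1 / real (n l)))"
    using posterior_wasserstein1_rate[OF _ assms(5) _ assms(1,2,3)] by blast
  have le: "ennreal (c * (\<Sum>l=1..<L. 1 / real (n l))) \<le> ennreal (c * (\<Sum>l=1..<L. 1 / sqrt (real (n l))))"
    if "\<forall>l\<in>{1..<L}. n l \<ge> 1" for n :: "nat \<Rightarrow> nat"
  proof (intro ennreal_leI mult_left_mono sum_mono c)
    fix l assume "l \<in> {1..<L}"
    then have "real (n l) \<ge> 1" using that by simp
    then have "sqrt (real (n l)) \<le> real (n l)" "sqrt (real (n l)) > 0"
      using real_sqrt_le_mono[of "real (n l)" "real (n l) ^ 2"] by (simp_all add: power2_eq_square)
    then show "1 / real (n l) \<le> 1 / sqrt (real (n l))" by (intro divide_left_mono) auto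
  qed
  show ?thesis
  proof (intro conjI impI exI[of _ c] c allI)
  qed (use rate order_trans[OF rate le] in blast)+
qed

end
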